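(* For all sufficiently large integers $n$, \[ r_{1,1}(n) > r_{2,1}(n) \quad\text{and}\quad r_{1,2}(n) < r_{2,2}(n). \]
   Context: A partition $\lambda=(\lambda_1\ge \lambda_2\ge\cdots\ge\lambda_k)$ of $n$ is a weakly decreasing sequence of positive integers summing to $n$; its conjugate is $\lambda'$ with $\lambda'_j=\#\{i:\lambda_i\ge j\}$. For the cell in row $i$ and column $j$ of the Young diagram of $\lambda$ (so $1\le j\le \lambda_i$), its hook length is $h(i,j)=\lambda_i+\lambda'_j-i-j+1$. A $t$-hook of $\lambda$ is a cell with hook length $t$. For a positive integer $t$, $r_{1,t}(n)$ denotes the total number of $t$-hooks, summed over all partitions of $n$ whose consecutive parts differ by at least $2$ (i.e. $\lambda_i-\lambda_{i+1}\ge 2$ for all $1\le i<k$), and $r_{2,t}(n)$ denotes the total number of $t$-hooks, summed over all partitions of $n$ all of whose parts are congruent to $1$ or $4$ modulo $5$. *)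

theory Defs
  imports Complex_Main
begin

definition is_partition :: "nat \<Rightarrow> nat list \<Rightarrow> bool" where
  "is_partition n l \<longleftrightarrow> sorted_wrt (\<ge>) l \<and> (\<forall>x\<in>set l. 0 < x) \<and> sum_list l = n"

text \<open>Rows, columns and parts are numbered from 1, whereas list positions start at 0.\<close>

definition part :: "nat list \<Rightarrow> nat \<Rightarrow> nat" where
  "part l i = l ! (i - 1)"

definition conj_part :: "nat list \<Rightarrow> nat \<Rightarrow> nat" where
  "conj_part l j = card {i. 1 \<le> i \<and> i \<le> length l \<and> j \<le> part l i}"

definition cells :: "nat list \<Rightarrow> (nat \<times> nat) set" where
  "cells l = {(i, j). 1 \<le> i \<and> i \<le> length l \<and> 1 \<le> j \<and> j \<le> part l i}"

text \<open>The subtractions do not truncate when \<open>l\<close> is a partition and \<open>(i, j)\<close> is one of its cells,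
  since then \<open>j \<le> part l i\<close> and \<open>i \<le> conj_part l j\<close>.\<close>

definition hook_length :: "nat list \<Rightarrow> nat \<Rightarrow> nat \<Rightarrow> nat" where
  "hook_length l i j = part l i + conj_part l j - i - j + 1"

definition num_hooks :: "nat \<Rightarrow> nat list \<Rightarrow> nat" where
  "num_hooks t l = card {(i, j). (i, j) \<in> cells l \<and> hook_length l i j = t}"

definition gap_two :: "nat list \<Rightarrow> bool" where
  "gap_two l \<longleftrightarrow> (\<forall>i. 1 \<le> i \<and> i < length l \<longrightarrow> part l (i + 1) + 2 \<le> part l i)"

definition parts_1_4_mod_5 :: "nat list \<Rightarrow> bool" where
  "parts_1_4_mod_5 l \<longleftrightarrow> (\<forall>x\<in>set l. x mod 5 = 1 \<or> x mod 5 = 4)"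

definition r1 :: "nat \<Rightarrow> nat \<Rightarrow> nat" where
  "r1 t n = (\<Sum>l | is_partition n l \<and> gap_two l. num_hooks t l)"

definition r2 :: "nat \<Rightarrow> nat \<Rightarrow> nat" where
  "r2 t n = (\<Sum>l | is_partition n l \<and> parts_1_4_mod_5 l. num_hooks t l)"

text \<open>The sums and cardinalities above range over finite sets, so none of them is a default value.\<close>

lemma finite_partitions: "finite {l. is_partition n l}"
proof (rule finite_subset)
  have "length l \<le> sum_list l" if "\<forall>x\<in>set l. 0 < x" for l :: "nat list"
    using that by (induction l) auto
  then show "{l. is_partition n l} \<subseteq> {l. set l \<subseteq> {..n} \<and> length l \<le> n}"
    by (auto simp: is_partition_def member_le_sum_list)
  show "finite {l. set l \<subseteq> {..n} \<and> length l \<le> n}"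
    by (rule finite_lists_length_le) simp
qed

lemma finite_cells: "finite (cells l)"
proof -
  have "cells l = (SIGMA i:{1..length l}. {1..part l i})"
    by (auto simp: cells_def)
  then show ?thesis by simp
qed

lemma finite_conj_part: "finite {i. 1 \<le> i \<and> i \<le> length l \<and> j \<le> part l i}"
  by (rule finite_subset[of _ "{..length l}"]) auto

lemma le_conj_part:
  assumes "is_partition n l" "(i, j) \<in> cells l"
  shows "i \<le> conj_part l j"
proof -
  have "part l i \<le> part l k" if "1 \<le> k" "k \<le> i" for k
  proof (cases "k = i")
    case False
    with that assms have "k - 1 < i - 1" "i - 1 < length l"
      by (auto simp: cells_def)
    with assms(1) show ?thesis
      by (simp add: is_partition_def part_def sorted_wrt_iff_nth_less)
  qed simp
  with assms(2) have "{1..i} \<subseteq> {i. 1 \<le> i \<and> i \<le> length l \<and> j \<le> part l i}"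
    by (fastforce simp: cells_def)
  from card_mono[OF finite_conj_part this] show ?thesis
    by (simp add: conj_part_def)
qed

end

theory Submission
  imports "HOL-Analysis.Analysis" "HOL-Real_Asymp.Real_Asymp" Defs
begin

text \<open>
  In a partition with gaps at least 2, every part contributes exactly one 1-hook, and at most one
  2-hook. In a partition \<open>\<lambda>\<close> into parts \<open>\<plusminus>1\<close> modulo 5, the 1-hooks correspond to the distinct part sizes,
  and the 2-hooks to the sizes at least 2 together with the repeated sizes. By the first
  Rogers-Ramanujan identity both families have the same number \<open>a(n)\<close> of members; let \<open>G\<close> be the
  generating function. Put \<open>q = exp (-t)\<close> with \<open>t\<close> of order \<open>1/sqrt n\<close>. The terms
  \<open>q^(m^2)/(q;q)_m\<close> counting gap partitions with \<open>m\<close> parts increase geometrically as long as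
  \<open>x = q^m\<close> satisfies \<open>x^2 > 1 - x\<close> and decrease geometrically afterwards, so the number of parts
  concentrates near \<open>ln \<phi> / t = 0.481\<dots>/t\<close>, where \<open>\<phi>\<close> is the golden ratio. An exponential
  Markov inequality for the product side shows that the numbers of distinct sizes and of 2-hooks
  concentrate near \<open>0.4/t\<close> and \<open>0.6/t\<close>. The exceptional sets contain
  at most \<open>exp (n t) G(q) exp (-c/t)\<close> partitions, which is negligible: \<open>t ln G(exp (-t))\<close> converges and
  \<open>a\<close> is monotone, hence \<open>a(n) \<ge> exp (n t) G(q) exp (-\<epsilon>/t)\<close> for the right choice of \<open>t\<close>.
\<close>

section \<open>The first Rogers-Ramanujan identity\<close>

text \<open>A hook total is the size of the family times an average, so comparing averages decides
  the matter only because both families have the same size. The identity behind this is proved for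
  real \<open>q\<close> in (0,1) through finite versions in \<open>N\<close>; convergence enters
  only as \<open>N\<close> grows, and coefficients are compared at the end. The constants 0.4 and
  0.6 come from giving a partition of size \<open>n\<close> on the product side the probability
  \<open>q^n / G(q)\<close>. The multiplicities of the sizes are then independent, the size
  \<open>s\<close> occurs with probability \<open>q^s\<close> and is repeated with probability
  \<open>q^(2 s)\<close>. Summed over the residues 1 and 4 modulo 5 this gives about
  \<open>2/(5 t)\<close> and \<open>2/(10 t)\<close>. Since 0.4 < 0.48 < 0.6 with room to spare, the
  crude thresholds 0.44 < 0.45 and 0.52 < 0.55 suffice, and \<open>a(n)\<close> is needed only up to
  a factor \<open>exp (\<epsilon>/t)\<close>. Hence monotonicity of \<open>a\<close> can replace
  precise asymptotics. The rates \<open>c\<close> of the exceptional sets are fixed first, then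
  \<epsilon>, and \<epsilon> determines the constant value of \<open>n t^2\<close>, which lies
  slightly above its saddle point value.\<close>

definition qpoch :: "real \<Rightarrow> nat \<Rightarrow> real" where
  "qpoch q n = (\<Prod>i<n. 1 - q ^ Suc i)"

lemma qpoch_0 [simp]: "qpoch q 0 = 1"
  by (simp add: qpoch_def)

lemma qpoch_Suc: "qpoch q (Suc n) = qpoch q n * (1 - q ^ Suc n)"
  by (simp add: qpoch_def)

lemma one_minus_power_pos:
  fixes q :: real
  assumes "0 < q" "q < 1" "0 < n"
  shows "0 < 1 - q ^ n"
  using assms power_less_one_iff[of q n] by simp

lemma qpoch_pos:
  assumes "0 < q" "q < 1"
  shows "0 < qpoch q n"
  unfolding qpoch_def by (intro prod_pos ballI one_minus_power_pos assms) auto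

text \<open>A form of the q-Chu-Vandermonde sum. Multiplied by \<open>qpoch q M\<close>, it sorts
  the partitions with parts at most \<open>M + b\<close> by the largest \<open>j\<close> by
  \<open>j + b\<close> rectangle in their diagram. The induction uses a Pascal rule in
  \<open>M\<close> that raises \<open>b\<close>, hence the arbitrary \<open>b\<close>.\<close>

lemma durfee_rectangle_sum:
  assumes q: "0 < q" "q < 1"
  shows "(\<Sum>j\<le>M. q ^ (j * (j + b)) / (qpoch q (M - j) * qpoch q j * qpoch q (j + b)))
         = 1 / (qpoch q M * qpoch q (M + b))"
proof (induction M arbitrary: b)
  case 0
  show ?case by simp
next
  case (Suc M)
  define f where "f M b j = q ^ (j * (j + b)) / (qpoch q (M - j) * qpoch q j * qpoch q (j + b))" for M b j
  have nz [simp]: "qpoch q n \<noteq> 0" for n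
    using qpoch_pos[OF q, of n] by simp
  have nz' [simp]: "q ^ Suc n \<noteq> 1" for n
    using one_minus_power_pos[OF q, of "Suc n"] by simp
  have step: "(1 - q ^ Suc M) * f (Suc M) b j =
      (if j \<le> M then f M b j else 0)
      + (if j = 0 then 0 else q ^ (Suc M + b) * f M (Suc b) (j - 1))" if "j \<le> Suc M" for j
  proof -
    \<comment> \<open>The first summand cancels the last factor of
      \<open>qpoch q (Suc M - j)\<close>, the second that of \<open>qpoch q j\<close>; this is
      Pascal's rule.\<close>
    have split: "1 - q ^ Suc M = (1 - q ^ (Suc M - j)) + q ^ (Suc M - j) * (1 - q ^ j)"
      using that by (simp add: algebra_simps flip: power_add)
    have 1: "(1 - q ^ (Suc M - j)) * f (Suc M) b j = (if j \<le> M then f M b j else 0)"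
    proof (cases "j \<le> M")
      case True
      then have "Suc M - j = Suc (M - j)" by simp
      with True show ?thesis
        by (simp add: f_def qpoch_Suc del: power_Suc)
    qed (use that in \<open>auto simp: not_le le_Suc_eq\<close>)
    have 2: "q ^ (Suc M - j) * (1 - q ^ j) * f (Suc M) b j =
      (if j = 0 then 0 else q ^ (Suc M + b) * f M (Suc b) (j - 1))"
    proof (cases j)
      case (Suc i)
      have "i \<le> M" using that Suc by simp
      then have e: "q ^ (M - i) * q ^ (Suc i * (Suc i + b)) = q ^ (Suc M + b) * q ^ (i * (i + Suc b))"
        by (simp add: algebra_simps flip: power_add)
      have "q ^ (Suc M - j) * (1 - q ^ j) * f (Suc M) b j
          = (q ^ (M - i) * q ^ (Suc i * (Suc i + b))) * (1 - q ^ Suc i)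
              / (qpoch q (M - i) * qpoch q (Suc i) * qpoch q (Suc i + b))"
        by (simp add: f_def Suc)
      also have "\<dots> = q ^ (Suc M + b) * f M (Suc b) (j - 1)"
        unfolding e by (simp add: f_def Suc qpoch_Suc[of q i] del: power_Suc)
      finally show ?thesis using Suc by simp
    qed simp
    show ?thesis
      unfolding split distrib_right 1 2 by simp
  qed
  have "(1 - q ^ Suc M) * (\<Sum>j\<le>Suc M. f (Suc M) b j)
      = (\<Sum>j\<le>Suc M. if j \<le> M then f M b j else 0)
        + (\<Sum>j\<le>Suc M. if j = 0 then 0 else q ^ (Suc M + b) * f M (Suc b) (j - 1))"
    unfolding sum_distrib_left sum.distrib[symmetric] by (intro sum.cong refl step) simp
  also have "(\<Sum>j\<le>Suc M. if j \<le> M then f M b j else 0) = (\<Sum>j\<le>M. f M b j)"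
    by simp
  also have "(\<Sum>j\<le>Suc M. if j = 0 then 0 else q ^ (Suc M + b) * f M (Suc b) (j - 1))
      = q ^ (Suc M + b) * (\<Sum>j\<le>M. f M (Suc b) j)"
    unfolding sum.atMost_Suc_shift by (simp add: sum_distrib_left)
  also have "(\<Sum>j\<le>M. f M b j) = 1 / (qpoch q M * qpoch q (M + b))"
    unfolding f_def by (rule Suc.IH)
  also have "(\<Sum>j\<le>M. f M (Suc b) j) = 1 / (qpoch q M * qpoch q (M + Suc b))"
    unfolding f_def by (rule Suc.IH)
  also have "1 / (qpoch q M * qpoch q (M + b)) + q ^ (Suc M + b) * (1 / (qpoch q M * qpoch q (M + Suc b)))
      = 1 / (qpoch q M * qpoch q (Suc M + b))"
    using nz'[of "M + b"] by (simp add: qpoch_Suc field_simps del: nz')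
  finally have "(1 - q ^ Suc M) * (\<Sum>j\<le>Suc M. f (Suc M) b j) = 1 / (qpoch q M * qpoch q (Suc M + b))" .
  then have "(\<Sum>j\<le>Suc M. f (Suc M) b j) = 1 / (qpoch q (Suc M) * qpoch q (Suc M + b))"
    by (simp add: qpoch_Suc[of q M] field_simps del: power_Suc)
  then show ?case by (simp add: f_def)
qed

text \<open>A limiting case of Bailey's lemma: multiplying \<open>\<alpha> m\<close> by
  \<open>q ^ (m * m)\<close> turns the inner sums into the left-hand side, which has the same shape
  again. After exchanging the sums, the sum over \<open>s = m + j\<close> is a Durfee rectangle sum
  with \<open>b = m + m\<close>.\<close>

lemma bailey_step:
  assumes q: "0 < q" "q < 1"
  shows "(\<Sum>s\<le>N. q ^ (s * s) / qpoch q (N - s) * (\<Sum>m\<le>s. \<alpha> m / (qpoch q (s - m) * qpoch q (s + m))))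
       = (\<Sum>m\<le>N. q ^ (m * m) * \<alpha> m / (qpoch q (N - m) * qpoch q (N + m)))"
proof -
  have "(\<Sum>s\<le>N. q ^ (s * s) / qpoch q (N - s) * (\<Sum>m\<le>s. \<alpha> m / (qpoch q (s - m) * qpoch q (s + m))))
      = (\<Sum>s\<le>N. \<Sum>m\<le>s. \<alpha> m * (q ^ (s * s) / (qpoch q (N - s) * qpoch q (s - m) * qpoch q (s + m))))"
    by (simp add: sum_distrib_left mult_ac)
  also have "\<dots> = (\<Sum>m\<le>N. \<Sum>s\<in>{m..N}. \<alpha> m * (q ^ (s * s) / (qpoch q (N - s) * qpoch q (s - m) * qpoch q (s + m))))"
    unfolding sum.Sigma[OF finite_atMost ballI[OF finite_atMost]]
      sum.Sigma[OF finite_atMost ballI[OF finite_atLeastAtMost]]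
    by (rule sum.reindex_bij_witness[of _ "\<lambda>(m, s). (s, m)" "\<lambda>(s, m). (m, s)"]) auto
  also have "\<dots> = (\<Sum>m\<le>N. q ^ (m * m) * \<alpha> m / (qpoch q (N - m) * qpoch q (N + m)))"
  proof (intro sum.cong refl)
    fix m assume "m \<in> {..N}"
    then have m: "m \<le> N" by simp
    have "(\<Sum>s\<in>{m..N}. q ^ (s * s) / (qpoch q (N - s) * qpoch q (s - m) * qpoch q (s + m)))
        = (\<Sum>j\<le>N-m. q ^ (m * m) * (q ^ (j * (j + (m + m)))
             / (qpoch q ((N - m) - j) * qpoch q j * qpoch q (j + (m + m)))))"
    proof (rule sum.reindex_bij_witness[of _ "\<lambda>j. j + m" "\<lambda>s. s - m"])
      fix s assume s: "s \<in> {m..N}"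
      then obtain j where "s = m + j" using le_Suc_ex by auto
      then show "q ^ (m * m) * (q ^ ((s - m) * (s - m + (m + m)))
             / (qpoch q (N - m - (s - m)) * qpoch q (s - m) * qpoch q (s - m + (m + m))))
          = q ^ (s * s) / (qpoch q (N - s) * qpoch q (s - m) * qpoch q (s + m))"
        by (simp add: algebra_simps power_add)
    qed (use m in auto)
    also have "\<dots> = q ^ (m * m) * (1 / (qpoch q (N - m) * qpoch q (N - m + (m + m))))"
      unfolding sum_distrib_left[symmetric] durfee_rectangle_sum[OF q] ..
    finally have "(\<Sum>s\<in>{m..N}. q ^ (s * s) / (qpoch q (N - s) * qpoch q (s - m) * qpoch q (s + m)))
       = q ^ (m * m) * (1 / (qpoch q (N - m) * qpoch q (N - m + (m + m))))" .
    then show "(\<Sum>s\<in>{m..N}. \<alpha> m * (q ^ (s * s) / (qpoch q (N - s) * qpoch q (s - m) * qpoch q (s + m))))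
       = q ^ (m * m) * \<alpha> m / (qpoch q (N - m) * qpoch q (N + m))"
      using m by (simp only: flip: sum_distrib_left) (simp add: mult_ac)
  qed
  finally show ?thesis .
qed

text \<open>The \<alpha> of the unit Bailey pair relative to 1, whose \<beta> is 1 at index 0 and 0
  elsewhere. The factor \<open>1 + q ^ m\<close> joins the terms of index \<open>m\<close> and
  \<open>- m\<close> of a bilateral sum.\<close>

definition unit_alpha :: "real \<Rightarrow> nat \<Rightarrow> real" where
  "unit_alpha q m = (if m = 0 then 1 else (- 1) ^ m * q ^ (m * (m - 1) div 2) * (1 + q ^ m))"

lemma triangle_Suc: "Suc k * k div 2 + Suc k = Suc (Suc k) * Suc k div 2"
proof -
  have "Suc (Suc k) * Suc k = Suc k * k + 2 * Suc k" by simp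
  then show ?thesis by simp
qed

text \<open>The closed form of the partial sums, which vanishes for \<open>k = n\<close>, is what makes the orthogonality
  relation of the unit Bailey pair provable by induction.\<close>

lemma unit_bailey_partial_sum:
  assumes q: "0 < q" "q < 1" and "k < n"
  shows "(\<Sum>m\<le>k. unit_alpha q m / (qpoch q (n - m) * qpoch q (n + m)))
       = (- 1) ^ k * q ^ (Suc k * k div 2) / ((1 - q ^ n) * qpoch q (n - 1 - k) * qpoch q (n + k))"
  using \<open>k < n\<close>
proof (induction k)
  case 0
  then obtain n' where "n = Suc n'" by (cases n) auto
  then show ?case
    using qpoch_pos[OF q, of n'] one_minus_power_pos[OF q, of n] by (simp add: unit_alpha_def qpoch_Suc)
next
  case (Suc k)
  obtain d where n: "n = d + Suc (Suc k)"
    using Suc.prems by (metis Suc_leI le_Suc_ex add.commute)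
  define A where "A = qpoch q d"
  define B where "B = qpoch q (n + k)"
  define x where "x = q ^ Suc k"
  define y where "y = q ^ Suc d"
  have nz: "A \<noteq> 0" "B \<noteq> 0" "1 - y \<noteq> 0" "1 - x * y \<noteq> 0" "1 - x * (x * y) \<noteq> 0"
    using qpoch_pos[OF q, of d] qpoch_pos[OF q, of "n+k"] one_minus_power_pos[OF q, of "Suc d"]
       one_minus_power_pos[OF q, of "Suc k + Suc d"] one_minus_power_pos[OF q, of "Suc k + (Suc k + Suc d)"]
    by (simp_all only: A_def B_def x_def y_def power_add zero_less_Suc less_irrefl add_pos_pos
       order_less_imp_not_eq2 not_False_eq_True simp_thms)
  have e: "qpoch q (n - Suc k) = A * (1 - y)" "qpoch q (n + Suc k) = B * (1 - x * (x * y))"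
      "qpoch q (n - 1 - k) = A * (1 - y)" "qpoch q (n - 1 - Suc k) = A" "1 - q ^ n = 1 - x * y"
    by (simp_all add: n A_def B_def x_def y_def qpoch_Suc power_add mult_ac)
  have t: "q ^ (Suc (Suc k) * Suc k div 2) = q ^ (Suc k * k div 2) * x"
    by (simp only: x_def flip: triangle_Suc power_add)
  have u: "unit_alpha q (Suc k) = - ((- 1) ^ k * q ^ (Suc k * k div 2) * (1 + x))"
    by (simp add: unit_alpha_def x_def)
  have "(\<Sum>m\<le>Suc k. unit_alpha q m / (qpoch q (n - m) * qpoch q (n + m)))
     = (- 1) ^ k * q ^ (Suc k * k div 2) / ((1 - x * y) * (A * (1 - y)) * B)
       - (- 1) ^ k * q ^ (Suc k * k div 2) * (1 + x) / (A * (1 - y) * (B * (1 - x * (x * y))))"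
    using Suc by (simp only: sum.atMost_Suc Suc.IH[OF Suc_lessD] e u B_def[symmetric])
  \<comment> \<open>Over the common denominator this is
    \<open>(1 - x^2 y) - (1 + x) (1 - x y) = - x (1 - y)\<close>.\<close>
  also have "\<dots> = (- 1) ^ Suc k * (q ^ (Suc k * k div 2) * x) / ((1 - x * y) * A * (B * (1 - x * (x * y))))"
    using nz by (simp add: divide_simps) (simp add: algebra_simps)
  finally show ?case by (simp only: t e)
qed

text \<open>The closed form covers the terms below \<open>n\<close>; the last term
  \<open>m = n\<close> cancels it because \<open>1 - q ^ (n + n)\<close> factors as
  \<open>(1 - q ^ n) * (1 + q ^ n)\<close>.\<close>

lemma unit_bailey_pair:
  assumes q: "0 < q" "q < 1"
  shows "(\<Sum>m\<le>n. unit_alpha q m / (qpoch q (n - m) * qpoch q (n + m))) = (if n = 0 then 1 else 0)"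
proof (cases n)
  case (Suc k)
  have nz: "qpoch q (n + k) \<noteq> 0" "1 - q ^ n \<noteq> 0" "1 - q ^ (n + n) \<noteq> 0"
    using qpoch_pos[OF q, of "n+k"] one_minus_power_pos[OF q, of n] one_minus_power_pos[OF q, of "n+n"] Suc
    by auto
  have f: "1 - q ^ (n + n) = (1 - q ^ n) * (1 + q ^ n)"
    by (simp add: algebra_simps power_add)
  have "(\<Sum>m\<le>Suc k. unit_alpha q m / (qpoch q (n - m) * qpoch q (n + m)))
     = (- 1) ^ k * q ^ (n * k div 2) / ((1 - q ^ n) * qpoch q (n + k))
       - (- 1) ^ k * q ^ (n * k div 2) * (1 + q ^ n) / (qpoch q (n + k) * (1 - q ^ (n + n)))"
    using unit_bailey_partial_sum[OF q, of k n] Suc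
    by (simp add: unit_alpha_def qpoch_Suc[of q "k + Suc k", simplified])
  also have "\<dots> = 0"
    using nz unfolding f by (simp add: divide_simps)
  finally show ?thesis using Suc by simp
qed (simp add: unit_alpha_def)

text \<open>The exponents are \<open>m (5 m - 1) / 2\<close> and \<open>m (5 m + 1) / 2\<close>, so
  this is a theta series whose triple product has base \<open>q ^ 5\<close>.\<close>

definition rr_theta :: "real \<Rightarrow> nat \<Rightarrow> real" where
  "rr_theta q m = q ^ (2 * (m * m)) * unit_alpha q m"

text \<open>Two Bailey steps applied to the unit pair; each multiplies \<open>\<alpha> m\<close> by \<open>q^(m^2)\<close>.\<close>

lemma finite_rogers_ramanujan:
  assumes q: "0 < q" "q < 1"
  shows "(\<Sum>s\<le>N. q ^ (s * s) / (qpoch q (N - s) * qpoch q s))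
       = (\<Sum>m\<le>N. rr_theta q m / (qpoch q (N - m) * qpoch q (N + m)))"
proof -
  \<comment> \<open>The first Bailey step, on the unit pair: only \<open>r = 0\<close> survives. The
    resulting pair is the input of the second step.\<close>
  have 1: "(\<Sum>m\<le>s. q ^ (m * m) * unit_alpha q m / (qpoch q (s - m) * qpoch q (s + m))) = 1 / qpoch q s" for s
  proof -
    have "(\<Sum>m\<le>s. q ^ (m * m) * unit_alpha q m / (qpoch q (s - m) * qpoch q (s + m)))
       = (\<Sum>r\<le>s. if r = 0 then 1 / qpoch q s else 0)"
      unfolding bailey_step[OF q, symmetric] unit_bailey_pair[OF q] by (intro sum.cong) auto
    then show ?thesis by simp
  qed
  show ?thesis
    using bailey_step[OF q, of N "\<lambda>m. q ^ (m * m) * unit_alpha q m"] unfolding 1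
    by (simp add: rr_theta_def mult_2 power_add mult.assoc)
qed

section \<open>A finite Jacobi triple product\<close>

definition tri :: "nat \<Rightarrow> nat" where "tri j = j * (j - 1) div 2"

lemma tri_Suc: "tri (Suc j) = tri j + j"
proof (cases j)
  case (Suc i)
  have "Suc j * j = j * (j - 1) + 2 * j" using Suc by simp
  then show ?thesis by (simp add: tri_def)
qed (simp add: tri_def)

lemma tri_0 [simp]: "tri 0 = 0" by (simp add: tri_def)

lemma double_tri: "2 * tri j + j = j * j"
  by (induction j) (auto simp: tri_Suc)

text \<open>Rothe's finite q-binomial theorem divided by \<open>qpoch q M\<close>. Splitting
  \<open>1 - q ^ Suc M\<close> as in \<open>durfee_rectangle_sum\<close> makes one more factor
  \<open>1 + x * q ^ M\<close> appear.\<close>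

lemma q_binomial:
  assumes q: "0 < q" "q < 1"
  shows "(\<Sum>j\<le>M. q ^ tri j * x ^ j / (qpoch q j * qpoch q (M - j))) = (\<Prod>i<M. 1 + x * q ^ i) / qpoch q M"
proof (induction M)
  case (Suc M)
  define g where "g M j = q ^ tri j * x ^ j / (qpoch q j * qpoch q (M - j))" for M j
  have nz [simp]: "qpoch q n \<noteq> 0" for n
    using qpoch_pos[OF q, of n] by simp
  have nz' [simp]: "q ^ Suc n \<noteq> 1" for n
    using one_minus_power_pos[OF q, of "Suc n"] by simp
  have step: "(1 - q ^ Suc M) * g (Suc M) j =
      (if j \<le> M then g M j else 0) + (if j = 0 then 0 else x * q ^ M * g M (j - 1))"
    if "j \<le> Suc M" for j
  proof -
    have split: "1 - q ^ Suc M = (1 - q ^ (Suc M - j)) + q ^ (Suc M - j) * (1 - q ^ j)"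
      using that by (simp add: algebra_simps flip: power_add)
    have 1: "(1 - q ^ (Suc M - j)) * g (Suc M) j = (if j \<le> M then g M j else 0)"
    proof (cases "j \<le> M")
      case True
      then have "Suc M - j = Suc (M - j)" by simp
      with True show ?thesis
        by (simp add: g_def qpoch_Suc del: power_Suc)
    qed (use that in \<open>auto simp: not_le le_Suc_eq\<close>)
    have 2: "q ^ (Suc M - j) * (1 - q ^ j) * g (Suc M) j = (if j = 0 then 0 else x * q ^ M * g M (j - 1))"
    proof (cases j)
      case (Suc i)
      have "i \<le> M" using that Suc by simp
      then have e: "q ^ (M - i) * q ^ tri (Suc i) = q ^ M * q ^ tri i"
        by (simp add: tri_Suc flip: power_add)
      have "q ^ (Suc M - j) * (1 - q ^ j) * g (Suc M) j
          = (q ^ (M - i) * q ^ tri (Suc i)) * (1 - q ^ Suc i) * x ^ Suc i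
              / (qpoch q (Suc i) * qpoch q (M - i))"
        by (simp add: g_def Suc)
      also have "\<dots> = x * q ^ M * g M (j - 1)"
        unfolding e by (simp add: g_def Suc qpoch_Suc[of q i] power_Suc[of x] del: power_Suc)
      finally show ?thesis using Suc by simp
    qed simp
    show ?thesis
      unfolding split distrib_right 1 2 by simp
  qed
  have "(1 - q ^ Suc M) * (\<Sum>j\<le>Suc M. g (Suc M) j)
      = (\<Sum>j\<le>Suc M. if j \<le> M then g M j else 0)
        + (\<Sum>j\<le>Suc M. if j = 0 then 0 else x * q ^ M * g M (j - 1))"
    unfolding sum_distrib_left sum.distrib[symmetric] by (intro sum.cong refl step) simp
  also have "(\<Sum>j\<le>Suc M. if j \<le> M then g M j else 0) = (\<Sum>j\<le>M. g M j)"
    by simp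
  also have "(\<Sum>j\<le>Suc M. if j = 0 then 0 else x * q ^ M * g M (j - 1)) = x * q ^ M * (\<Sum>j\<le>M. g M j)"
    unfolding sum.atMost_Suc_shift by (simp add: sum_distrib_left)
  also have "(\<Sum>j\<le>M. g M j) = (\<Prod>i<M. 1 + x * q ^ i) / qpoch q M"
    unfolding g_def by (rule Suc.IH)
  finally have "(1 - q ^ Suc M) * (\<Sum>j\<le>Suc M. g (Suc M) j) = (\<Prod>i<Suc M. 1 + x * q ^ i) / qpoch q M"
    by (simp only: prod.lessThan_Suc distrib_left distrib_right mult_1_left add_divide_distrib mult_1_right
        times_divide_eq_right times_divide_eq_left mult_ac)
  moreover have "S = X / (a * b)" if "b * S = X / a" "a \<noteq> 0" "b \<noteq> 0" for a b S X :: real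
    using that by (auto simp: field_simps)
  ultimately have "(\<Sum>j\<le>Suc M. g (Suc M) j) = (\<Prod>i<Suc M. 1 + x * q ^ i) / qpoch q (Suc M)"
    unfolding qpoch_Suc[of q M] using nz nz' by (metis right_minus_eq)
  then show ?case by (simp only: g_def)
qed simp

text \<open>A bilateral sum over \<open>- N .. N\<close>, shifted by \<open>N\<close> into the
  naturals and folded at its centre, which must be counted only once.\<close>

lemma sum_fold_symmetric:
  fixes h :: "nat \<Rightarrow> real"
  shows "(\<Sum>j\<le>N + N. h j) = (\<Sum>m\<le>N. if m = 0 then h N else h (N + m) + h (N - m))"
proof -
  have "(\<Sum>j\<le>N + N. h j) = (\<Sum>j<N. h j) + (\<Sum>j\<in>{N..N+N}. h j)"
    by (subst sum.union_disjoint[symmetric]) (auto intro!: sum.cong)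
  also have "(\<Sum>j<N. h j) = (\<Sum>m\<in>{1..N}. h (N - m))"
    by (rule sum.reindex_bij_witness[of _ "\<lambda>m. N - m" "\<lambda>j. N - j"]) auto
  also have "(\<Sum>j\<in>{N..N+N}. h j) = (\<Sum>m\<le>N. h (N + m))"
    by (rule sum.reindex_bij_witness[of _ "\<lambda>m. N + m" "\<lambda>j. j - N"]) auto
  finally have 1: "(\<Sum>j\<le>N + N. h j) = (\<Sum>m\<in>{1..N}. h (N - m)) + (\<Sum>m\<le>N. h (N + m))" .
  have 2: "(\<Sum>m\<in>{1..N}. if m = 0 then h N else h (N + m) + h (N - m))
      = (\<Sum>m\<in>{1..N}. h (N + m) + h (N - m))"
    by (rule sum.cong) auto
  have 3: "{..N} = insert 0 {1..N}" by auto
  show ?thesis unfolding 1 unfolding 3 using 2 by (simp add: sum.distrib)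
qed

text \<open>The \<open>q\<close>-binomial theorem for base \<open>q^5\<close>, \<open>2 N\<close> factors and \<open>x = - q^(2 - 5 N)\<close>, with the indices
  \<open>N + m\<close> and \<open>N - m\<close> paired.\<close>

lemma finite_jacobi_triple:
  assumes q: "0 < q" "q < 1"
  shows "(\<Sum>m\<le>N. rr_theta q m / (qpoch (q ^ 5) (N - m) * qpoch (q ^ 5) (N + m)))
       = (\<Prod>i<N. (1 - q ^ (5 * i + 2)) * (1 - q ^ (5 * i + 3))) / qpoch (q ^ 5) (N + N)"
proof -
  define Q where "Q = q ^ 5"
  have Q: "0 < Q" "Q < 1"
    using q by (auto simp: Q_def power_less_one_iff)
  \<comment> \<open>This factor gives the central term, of index \<open>N\<close>, the numerator 1.
    It is also what clears the negative powers of \<open>q\<close> on the product side.\<close>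
  define c where "c = (- 1) ^ N * q ^ (5 * tri (Suc N)) / q ^ (2 * N)"
  define x where "x = - (q ^ 2 / q ^ (5 * N))"
  have qnz [simp]: "q \<noteq> 0" using q by simp
  define h where "h j = c * (Q ^ tri j * x ^ j) / (qpoch Q j * qpoch Q (N + N - j))" for j
  \<comment> \<open>As \<open>x\<close> contains a negative power of \<open>q\<close>, exponents are
    compared in the naturals after moving \<open>5 * N * j + 2 * N\<close> to the other
    side.\<close>
  have summand: "c * (Q ^ tri j * x ^ j) = (- 1) ^ m * q ^ e"
    if "5 * tri j + 2 * j + 5 * tri (Suc N) = 5 * N * j + 2 * N + e" "(- 1) ^ m = ((- 1) ^ (N + j) :: real)" for j e m
  proof -
    have "c * (Q ^ tri j * x ^ j) = (- 1) ^ (N + j) * q ^ (5 * tri j + 2 * j + 5 * tri (Suc N)) / q ^ (5 * N * j + 2 * N)"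
      by (simp add: c_def Q_def x_def power_minus[of "_ / _"] power_divide power_mult[symmetric] power_add mult_ac)
    also have "\<dots> = (- 1) ^ (N + j) * q ^ e"
      unfolding that(1) by (simp add: power_add)
    finally show ?thesis by (simp add: that(2))
  qed
  \<comment> \<open>Doubling removes the halves hidden in \<open>tri\<close>, so that
    \<open>double_tri\<close> applies.\<close>
  have cancel2: "a = b" if "2 * a = 2 * b" for a b :: nat
    using that by simp
  have "rr_theta q m / (qpoch Q (N - m) * qpoch Q (N + m)) = (if m = 0 then h N else h (N + m) + h (N - m))"
    if m: "m \<le> N" for m
  proof -
    have t: "2 * tri N + N = N * N" "2 * tri (Suc N) = N * N + N" "2 * tri m + m = m * m"
      using double_tri[of N] double_tri[of m] by (auto simp: tri_Suc)
    have "c * (Q ^ tri (N + m) * x ^ (N + m)) = (- 1) ^ m * q ^ (2 * (m * m) + tri m)"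
    proof (rule summand)
      have "2 * tri (N + m) + (N + m) = (N + m) * (N + m)" by (rule double_tri)
      with t have "2 * (5 * tri (N + m) + 2 * (N + m) + 5 * tri (Suc N)) = 2 * (5 * N * (N + m) + 2 * N + (2 * (m * m) + tri m))"
        by (simp add: algebra_simps)
      then show "5 * tri (N + m) + 2 * (N + m) + 5 * tri (Suc N) = 5 * N * (N + m) + 2 * N + (2 * (m * m) + tri m)"
        by (rule cancel2)
    qed (simp add: power_add flip: power_mult_distrib)
    then have 1: "h (N + m) = (- 1) ^ m * q ^ (2 * (m * m) + tri m) / (qpoch Q (N + m) * qpoch Q (N - m))"
      by (simp add: h_def)
    obtain j where N: "N = j + m" using m by (metis add.commute le_Suc_ex)
    have "c * (Q ^ tri j * x ^ j) = (- 1) ^ m * q ^ (2 * (m * m) + tri m + m)"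
    proof (rule summand)
      have "2 * tri j + j = j * j" by (rule double_tri)
      with t N have "2 * (5 * tri j + 2 * j + 5 * tri (Suc N)) = 2 * (5 * N * j + 2 * N + (2 * (m * m) + tri m + m))"
        by (simp add: algebra_simps)
      then show "5 * tri j + 2 * j + 5 * tri (Suc N) = 5 * N * j + 2 * N + (2 * (m * m) + tri m + m)"
        by (rule cancel2)
      show "(- 1) ^ m = ((- 1) ^ (N + j) :: real)"
        by (simp add: N power_add mult_ac flip: power_mult_distrib)
    qed
    then have 2: "h (N - m) = (- 1) ^ m * q ^ (2 * (m * m) + tri m + m) / (qpoch Q (N - m) * qpoch Q (N + m))"
      using N by (simp add: h_def add_ac)
    show ?thesis
    proof (cases "m = 0")
      case True
      then show ?thesis using 1 by (simp add: rr_theta_def unit_alpha_def)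
    next
      case False
      then show ?thesis
        unfolding 1 2 rr_theta_def unit_alpha_def tri_def[symmetric]
        by (simp add: power_add algebra_simps add_divide_distrib)
    qed
  qed
  then have "(\<Sum>m\<le>N. rr_theta q m / (qpoch Q (N - m) * qpoch Q (N + m))) = (\<Sum>j\<le>N + N. h j)"
    unfolding sum_fold_symmetric by (intro sum.cong) auto
  also have "\<dots> = c * (\<Sum>j\<le>N + N. Q ^ tri j * x ^ j / (qpoch Q j * qpoch Q (N + N - j)))"
    by (simp add: h_def sum_distrib_left)
  also have "\<dots> = c * (\<Prod>i<N + N. 1 + x * Q ^ i) / qpoch Q (N + N)"
    unfolding q_binomial[OF Q] by simp
  also have "(\<Prod>i<N + N. 1 + x * Q ^ i) = (\<Prod>i<N. 1 + x * Q ^ i) * (\<Prod>i<N. 1 - q ^ (5 * i + 2))"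
  \<comment> \<open>The factors with \<open>i\<close> at least \<open>N\<close> have positive
    exponents and give the residue 2 modulo 5. Those below \<open>N\<close> have negative exponents;
    taken in reverse order they will give the residue 3.\<close>
  proof -
    have "(\<Prod>i<N + N. 1 + x * Q ^ i) = (\<Prod>i<N. 1 + x * Q ^ i) * (\<Prod>i\<in>{N..<N+N}. 1 + x * Q ^ i)"
      by (subst prod.union_disjoint[symmetric]) (auto intro!: prod.cong)
    also have "(\<Prod>i\<in>{N..<N+N}. 1 + x * Q ^ i) = (\<Prod>i<N. 1 - q ^ (5 * i + 2))"
      by (rule prod.reindex_bij_witness[of _ "\<lambda>i. N + i" "\<lambda>i. i - N"])
         (auto simp: x_def Q_def power_mult[symmetric] power_add[symmetric] algebra_simps divide_simps)
    finally show ?thesis .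
  qed
  also have "(\<Prod>i<N. 1 + x * Q ^ i) = (\<Prod>k<N. 1 - q ^ 2 / q ^ (5 * Suc k))"
  proof (rule prod.reindex_bij_witness[of _ "\<lambda>i. N - 1 - i" "\<lambda>i. N - 1 - i"])
    fix i assume "i \<in> {..<N}"
    then obtain d where d: "N = Suc i + d" by (metis lessThan_iff Suc_leI le_Suc_ex)
    then have "q ^ (5 * N) = q ^ (5 * Suc d) * q ^ (5 * i)"
      by (simp add: add_ac flip: power_add)
    then show "1 - q\<^sup>2 / q ^ (5 * Suc (N - 1 - i)) = 1 + x * Q ^ i"
      by (simp only: x_def Q_def flip: power_mult) (simp add: d)
  qed auto
  also have "c * ((\<Prod>k<N. 1 - q ^ 2 / q ^ (5 * Suc k)) * (\<Prod>i<N. 1 - q ^ (5 * i + 2)))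
      = (\<Prod>i<N. (1 - q ^ (5 * i + 2)) * (1 - q ^ (5 * i + 3)))"
  proof -
    \<comment> \<open>\<open>c\<close> is the product of the factors
      \<open>- q ^ (5 * Suc k) / q ^ 2\<close>, each of which turns
      \<open>1 - q ^ 2 / q ^ (5 * Suc k)\<close> into \<open>1 - q ^ (5 * k + 3)\<close>.\<close>
    have "(- 1) ^ n * q ^ (5 * tri (Suc n)) / q ^ (2 * n) * (\<Prod>k<n. 1 - q ^ 2 / q ^ (5 * Suc k)) = (\<Prod>i<n. 1 - q ^ (5 * i + 3))" for n
    proof (induction n)
      case (Suc n)
      have 1: "- (q ^ (5 * Suc n) / q ^ 2) * (1 - q ^ 2 / q ^ (5 * Suc n)) = 1 - q ^ (5 * n + 3)"
        by (simp add: field_simps power_add)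
      have 2: "(- 1) ^ Suc n * q ^ (5 * tri (Suc (Suc n))) / q ^ (2 * Suc n)
          = ((- 1) ^ n * q ^ (5 * tri (Suc n)) / q ^ (2 * n)) * (- (q ^ (5 * Suc n) / q ^ 2))"
        unfolding tri_Suc[of "Suc n"] distrib_left power_add mult_Suc_right[of 2] by (simp add: mult_ac)
      show ?case
        unfolding prod.lessThan_Suc 2 Suc.IH[symmetric] 1[symmetric] by (simp only: mult_ac)
    qed (simp add: tri_Suc)
    then show ?thesis
      by (simp add: c_def prod.distrib mult_ac)
  qed
  finally show ?thesis by (simp add: Q_def)
qed

section \<open>Letting \<open>N\<close> tend to infinity in the finite identities\<close>

lemma qpoch_limit:
  assumes q: "0 < q" "q < 1"
  obtains L where "0 < L" "qpoch q \<longlonglongrightarrow> L" "\<And>n. L \<le> qpoch q n"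
proof -
  have "summable (\<lambda>i. norm ((1 - q ^ Suc i) - 1))"
    using q by (auto intro!: summable_mult summable_geometric)
  then have cp: "convergent_prod (\<lambda>i. 1 - q ^ Suc i)"
    by (intro abs_convergent_prod_imp_convergent_prod summable_imp_abs_convergent_prod)
  define L where "L = prodinf (\<lambda>i. 1 - q ^ Suc i)"
  have "(\<lambda>n. \<Prod>i\<le>n. 1 - q ^ Suc i) \<longlonglongrightarrow> L"
    unfolding L_def by (rule convergent_prod_LIMSEQ[OF cp])
  then have lim: "qpoch q \<longlonglongrightarrow> L"
    by (subst filterlim_sequentially_Suc[symmetric]) (simp only: qpoch_def lessThan_Suc_atMost)
  have dec: "decseq (qpoch q)"
    using qpoch_pos[OF q] q by (intro decseq_SucI) (simp add: qpoch_Suc mult_le_cancel_left1 less_imp_le)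
  have "L \<noteq> 0"
    unfolding L_def using one_minus_power_pos[OF q, of "Suc _"]
    by (intro prodinf_nonzero cp) (simp add: less_imp_neq[symmetric])
  moreover have "0 \<le> L"
    by (rule LIMSEQ_le_const[OF lim]) (use qpoch_pos[OF q] less_imp_le in blast)
  ultimately show thesis
    using that[of L] lim decseq_ge[OF dec lim] by auto
qed

text \<open>Dominated convergence for series. The weights will be reciprocals of
  \<open>qpoch\<close> at \<open>n - m\<close> and \<open>n + m\<close>; their limit does not depend
  on \<open>m\<close>, and \<open>B\<close> exists because \<open>qpoch\<close> stays above its
  positive limit.\<close>

lemma tendsto_weighted_partial_sums:
  fixes c :: "nat \<Rightarrow> real"
  assumes c: "summable (\<lambda>m. \<bar>c m\<bar>)"
    and w: "\<And>m. (\<lambda>n. w m n) \<longlonglongrightarrow> W"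
    and B: "\<And>m n. m \<le> n \<Longrightarrow> \<bar>w m n\<bar> \<le> B"
  shows "(\<lambda>n. \<Sum>m\<le>n. c m * w m n) \<longlonglongrightarrow> suminf c * W"
proof -
  have B0: "0 \<le> B" using B[of 0 0] by simp
  have "(\<lambda>n. \<Sum>m. if m \<le> n then c m * w m n else 0) \<longlonglongrightarrow> (\<Sum>m. c m * W)"
  proof (rule tannerys_theorem[THEN conjunct2, THEN conjunct2])
    show "((\<lambda>n. if m \<le> n then c m * w m n else 0) \<longlonglongrightarrow> c m * W)" for m
      by (rule Lim_transform_eventually[OF tendsto_mult[OF tendsto_const w]])
         (auto intro: eventually_mono[OF eventually_ge_at_top[of m]])
    show "\<forall>\<^sub>F (m, n) in sequentially \<times>\<^sub>F sequentially. norm (if m \<le> n then c m * w m n else 0) \<le> \<bar>c m\<bar> * B"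
      using B B0 by (intro always_eventually) (auto simp: abs_mult intro!: mult_left_mono)
  qed (use c summable_mult2 in auto)
  moreover have "(\<Sum>m. if m \<le> n then c m * w m n else 0) = (\<Sum>m\<le>n. c m * w m n)" for n
    by (subst suminf_finite[of "{..n}"]) (auto intro!: sum.cong)
  moreover have "(\<Sum>m. c m * W) = suminf c * W"
    using suminf_mult2[OF summable_rabs_cancel[OF c]] by simp
  ultimately show ?thesis by simp
qed

lemma summable_rr_theta:
  assumes q: "0 < q" "q < 1"
  shows "summable (\<lambda>m. \<bar>rr_theta q m\<bar>)"
proof (rule summable_comparison_test_ev)
  show "summable (\<lambda>m. 2 * q ^ m)"
    using q by (intro summable_mult summable_geometric) auto
  have "norm \<bar>rr_theta q m\<bar> \<le> 2 * q ^ m" for m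
  proof (cases "m = 0")
    case False
    have "\<bar>rr_theta q m\<bar> = q ^ (2 * (m * m) + m * (m - 1) div 2) * (1 + q ^ m)"
      using q False by (simp add: rr_theta_def unit_alpha_def abs_mult power_add)
    also have "\<dots> \<le> q ^ m * 2"
      using q by (intro mult_mono power_decreasing) (auto simp: power_le_one trans_le_add1)
    finally show ?thesis by simp
  qed (simp add: rr_theta_def unit_alpha_def)
  then show "\<forall>\<^sub>F m in sequentially. norm \<bar>rr_theta q m\<bar> \<le> 2 * q ^ m" by simp
qed

lemma summable_gap_terms:
  assumes q: "0 < q" "q < 1"
  shows "summable (\<lambda>m. q ^ (m * m) / qpoch q m)"
proof -
  obtain L where L: "0 < L" "\<And>n. L \<le> qpoch q n"
    using qpoch_limit[OF q] by metis
  show ?thesis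
  proof (rule summable_comparison_test_ev)
    show "summable (\<lambda>m. q ^ m / L)"
      using q by (intro summable_divide summable_geometric) auto
    have "norm (q ^ (m * m) / qpoch q m) \<le> q ^ m / L" for m
      using q L qpoch_pos[OF q, of m]
      by (auto simp: abs_mult intro!: frac_le power_decreasing)
    then show "\<forall>\<^sub>F m in sequentially. norm (q ^ (m * m) / qpoch q m) \<le> q ^ m / L" by simp
  qed
qed

text \<open>The theta series \<open>T\<close> is eliminated between two limits. The Bailey chain
  gives \<open>S = T / L\<close>, the triple product gives \<open>T / K\<close> for the residues 2
  and 3. Splitting \<open>qpoch q (5 * N)\<close> by residues modulo 5 then leaves the residues 1
  and 4.\<close>

theorem rogers_ramanujan:
  assumes q: "0 < q" "q < 1"
  shows "(\<lambda>N. \<Prod>i<N. 1 / ((1 - q ^ (5 * i + 1)) * (1 - q ^ (5 * i + 4))))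
           \<longlonglongrightarrow> (\<Sum>m. q ^ (m * m) / qpoch q m)"
proof -
  define S where "S = (\<Sum>m. q ^ (m * m) / qpoch q m)"
  define T where "T = (\<Sum>m. rr_theta q m)"
  define p where "p r N = (\<Prod>i<N. 1 - q ^ (5 * i + r))" for r N
  obtain L where L: "0 < L" "qpoch q \<longlonglongrightarrow> L" "\<And>n. L \<le> qpoch q n"
    using qpoch_limit[OF q] by metis
  have Q: "0 < q ^ 5" "q ^ 5 < 1"
    using q by (auto simp: power_less_one_iff)
  obtain K where K: "0 < K" "qpoch (q ^ 5) \<longlonglongrightarrow> K" "\<And>n. K \<le> qpoch (q ^ 5) n"
    using qpoch_limit[OF Q] by metis
  have sub: "(\<lambda>n. f (n - m)) \<longlonglongrightarrow> l" "(\<lambda>n. f (n + m)) \<longlonglongrightarrow> l" if "f \<longlonglongrightarrow> l" for f :: "nat \<Rightarrow> real" and l m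
    using that by (auto intro: filterlim_compose[OF _ filterlim_minus_const_nat_at_top] LIMSEQ_ignore_initial_segment)
  have gap: "summable (\<lambda>m. \<bar>q ^ (m * m) / qpoch q m\<bar>)"
    using summable_gap_terms[OF q] q qpoch_pos[OF q] by (simp add: less_imp_le)
  have inv: "\<bar>1 / (x * y)\<bar> \<le> 1 / (k * k)" if "0 < k" "k \<le> x" "k \<le> y" for x y k :: real
    using that by (auto simp: abs_mult intro!: frac_le mult_mono)
  have inv1: "\<bar>1 / x\<bar> \<le> 1 / k" if "0 < k" "k \<le> x" for x k :: real
    using that by (auto intro!: frac_le)
  have l1: "(\<lambda>n. \<Sum>m\<le>n. q ^ (m * m) / qpoch q m * (1 / qpoch q (n - m))) \<longlonglongrightarrow> S * (1 / L)"
    unfolding S_def using L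
    by (intro tendsto_weighted_partial_sums[OF gap, where B = "1 / L"] tendsto_divide tendsto_const sub inv1) auto
  have l2: "(\<lambda>n. \<Sum>m\<le>n. rr_theta q m * (1 / (qpoch q (n - m) * qpoch q (n + m)))) \<longlonglongrightarrow> T * (1 / (L * L))"
    unfolding T_def using L
    by (intro tendsto_weighted_partial_sums[OF summable_rr_theta[OF q], where B = "1 / (L * L)"]
        tendsto_divide tendsto_mult tendsto_const sub inv) auto
  have l3: "(\<lambda>n. \<Sum>m\<le>n. rr_theta q m * (1 / (qpoch (q ^ 5) (n - m) * qpoch (q ^ 5) (n + m)))) \<longlonglongrightarrow> T * (1 / (K * K))"
    unfolding T_def using K
    by (intro tendsto_weighted_partial_sums[OF summable_rr_theta[OF q], where B = "1 / (K * K)"]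
        tendsto_divide tendsto_mult tendsto_const sub inv) auto
  have "S * (1 / L) = T * (1 / (L * L))"
    by (rule LIMSEQ_unique[OF l1])
       (use l2 finite_rogers_ramanujan[OF q] in \<open>simp add: mult.commute\<close>)
  then have S: "S = T / L"
    using L(1) by (simp add: field_simps)
  have NN: "filterlim (\<lambda>N::nat. N + N) sequentially sequentially"
    by (rule filterlim_at_top_mono[OF filterlim_ident]) auto
  have "(\<lambda>N. p 2 N * p 3 N / qpoch (q ^ 5) (N + N)) \<longlonglongrightarrow> T * (1 / (K * K))"
    using l3 finite_jacobi_triple[OF q] by (simp add: p_def prod.distrib)
  then have "(\<lambda>N. p 2 N * p 3 N / qpoch (q ^ 5) (N + N) * qpoch (q ^ 5) (N + N)) \<longlonglongrightarrow> T * (1 / (K * K)) * K"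
    by (rule tendsto_mult) (rule filterlim_compose[OF K(2) NN])
  moreover have "qpoch (q ^ 5) n \<noteq> 0" for n using qpoch_pos[OF Q, of n] by simp
  ultimately have p23: "(\<lambda>N. p 2 N * p 3 N) \<longlonglongrightarrow> T / K"
    using K(1) by simp
  have N5: "filterlim (\<lambda>N::nat. 5 * N) sequentially sequentially"
    by (rule filterlim_at_top_mono[OF filterlim_ident]) auto
  have split: "qpoch q (5 * N) = p 1 N * p 2 N * p 3 N * p 4 N * qpoch (q ^ 5) N" for N
  proof (induction N)
    case (Suc N)
    have 1: "qpoch q (5 * Suc N) = qpoch q (5 * N) * (1 - q ^ (5 * N + 1)) * (1 - q ^ (5 * N + 2))
        * (1 - q ^ (5 * N + 3)) * (1 - q ^ (5 * N + 4)) * (1 - q ^ (5 * Suc N))"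
      by (simp add: qpoch_def eval_nat_numeral)
    have 2: "p r (Suc N) = p r N * (1 - q ^ (5 * N + r))" for r
      by (simp add: p_def)
    have 3: "qpoch (q ^ 5) (Suc N) = qpoch (q ^ 5) N * (1 - q ^ (5 * Suc N))"
      by (simp only: qpoch_Suc power_mult)
    show ?case
      unfolding 1 2 3 Suc.IH by (simp only: mult_ac)
  qed (simp add: p_def)
  have pnz: "p r N \<noteq> 0" if "0 < r" for r N
  proof -
    have "1 - q ^ (5 * i + r) \<noteq> 0" for i
      using one_minus_power_pos[OF q, of "5 * i + r"] that by linarith
    then show ?thesis unfolding p_def by simp
  qed
  have Qnz: "qpoch (q ^ 5) n \<noteq> 0" for n using qpoch_pos[OF Q, of n] by simp
  have cancel: "1 / (a * d) = b * c * e / (a * b * c * d * e)"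
    if "a \<noteq> 0" "b \<noteq> 0" "c \<noteq> 0" "d \<noteq> 0" "e \<noteq> 0" for a b c d e :: real
    using that by (simp add: field_simps)
  have "1 / (p 1 N * p 4 N) = p 2 N * p 3 N * qpoch (q ^ 5) N / qpoch q (5 * N)" for N
    unfolding split by (rule cancel) (simp_all add: pnz Qnz)
  moreover have "(\<lambda>N. p 2 N * p 3 N * qpoch (q ^ 5) N / qpoch q (5 * N)) \<longlonglongrightarrow> T / K * K / L"
    using L(1) by (intro tendsto_divide tendsto_mult p23 K filterlim_compose[OF L(2) N5]) auto
  ultimately show ?thesis
    using K(1) unfolding S_def[symmetric] S by (simp add: p_def prod.distrib prod_dividef)
qed

section \<open>Hooks of length 1 and 2\<close>

lemma part_antimono:
  assumes "is_partition n l" "1 \<le> i" "i \<le> k" "k \<le> length l"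
  shows "part l k \<le> part l i"
proof (cases "k = i")
  case False
  with assms have "i - 1 < k - 1" "k - 1 < length l" by auto
  with assms(1) show ?thesis
    by (simp add: is_partition_def part_def sorted_wrt_iff_nth_less)
qed simp

lemma conj_part_le_length: "conj_part l j \<le> length l"
proof -
  have "conj_part l j \<le> card {1..length l}"
    unfolding conj_part_def by (rule card_mono) auto
  then show ?thesis by simp
qed

text \<open>The adjunction between a partition and its conjugate; through it every statement about a
  column becomes one about rows.\<close>

lemma le_part_iff_le_conj_part:
  assumes "is_partition n l" "1 \<le> i" "i \<le> length l"
  shows "j \<le> part l i \<longleftrightarrow> i \<le> conj_part l j"
proof
  assume j: "j \<le> part l i"
  have "{1..i} \<subseteq> {i. 1 \<le> i \<and> i \<le> length l \<and> j \<le> part l i}"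
    using part_antimono[OF assms(1)] assms(3) j by (auto intro: order_trans)
  from card_mono[OF finite_conj_part this] show "i \<le> conj_part l j"
    by (simp add: conj_part_def)
next
  assume i: "i \<le> conj_part l j"
  show "j \<le> part l i"
  proof (rule ccontr)
    assume j: "\<not> j \<le> part l i"
    have "{k. 1 \<le> k \<and> k \<le> length l \<and> j \<le> part l k} \<subseteq> {1..<i}"
    proof
      fix k assume k: "k \<in> {k. 1 \<le> k \<and> k \<le> length l \<and> j \<le> part l k}"
      then have "\<not> i \<le> k"
        using part_antimono[OF assms(1,2), of k] j by auto
      with k show "k \<in> {1..<i}" by auto
    qed
    from card_mono[OF _ this] have "conj_part l j \<le> i - 1"
      by (simp add: conj_part_def)
    with i assms(2) show False by simp
  qed
qed

lemma part_in_set: "1 \<le> i \<Longrightarrow> i \<le> length l \<Longrightarrow> part l i \<in> set l"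
  by (simp add: part_def)

text \<open>For a size \<open>s\<close> that occurs, \<open>conj_part l s\<close> is the index of
  the last row of length \<open>s\<close>.\<close>

lemma part_conj_part:
  assumes l: "is_partition n l" and s: "s \<in> set l"
  shows "1 \<le> conj_part l s" "part l (conj_part l s) = s"
proof -
  obtain k where "k < length l" "l ! k = s" using s by (auto simp: in_set_conv_nth)
  then have k: "1 \<le> Suc k" "Suc k \<le> length l" "part l (Suc k) = s"
    by (auto simp: part_def)
  then have kc: "Suc k \<le> conj_part l s"
    using le_part_iff_le_conj_part[OF l k(1,2), of s] by simp
  then show 1: "1 \<le> conj_part l s" by simp
  have "part l (conj_part l s) \<le> s"
    using part_antimono[OF l k(1) kc conj_part_le_length] k(3) by simp
  moreover have "s \<le> part l (conj_part l s)"
    using le_part_iff_le_conj_part[OF l 1 conj_part_le_length] by simp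
  ultimately show "part l (conj_part l s) = s" by simp
qed

lemma finite_hooks: "finite {(i, j). (i, j) \<in> cells l \<and> hook_length l i j = t}"
  by (rule finite_subset[OF _ finite_cells[of l]]) auto

text \<open>Hook length 1 means that arm and leg vanish, so the cell is a corner. Its column is the
  length of its row, hence an occurring size, and this size determines the row.\<close>

lemma num_hooks_one_le:
  assumes l: "is_partition n l"
  shows "num_hooks 1 l \<le> card (set l)"
  unfolding num_hooks_def
proof (rule card_inj_on_le[where f = snd])
  have hook: "j = part l i \<and> i = conj_part l j" if "(i, j) \<in> cells l" "hook_length l i j = 1" for i j
    using that le_conj_part[OF l that(1)] by (auto simp: cells_def hook_length_def)
  show "inj_on snd {(i, j). (i, j) \<in> cells l \<and> hook_length l i j = 1}"
    using hook by (auto simp: inj_on_def)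
  show "snd ` {(i, j). (i, j) \<in> cells l \<and> hook_length l i j = 1} \<subseteq> set l"
  proof clarify
    fix i j assume ij: "(i, j) \<in> cells l" "hook_length l i j = 1"
    then have "1 \<le> i" "i \<le> length l" by (auto simp: cells_def)
    moreover have "j = part l i" using hook[OF ij] by (rule conjunct1)
    ultimately show "snd (i, j) \<in> set l" using part_in_set by simp
  qed
qed simp

lemma gap_two_conj_part:
  assumes l: "is_partition n l" "gap_two l" and i: "1 \<le> i" "i \<le> length l"
  shows "conj_part l (part l i) = i"
proof (rule ccontr)
  assume "conj_part l (part l i) \<noteq> i"
  moreover have "i \<le> conj_part l (part l i)"
    using le_part_iff_le_conj_part[OF l(1) i, of "part l i"] by simp
  ultimately have "i + 1 \<le> conj_part l (part l i)" by simp
  moreover from this have "i + 1 \<le> length l"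
    using conj_part_le_length order_trans by blast
  ultimately have "part l i \<le> part l (i + 1)"
    using le_part_iff_le_conj_part[OF l(1), of "i + 1"] by simp
  moreover have "part l (i + 1) + 2 \<le> part l i"
    using l(2) i \<open>i + 1 \<le> length l\<close> by (simp add: gap_two_def)
  ultimately show False by simp
qed

lemma gap_two_num_hooks_one:
  assumes l: "is_partition n l" "gap_two l"
  shows "length l \<le> num_hooks 1 l"
proof -
  have "card {1..length l} \<le> num_hooks 1 l"
    unfolding num_hooks_def
  proof (rule card_inj_on_le[where f = "\<lambda>i. (i, part l i)"])
    show "(\<lambda>i. (i, part l i)) ` {1..length l} \<subseteq> {(i, j). (i, j) \<in> cells l \<and> hook_length l i j = 1}"
      using gap_two_conj_part[OF l] l(1) part_in_set[of _ l]
      by (auto simp: cells_def hook_length_def is_partition_def Suc_le_eq)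
  qed (auto simp: inj_on_def finite_hooks)
  then show ?thesis by simp
qed

text \<open>A 2-hook has arm 1 and leg 0, or arm 0 and leg 1. The latter would be the end of a row
  followed by a row of the same length, which the gaps exclude; so each row has at most its last but
  one cell as a 2-hook.\<close>

lemma gap_two_num_hooks_two:
  assumes l: "is_partition n l" "gap_two l"
  shows "num_hooks 2 l \<le> length l"
proof -
  have "num_hooks 2 l \<le> card {1..length l}"
    unfolding num_hooks_def
  proof (rule card_inj_on_le[where f = fst])
    have hook: "j + 1 = part l i" if "(i, j) \<in> cells l" "hook_length l i j = 2" for i j
    proof -
      have ij: "1 \<le> i" "i \<le> length l" "j \<le> part l i" "i \<le> conj_part l j"
        using that le_conj_part[OF l(1) that(1)] by (auto simp: cells_def)
      with that have "j + 1 = part l i \<or> j = part l i \<and> conj_part l j = i + 1"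
        by (auto simp: hook_length_def)
      then show ?thesis
        using gap_two_conj_part[OF l ij(1,2)] by auto
    qed
    show "inj_on fst {(i, j). (i, j) \<in> cells l \<and> hook_length l i j = 2}"
      using hook by (auto simp: inj_on_def) (metis Suc_inject)
    show "fst ` {(i, j). (i, j) \<in> cells l \<and> hook_length l i j = 2} \<subseteq> {1..length l}"
      by (auto simp: cells_def)
  qed simp
  then show ?thesis by simp
qed

text \<open>A size \<open>s\<close> of at least 2 gives the last but one cell of the last row of
  length \<open>s\<close>, with leg 0 since no row has length \<open>s - 1\<close>. A repeated size
  gives the end of the last but one row of that length. The first kind is never at the end of its
  row and the second always is, so they differ.\<close>

lemma num_hooks_two_ge:
  assumes l: "is_partition n l" and isolated: "\<And>s. s \<in> set l \<Longrightarrow> s - 1 \<notin> set l"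
  shows "card {s \<in> set l. 2 \<le> s} + card {s \<in> set l. 2 \<le> count_list l s} \<le> num_hooks 2 l"
proof -
  let ?A = "{s \<in> set l. 2 \<le> s}" and ?B = "{s \<in> set l. 2 \<le> count_list l s}"
  let ?f = "\<lambda>s. (conj_part l s, s - 1)" and ?g = "\<lambda>s. (conj_part l s - 1, s)"
  have A: "(conj_part l s, s - 1) \<in> cells l \<and> hook_length l (conj_part l s) (s - 1) = 2
      \<and> part l (conj_part l s) = s" if s: "s \<in> ?A" for s
  proof -
    have s': "s \<in> set l" "2 \<le> s" using s by auto
    define i where "i = conj_part l s"
    have i: "1 \<le> i" "part l i = s" "i \<le> length l"
      using part_conj_part[OF l s'(1)] conj_part_le_length by (auto simp: i_def)
    have "conj_part l (s - 1) = i"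
    proof (rule ccontr)
      assume "conj_part l (s - 1) \<noteq> i"
      moreover have "i \<le> conj_part l (s - 1)"
        using le_part_iff_le_conj_part[OF l i(1,3), of "s - 1"] i(2) by simp
      ultimately have i': "i + 1 \<le> conj_part l (s - 1)" by simp
      then have len: "i + 1 \<le> length l"
        using conj_part_le_length order_trans by blast
      have "s - 1 \<le> part l (i + 1)"
        using le_part_iff_le_conj_part[OF l _ len, of "s - 1"] i' by simp
      moreover have "\<not> s \<le> part l (i + 1)"
        using le_part_iff_le_conj_part[OF l _ len, of s] by (simp add: i_def)
      ultimately have "part l (i + 1) = s - 1" by simp
      with part_in_set[OF _ len] isolated[OF s'(1)] show False by simp
    qed
    with i s' show ?thesis
      by (auto simp: cells_def hook_length_def i_def[symmetric])
  qed
  have B: "(conj_part l s - 1, s) \<in> cells l \<and> hook_length l (conj_part l s - 1) s = 2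
      \<and> part l (conj_part l s - 1) = s \<and> 2 \<le> conj_part l s" if s: "s \<in> ?B" for s
  proof -
    have s': "s \<in> set l" "2 \<le> count_list l s" using s by auto
    then have "\<not> card {i. i < length l \<and> l ! i = s} \<le> Suc 0"
      by (simp add: count_list_eq_length_filter length_filter_conv_card eq_commute)
    then obtain k k' where k: "k < length l" "l ! k = s" "k' < length l" "l ! k' = s" "k < k'"
      by (auto simp: card_le_Suc0_iff_eq) (metis nat_neq_iff)
    define i where "i = conj_part l s"
    have "part l (Suc k) = s" "part l (Suc k') = s" using k by (auto simp: part_def)
    then have "Suc k' \<le> i"
      using le_part_iff_le_conj_part[OF l, of "Suc k'" s] k by (simp add: i_def)
    then have i: "2 \<le> i" "Suc k \<le> i - 1" "i \<le> length l"
      using k conj_part_le_length[of l s] by (auto simp: i_def)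
    have "part l (i - 1) \<le> s"
      using part_antimono[OF l, of "Suc k" "i - 1"] i \<open>part l (Suc k) = s\<close> by simp
    moreover have "s \<le> part l (i - 1)"
      using le_part_iff_le_conj_part[OF l, of "i - 1" s] i by (simp add: i_def)
    moreover have "0 < s" using l s' by (auto simp: is_partition_def)
    ultimately have p: "part l (i - 1) = s" and s0: "0 < s" by auto
    show ?thesis
      unfolding cells_def hook_length_def i_def[symmetric] using i s0 p by simp
  qed
  have "card ?A + card ?B = card (?f ` ?A) + card (?g ` ?B)"
  proof -
    have "inj_on ?f ?A" by (auto simp: inj_on_def)
    moreover have "inj_on ?g ?B" by (auto simp: inj_on_def)
    ultimately show ?thesis by (simp add: card_image)
  qed
  also have "\<dots> = card (?f ` ?A \<union> ?g ` ?B)"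
  proof (rule card_Un_disjoint[symmetric])
    show "?f ` ?A \<inter> ?g ` ?B = {}"
    proof (rule ccontr)
      assume "?f ` ?A \<inter> ?g ` ?B \<noteq> {}"
      then obtain s s' where s: "s \<in> ?A" "s' \<in> ?B" "conj_part l s = conj_part l s' - 1" "s - 1 = s'"
        by auto
      then have "s = s'" using A[OF s(1)] B[OF s(2)] by metis
      with s show False by auto
    qed
  qed auto
  also have "\<dots> \<le> num_hooks 2 l"
    unfolding num_hooks_def using A B by (intro card_mono finite_hooks) auto
  finally show ?thesis .
qed

section \<open>Generating functions of the two families\<close>

text \<open>Formally \<open>A = q ^ k * A + q ^ j * B\<close>. Convergence has to come first: by
  nonnegativity \<open>S (N - k)\<close> is at most \<open>S N\<close>, so the recurrence bounds its
  own partial sums.\<close>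

lemma sums_of_shift_recurrence:
  fixes a b :: "nat \<Rightarrow> real"
  assumes q: "0 < q" "q < 1" and k: "0 < k"
    and nonneg: "\<And>n. 0 \<le> a n" "\<And>n. 0 \<le> b n"
    and rec: "\<And>n. a n = (if k \<le> n then a (n - k) else 0) + (if j \<le> n then b (n - j) else 0)"
    and b: "(\<lambda>n. b n * q ^ n) sums B"
  shows "(\<lambda>n. a n * q ^ n) sums (q ^ j * B / (1 - q ^ k))"
proof -
  have shift: "(\<Sum>n<N. (if k \<le> n then f (n - k) else 0) * q ^ n) = q ^ k * (\<Sum>n<N - k. f n * q ^ n)"
    for f :: "nat \<Rightarrow> real" and k N
  proof -
    have "(\<Sum>n<N. (if k \<le> n then f (n - k) else 0) * q ^ n) = (\<Sum>n\<in>{k..<N}. f (n - k) * q ^ n)"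
      by (rule sum.mono_neutral_cong_right) auto
    also have "\<dots> = (\<Sum>n<N - k. f n * q ^ (n + k))"
      by (rule sum.reindex_bij_witness[of _ "\<lambda>n. n + k" "\<lambda>n. n - k"]) auto
    finally show ?thesis by (simp add: sum_distrib_left power_add mult_ac)
  qed
  have k1: "0 < 1 - q ^ k" using one_minus_power_pos[OF q k] .
  define S where "S N = (\<Sum>n<N. a n * q ^ n)" for N
  have S: "S N = q ^ k * S (N - k) + q ^ j * (\<Sum>n<N - j. b n * q ^ n)" for N
  proof -
    have "S N = (\<Sum>n<N. (if k \<le> n then a (n - k) else 0) * q ^ n + (if j \<le> n then b (n - j) else 0) * q ^ n)"
      unfolding S_def by (intro sum.cong refl) (subst rec, simp add: distrib_right)
    then show ?thesis
      unfolding sum.distrib shift S_def .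
  qed
  have Bsum: "(\<Sum>n<N. b n * q ^ n) \<le> B" for N
    using b q nonneg by (auto simp: sums_iff intro!: sum_le_suminf)
  have "S N \<le> q ^ j * B / (1 - q ^ k)" for N
  proof -
    have "S (N - k) \<le> S N"
      unfolding S_def using q nonneg by (intro sum_mono2) auto
    then have "S N \<le> q ^ k * S N + q ^ j * B"
      using q S[of N] Bsum[of "N - j"] by (smt (verit) mult_left_mono zero_le_power)
    then show ?thesis using k1 by (simp add: field_simps)
  qed
  then have "summable (\<lambda>n. a n * q ^ n)"
    using q nonneg unfolding S_def by (intro summableI_nonneg_bounded) auto
  then have A: "S \<longlonglongrightarrow> (\<Sum>n. a n * q ^ n)" (is "_ \<longlonglongrightarrow> ?A")
    unfolding S_def by (simp add: summable_LIMSEQ)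
  have "(\<lambda>N. q ^ k * S (N - k) + q ^ j * (\<Sum>n<N - j. b n * q ^ n)) \<longlonglongrightarrow> q ^ k * ?A + q ^ j * B"
    using b unfolding sums_def
    by (intro tendsto_intros filterlim_compose[OF A filterlim_minus_const_nat_at_top]
        filterlim_compose[OF _ filterlim_minus_const_nat_at_top]) auto
  then have "?A = q ^ k * ?A + q ^ j * B"
    unfolding S[symmetric] by (rule LIMSEQ_unique[OF A])
  then have "?A = q ^ j * B / (1 - q ^ k)"
    using k1 by (simp add: field_simps)
  with \<open>summable (\<lambda>n. a n * q ^ n)\<close> show ?thesis
    by (simp add: sums_iff)
qed

text \<open>Monotone convergence. \<open>a' K\<close> will count the partitions with at most
  \<open>K\<close> parts, or with parts at most \<open>5 * K\<close>; this is complete up to degree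
  \<open>K\<close>.\<close>

lemma sums_of_exhaustion:
  fixes a :: "nat \<Rightarrow> real" and a' :: "nat \<Rightarrow> nat \<Rightarrow> real"
  assumes q: "0 < q" and nonneg: "\<And>K n. 0 \<le> a' K n"
    and le: "\<And>K n. a' K n \<le> a n" and eq: "\<And>K n. n \<le> K \<Longrightarrow> a' K n = a n"
    and sums: "\<And>K. (\<lambda>n. a' K n * q ^ n) sums s K" and lim: "s \<longlonglongrightarrow> l"
  shows "(\<lambda>n. a n * q ^ n) sums l"
proof -
  have a: "0 \<le> a n" for n using nonneg le order_trans by blast
  have part: "(\<Sum>n<N. a n * q ^ n) \<le> l" for N
  proof (rule LIMSEQ_le_const[OF lim], intro exI allI impI)
    fix K assume "N \<le> K"
    then have "(\<Sum>n<N. a n * q ^ n) = (\<Sum>n<N. a' K n * q ^ n)"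
      by (intro sum.cong) (simp_all add: eq)
    also have "\<dots> \<le> s K"
      using sum_le_suminf[of "\<lambda>n. a' K n * q ^ n" "{..<N}"] sums[of K] q nonneg by (auto simp: sums_iff)
    finally show "(\<Sum>n<N. a n * q ^ n) \<le> s K" .
  qed
  then have sa: "summable (\<lambda>n. a n * q ^ n)"
    using q a by (intro summableI_nonneg_bounded) auto
  have "s K \<le> (\<Sum>n. a n * q ^ n)" for K
    using suminf_le[of "\<lambda>n. a' K n * q ^ n" "\<lambda>n. a n * q ^ n"] sums[of K] q le sa by (auto simp: sums_iff)
  then have "l \<le> (\<Sum>n. a n * q ^ n)"
    by (intro LIMSEQ_le_const2[OF lim]) auto
  moreover have "(\<Sum>n. a n * q ^ n) \<le> l"
    by (rule suminf_le_const[OF sa part])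
  ultimately show ?thesis using sa by (simp add: sums_iff)
qed

lemma finite_partitions_with: "finite {l. is_partition n l \<and> P l}"
  by (rule finite_subset[OF _ finite_partitions[of n]]) auto

section \<open>Gap partitions with a given number of parts\<close>

definition gap_partitions :: "nat \<Rightarrow> nat \<Rightarrow> nat list set" where
  "gap_partitions m n = {l. is_partition n l \<and> gap_two l \<and> length l = m}"

lemma finite_gap_partitions [simp]: "finite (gap_partitions m n)"
  unfolding gap_partitions_def by (rule finite_partitions_with)

lemma gap_two_iff: "gap_two l \<longleftrightarrow> sorted_wrt (\<lambda>x y. y + 2 \<le> x) l"
proof -
  have "gap_two l \<longleftrightarrow> (\<forall>i. Suc i < length l \<longrightarrow> l ! Suc i + 2 \<le> l ! i)"
    unfolding gap_two_def part_def
  proof (intro iffI allI impI)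
    fix i assume "\<forall>i. 1 \<le> i \<and> i < length l \<longrightarrow> l ! (i + 1 - 1) + 2 \<le> l ! (i - 1)" "Suc i < length l"
    from this(1)[rule_format, of "Suc i"] this(2) show "l ! Suc i + 2 \<le> l ! i" by simp
  next
    fix i assume *: "\<forall>i. Suc i < length l \<longrightarrow> l ! Suc i + 2 \<le> l ! i" and i: "1 \<le> i \<and> i < length l"
    then obtain k where "i = Suc k" by (cases i) auto
    with *[rule_format, of k] i show "l ! (i + 1 - 1) + 2 \<le> l ! (i - 1)" by simp
  qed
  then show ?thesis
    by (subst sorted_wrt_iff_nth_Suc_transp) (auto simp: transp_def)
qed

lemma gap_partitions_alt:
  "gap_partitions m n = {l. sorted_wrt (\<lambda>x y. y + 2 \<le> x) l \<and> (\<forall>x\<in>set l. 0 < x) \<and> sum_list l = n \<and> length l = m}"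
  unfolding gap_partitions_def is_partition_def gap_two_iff
  by (auto elim: sorted_wrt_mono_rel[rotated])

lemma sum_list_map_add: "sum_list (map (\<lambda>x. x + c) l) = sum_list l + c * length (l :: nat list)"
  by (induction l) auto

text \<open>A part 1 is removed and the other parts are decreased by 2; without a part 1, all parts are
  decreased by 1.\<close>

lemma gap_partitions_Suc:
  "gap_partitions (Suc m) n =
     (if Suc m \<le> n then map (\<lambda>x. x + 1) ` gap_partitions (Suc m) (n - Suc m) else {}) \<union>
     (if 2 * m + 1 \<le> n then (\<lambda>l. map (\<lambda>x. x + 2) l @ [1]) ` gap_partitions m (n - (2 * m + 1)) else {})"
  (is "?L = ?R1 \<union> ?R2")
proof (intro subset_antisym subsetI)
  fix l assume "l \<in> ?L"
  then have l: "sorted_wrt (\<lambda>x y. y + 2 \<le> x) l" "\<forall>x\<in>set l. 0 < x" "sum_list l = n" "length l = Suc m"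
    by (auto simp: gap_partitions_alt)
  show "l \<in> ?R1 \<union> ?R2"
  proof (cases "1 \<in> set l")
    case False
    define l' where "l' = map (\<lambda>x. x - 1) l"
    have pos: "2 \<le> x" if "x \<in> set l" for x
    proof -
      have "x \<noteq> 1" "0 < x" using that False l(2) by auto
      then show ?thesis by simp
    qed
    have l': "l = map (\<lambda>x. x + 1) l'"
      unfolding l'_def map_map by (rule map_idI[symmetric]) (use pos in force)
    have "sum_list l = sum_list l' + 1 * length l'" unfolding l' by (rule sum_list_map_add)
    moreover have "l' \<in> gap_partitions (Suc m) (sum_list l')"
      using l pos unfolding gap_partitions_alt
      by (auto simp: l'_def sorted_wrt_map elim!: sorted_wrt_mono_rel[rotated]) force
    moreover have "length l' = Suc m" using l by (simp add: l'_def)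
    ultimately have n: "n = sum_list l' + Suc m" and mem: "l' \<in> gap_partitions (Suc m) (sum_list l')"
      using l(3) by simp_all
    have "l \<in> map (\<lambda>x. x + 1) ` gap_partitions (Suc m) (n - Suc m)"
      unfolding l' using mem by (intro imageI) (simp add: n)
    then show ?thesis using n by simp
  next
    case True
    obtain b a where lb: "l = b @ [a]" using l(4) by (cases l rule: rev_cases) auto
    have gap: "\<forall>x\<in>set b. a + 2 \<le> x" "sorted_wrt (\<lambda>x y. y + 2 \<le> x) b"
      using l(1) by (auto simp: lb sorted_wrt_append)
    have "0 < a" using l(2) by (simp add: lb)
    with True gap have last: "a = 1" by (fastforce simp: lb)
    define l' where "l' = map (\<lambda>x. x - 2) b"
    have b: "b = map (\<lambda>x. x + 2) l'"
      unfolding l'_def map_map by (rule map_idI[symmetric]) (use gap last in force)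
    have len: "length l' = m" using l(4) lb by (simp add: l'_def)
    have "sum_list b = sum_list l' + 2 * length l'"
      unfolding b by (rule sum_list_map_add)
    moreover have "sum_list l = sum_list b + 1"
      by (simp add: lb last)
    moreover have "l' \<in> gap_partitions m (sum_list l')"
      using gap last len unfolding gap_partitions_alt
      by (auto simp: l'_def sorted_wrt_map elim!: sorted_wrt_mono_rel[rotated])
    ultimately have n: "n = sum_list l' + (2 * m + 1)" and mem: "l' \<in> gap_partitions m (sum_list l')"
      using l(3) len by simp_all
    have "l = map (\<lambda>x. x + 2) l' @ [1]" using lb last b by simp
    then have "l \<in> (\<lambda>l. map (\<lambda>x. x + 2) l @ [1]) ` gap_partitions m (n - (2 * m + 1))"
      by (rule image_eqI) (simp add: n mem)
    then show ?thesis using n by simp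
  qed
next
  fix l assume "l \<in> ?R1 \<union> ?R2"
  then show "l \<in> ?L"
  proof
    assume "l \<in> ?R1"
    then show ?thesis
      using sum_list_map_add[of 1]
      by (auto simp: gap_partitions_alt sorted_wrt_map split: if_splits)
  next
    assume "l \<in> ?R2"
    then show ?thesis
      using sum_list_map_add[of 2]
      by (auto simp: gap_partitions_alt sorted_wrt_map sorted_wrt_append Suc_le_eq split: if_splits)
  qed
qed

lemma card_gap_partitions_Suc:
  "card (gap_partitions (Suc m) n) =
     (if Suc m \<le> n then card (gap_partitions (Suc m) (n - Suc m)) else 0) +
     (if 2 * m + 1 \<le> n then card (gap_partitions m (n - (2 * m + 1))) else 0)"
proof -
  let ?A = "if Suc m \<le> n then map (\<lambda>x. x + 1) ` gap_partitions (Suc m) (n - Suc m) else {}"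
  let ?B = "if 2 * m + 1 \<le> n then (\<lambda>l. map (\<lambda>x. x + 2) l @ [1]) ` gap_partitions m (n - (2 * m + 1)) else {}"
  have "1 \<notin> set l" if "l \<in> ?A" for l
    using that by (auto simp: gap_partitions_alt split: if_splits)
  moreover have "1 \<in> set l" if "l \<in> ?B" for l
    using that by (auto split: if_splits)
  ultimately have "?A \<inter> ?B = {}" by blast
  then have "card (gap_partitions (Suc m) n) = card ?A + card ?B"
    unfolding gap_partitions_Suc[of m n] by (intro card_Un_disjoint) auto
  moreover have "card (map (\<lambda>x. x + 1) ` X) = card X" for X :: "nat list set"
  proof (intro card_image inj_onI)
    fix x y :: "nat list" assume "map (\<lambda>x. x + 1) x = map (\<lambda>x. x + 1) y"
    then show "x = y" by (rule map_injective) (auto simp: inj_def)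
  qed
  moreover have "card ((\<lambda>l. map (\<lambda>x. x + 2) l @ [1]) ` X) = card X" for X :: "nat list set"
  proof (intro card_image inj_onI)
    fix x y :: "nat list" assume "map (\<lambda>x. x + 2) x @ [1] = map (\<lambda>x. x + 2) y @ [1]"
    then have "map (\<lambda>x. x + 2) x = map (\<lambda>x. x + 2) y" by simp
    then show "x = y" by (rule map_injective) (auto simp: inj_def)
  qed
  ultimately show ?thesis by (simp only: if_distrib[of card] card.empty)
qed

text \<open>The two cases of the recurrence contribute the factor
  \<open>q ^ (2 * m + 1) / (1 - q ^ Suc m)\<close>, and the odd exponents add up to a
  square.\<close>

lemma gap_partitions_gf:
  assumes q: "0 < q" "q < 1"
  shows "(\<lambda>n. real (card (gap_partitions m n)) * q ^ n) sums (q ^ (m * m) / qpoch q m)"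
proof (induction m)
  case 0
  have "gap_partitions 0 n = (if n = 0 then {[]} else {})" for n
    by (auto simp: gap_partitions_alt)
  then have "real (card (gap_partitions 0 n)) * q ^ n = (if n = 0 then 1 else 0)" for n
    by simp
  then show ?case using sums_single[of 0 "\<lambda>_. 1 :: real"] by simp
next
  case (Suc m)
  have "(\<lambda>n. real (card (gap_partitions (Suc m) n)) * q ^ n)
      sums (q ^ (2 * m + 1) * (q ^ (m * m) / qpoch q m) / (1 - q ^ Suc m))"
  proof (rule sums_of_shift_recurrence[OF q _ _ _ _ Suc.IH])
    show "real (card (gap_partitions (Suc m) n)) =
      (if Suc m \<le> n then real (card (gap_partitions (Suc m) (n - Suc m))) else 0) +
      (if 2 * m + 1 \<le> n then real (card (gap_partitions m (n - (2 * m + 1)))) else 0)" for n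
      by (subst card_gap_partitions_Suc) simp
  qed simp_all
  moreover have "q ^ (2 * m + 1) * q ^ (m * m) = q ^ (Suc m * Suc m)"
    unfolding power_add[symmetric] by (rule arg_cong[where f = "power q"]) simp
  ultimately show ?case
    by (simp only: times_divide_eq_right divide_divide_eq_left qpoch_Suc)
qed

definition gap_count :: "nat \<Rightarrow> nat" where
  "gap_count n = card {l. is_partition n l \<and> gap_two l}"

lemma length_le_of_partition: "is_partition n l \<Longrightarrow> length l \<le> n"
proof -
  have "length l \<le> sum_list l" if "\<forall>x\<in>set l. 0 < x" for l :: "nat list"
    using that by (induction l) auto
  then show "is_partition n l \<Longrightarrow> length l \<le> n" by (auto simp: is_partition_def)
qed

lemma gap_partitions_gf_total:
  assumes q: "0 < q" "q < 1"
  shows "(\<lambda>n. real (gap_count n) * q ^ n) sums (\<Sum>m. q ^ (m * m) / qpoch q m)"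
proof (rule sums_of_exhaustion[where a' = "\<lambda>K n. \<Sum>m\<le>K. real (card (gap_partitions m n))"
      and s = "\<lambda>K. \<Sum>m\<le>K. q ^ (m * m) / qpoch q m"])
  have un: "(\<Sum>m\<le>K. real (card (gap_partitions m n))) = card (\<Union>m\<le>K. gap_partitions m n)" for K n
  proof (subst card_UN_disjoint)
    show "\<forall>i\<in>{..K}. \<forall>j\<in>{..K}. i \<noteq> j \<longrightarrow> gap_partitions i n \<inter> gap_partitions j n = {}"
      by (auto simp: gap_partitions_def)
  qed simp_all
  show "(\<Sum>m\<le>K. real (card (gap_partitions m n))) \<le> real (gap_count n)" for K n
    unfolding un gap_count_def of_nat_le_iff
    by (intro card_mono finite_partitions_with) (auto simp: gap_partitions_def)
  show "(\<Sum>m\<le>K. real (card (gap_partitions m n))) = real (gap_count n)" if "n \<le> K" for K n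
  proof -
    have "length l \<le> K" if "is_partition n l" for l
      using length_le_of_partition[OF that] \<open>n \<le> K\<close> by simp
    then have "(\<Union>m\<le>K. gap_partitions m n) = {l. is_partition n l \<and> gap_two l}"
      by (auto simp: gap_partitions_def)
    then show ?thesis unfolding un gap_count_def by simp
  qed
  show "(\<lambda>n. (\<Sum>m\<le>K. real (card (gap_partitions m n))) * q ^ n) sums (\<Sum>m\<le>K. q ^ (m * m) / qpoch q m)" for K
    unfolding sum_distrib_right by (rule sums_sum) (rule gap_partitions_gf[OF q])
  show "(\<lambda>K. \<Sum>m\<le>K. q ^ (m * m) / qpoch q m) \<longlonglongrightarrow> (\<Sum>m. q ^ (m * m) / qpoch q m)"
    by (rule summable_LIMSEQ'[OF summable_gap_terms[OF q]])
qed (simp_all add: q sum_nonneg)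

section \<open>Partitions into parts 1 or 4 modulo 5\<close>

definition residues_1_4 :: "nat \<Rightarrow> nat set" where
  "residues_1_4 K = {s \<in> {1..K}. s mod 5 = 1 \<or> s mod 5 = 4}"

lemma finite_residues [simp]: "finite (residues_1_4 K)"
  by (simp add: residues_1_4_def)

lemma residues_Suc:
  "residues_1_4 (Suc K) = (if Suc K mod 5 = 1 \<or> Suc K mod 5 = 4 then insert (Suc K) (residues_1_4 K) else residues_1_4 K)"
  by (auto simp: residues_1_4_def le_Suc_eq)

lemma residues_multiple_5:
  "residues_1_4 (5 * Suc N) = insert (5 * N + 4) (insert (5 * N + 1) (residues_1_4 (5 * N)))"
  "5 * N + 4 \<notin> insert (5 * N + 1) (residues_1_4 (5 * N))" "5 * N + 1 \<notin> residues_1_4 (5 * N)"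
proof -
  have m: "Suc (5 * N) mod 5 = 1" "Suc (Suc (5 * N)) mod 5 = 2" "Suc (Suc (Suc (5 * N))) mod 5 = 3"
    "Suc (Suc (Suc (Suc (5 * N)))) mod 5 = 4" "Suc (Suc (Suc (Suc (Suc (5 * N))))) mod 5 = 0"
    by presburger+
  have e: "5 * Suc N = Suc (Suc (Suc (Suc (Suc (5 * N)))))"
    "5 * N + 4 = Suc (Suc (Suc (Suc (5 * N))))" "5 * N + 1 = Suc (5 * N)" by simp_all
  show "residues_1_4 (5 * Suc N) = insert (5 * N + 4) (insert (5 * N + 1) (residues_1_4 (5 * N)))"
    unfolding e residues_Suc m by simp
qed (auto simp: residues_1_4_def)

lemma prod_residues:
  fixes F :: "nat \<Rightarrow> real"
  shows "(\<Prod>s\<in>residues_1_4 (5 * N). F s) = (\<Prod>i<N. F (5 * i + 1) * F (5 * i + 4))"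
proof (induction N)
  case (Suc N)
  then show ?case
    unfolding residues_multiple_5(1) using residues_multiple_5(2,3)[of N] by (simp add: mult_ac)
qed (simp add: residues_1_4_def)

lemma sum_residues:
  fixes F :: "nat \<Rightarrow> real"
  shows "(\<Sum>s\<in>residues_1_4 (5 * N). F s) = (\<Sum>i<N. F (5 * i + 1) + F (5 * i + 4))"
proof (induction N)
  case (Suc N)
  then show ?case
    unfolding residues_multiple_5(1) using residues_multiple_5(2,3)[of N] by (simp add: add_ac)
qed (simp add: residues_1_4_def)

definition mod5_partitions :: "nat \<Rightarrow> nat \<Rightarrow> nat list set" where
  "mod5_partitions K n = {l. is_partition n l \<and> parts_1_4_mod_5 l \<and> (\<forall>x\<in>set l. x \<le> K)}"

lemma finite_mod5_partitions [simp]: "finite (mod5_partitions K n)"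
  unfolding mod5_partitions_def by (rule finite_partitions_with)

lemma mod5_partitions_0: "mod5_partitions 0 n = (if n = 0 then {[]} else {})"
proof -
  have "l = [] \<and> n = 0" if "l \<in> mod5_partitions 0 n" for l
    using that by (cases l) (auto simp: mod5_partitions_def is_partition_def)
  moreover have "[] \<in> mod5_partitions 0 0"
    by (simp add: mod5_partitions_def is_partition_def parts_1_4_mod_5_def)
  ultimately show ?thesis by auto
qed

text \<open>Only one copy of the largest size is removed, so the remainder may still contain it. The
  recurrence thus refers to itself and yields the geometric factor
  \<open>1 / (1 - q ^ Suc K)\<close>.\<close>

lemma mod5_partitions_Suc:
  "mod5_partitions (Suc K) n = mod5_partitions K n \<union>
     (if (Suc K mod 5 = 1 \<or> Suc K mod 5 = 4) \<and> Suc K \<le> n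
      then (#) (Suc K) ` mod5_partitions (Suc K) (n - Suc K) else {})"
  (is "?L = ?R1 \<union> ?R2")
proof (intro subset_antisym subsetI)
  fix l assume l: "l \<in> ?L"
  show "l \<in> ?R1 \<union> ?R2"
  proof (cases "Suc K \<in> set l")
    case False
    with l show ?thesis by (force simp: mod5_partitions_def le_Suc_eq)
  next
    case True
    then obtain a l' where al: "l = a # l'" by (cases l) auto
    with True l have "a = Suc K"
      by (auto simp: mod5_partitions_def is_partition_def)
    with l show ?thesis
      by (auto simp: al mod5_partitions_def is_partition_def parts_1_4_mod_5_def)
  qed
next
  fix l assume "l \<in> ?R1 \<union> ?R2"
  then show "l \<in> ?L"
    by (auto simp: mod5_partitions_def is_partition_def parts_1_4_mod_5_def split: if_splits)
qed

lemma card_mod5_partitions_Suc: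
  "card (mod5_partitions (Suc K) n) = card (mod5_partitions K n) +
     (if (Suc K mod 5 = 1 \<or> Suc K mod 5 = 4) \<and> Suc K \<le> n
      then card (mod5_partitions (Suc K) (n - Suc K)) else 0)"
proof -
  let ?B = "if (Suc K mod 5 = 1 \<or> Suc K mod 5 = 4) \<and> Suc K \<le> n
      then (#) (Suc K) ` mod5_partitions (Suc K) (n - Suc K) else {}"
  have "mod5_partitions K n \<inter> ?B = {}"
    by (auto simp: mod5_partitions_def)
  then have "card (mod5_partitions (Suc K) n) = card (mod5_partitions K n) + card ?B"
    unfolding mod5_partitions_Suc[of K n] by (intro card_Un_disjoint) auto
  moreover have "card ((#) (Suc K) ` X) = card X" for X
    by (rule card_image) simp
  ultimately show ?thesis by (simp only: if_distrib[of card] card.empty)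
qed

lemma mod5_partitions_gf:
  assumes q: "0 < q" "q < 1"
  shows "(\<lambda>n. real (card (mod5_partitions K n)) * q ^ n) sums (\<Prod>s\<in>residues_1_4 K. 1 / (1 - q ^ s))"
proof (induction K)
  case 0
  have "real (card (mod5_partitions 0 n)) * q ^ n = (if n = 0 then 1 else 0)" for n
    by (simp add: mod5_partitions_0)
  then show ?case using sums_single[of 0 "\<lambda>_. 1 :: real"] by (simp add: residues_1_4_def)
next
  case (Suc K)
  show ?case
  proof (cases "Suc K mod 5 = 1 \<or> Suc K mod 5 = 4")
    case False
    then have "mod5_partitions (Suc K) n = mod5_partitions K n" for n
      using mod5_partitions_Suc[of K n] by simp
    with Suc.IH False show ?thesis by (simp add: residues_Suc)
  next
    case True
    have "(\<lambda>n. real (card (mod5_partitions (Suc K) n)) * q ^ n)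
        sums (q ^ 0 * (\<Prod>s\<in>residues_1_4 K. 1 / (1 - q ^ s)) / (1 - q ^ Suc K))"
    proof (rule sums_of_shift_recurrence[OF q _ _ _ _ Suc.IH])
      show "real (card (mod5_partitions (Suc K) n)) =
          (if Suc K \<le> n then real (card (mod5_partitions (Suc K) (n - Suc K))) else 0) +
          (if 0 \<le> n then real (card (mod5_partitions K (n - 0))) else 0)" for n
        using True by (subst card_mod5_partitions_Suc) simp
    qed simp_all
    moreover have "Suc K \<notin> residues_1_4 K" by (simp add: residues_1_4_def)
    ultimately show ?thesis using True by (simp add: residues_Suc)
  qed
qed

definition mod5_count :: "nat \<Rightarrow> nat" where
  "mod5_count n = card {l. is_partition n l \<and> parts_1_4_mod_5 l}"

definition rr_gf :: "real \<Rightarrow> real" where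
  "rr_gf q = (\<Sum>m. q ^ (m * m) / qpoch q m)"

lemma mod5_partitions_eq:
  assumes "n \<le> K"
  shows "mod5_partitions K n = {l. is_partition n l \<and> parts_1_4_mod_5 l}"
proof -
  have "x \<le> K" if "is_partition n l" "x \<in> set l" for l x
    using that assms member_le_sum_list[of x l] by (auto simp: is_partition_def)
  then show ?thesis by (auto simp: mod5_partitions_def)
qed

lemma mod5_partitions_gf_total:
  assumes q: "0 < q" "q < 1"
  shows "(\<lambda>n. real (mod5_count n) * q ^ n) sums rr_gf q"
proof (rule sums_of_exhaustion[where a' = "\<lambda>K n. real (card (mod5_partitions (5 * K) n))"
      and s = "\<lambda>K. \<Prod>s\<in>residues_1_4 (5 * K). 1 / (1 - q ^ s)"])
  show "real (card (mod5_partitions (5 * K) n)) \<le> real (mod5_count n)" for K n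
    unfolding mod5_count_def of_nat_le_iff
    by (rule card_mono[OF finite_partitions_with]) (auto simp: mod5_partitions_def)
  show "real (card (mod5_partitions (5 * K) n)) = real (mod5_count n)" if "n \<le> K" for K n
    unfolding mod5_count_def using mod5_partitions_eq[of n "5 * K"] that by simp
  show "(\<lambda>K. \<Prod>s\<in>residues_1_4 (5 * K). 1 / (1 - q ^ s)) \<longlonglongrightarrow> rr_gf q"
    unfolding prod_residues rr_gf_def using rogers_ramanujan[OF q] by simp
qed (simp_all add: q mod5_partitions_gf[OF q])

text \<open>The identity is known only for \<open>x\<close> in (0,1), so the coefficients are read
  off one by one: once the earlier ones vanish, dividing by \<open>x ^ n\<close> and letting
  \<open>x\<close> tend to 0 from the right leaves \<open>d n\<close>.\<close>

lemma power_series_coeff_zero: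
  fixes d :: "nat \<Rightarrow> real"
  assumes "\<And>x. 0 < x \<Longrightarrow> x < 1 \<Longrightarrow> (\<lambda>n. d n * x ^ n) sums 0"
  shows "d n = 0"
proof (induction n rule: less_induct)
  case (less n)
  have shifted: "(\<lambda>i. d (i + n) * x ^ i) sums 0" if x: "0 < x" "x < 1" for x
  proof -
    have "(\<lambda>i. d (i + n) * x ^ (i + n)) sums (0 - (\<Sum>i<n. d i * x ^ i))"
      using assms[OF x] by (subst sums_iff_shift) simp
    then have "(\<lambda>i. x ^ n * (d (i + n) * x ^ i)) sums (x ^ n * 0)"
      using less by (simp add: power_add mult_ac)
    from sums_mult_D[OF this] x show ?thesis by simp
  qed
  \<comment> \<open>Summability at one positive point gives convergence around 0, hence continuity
    there.\<close>
  have "summable (\<lambda>i. d (i + n) * (1 / 2) ^ i)"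
    using shifted[of "1 / 2"] by (simp add: sums_iff)
  then have "(\<lambda>i. d (i + n) * x ^ i) sums (\<Sum>i. d (i + n) * x ^ i)" if "norm x < 1 / 2" for x
    using powser_inside[of "\<lambda>i. d (i + n)" "1 / 2" x] that by (simp add: summable_sums)
  then have "((\<lambda>x. \<Sum>i. d (i + n) * x ^ i) \<longlongrightarrow> d (0 + n)) (at 0)"
    by (intro powser_limit_0[of "1 / 2"]) auto
  then have "((\<lambda>x. \<Sum>i. d (i + n) * x ^ i) \<longlongrightarrow> d n) (at_right 0)"
    by (simp add: filterlim_at_split)
  moreover have "\<forall>\<^sub>F x in at_right 0. (\<Sum>i. d (i + n) * x ^ i) = 0"
    using eventually_at_right_real[OF zero_less_one[where 'a = real]]
    by eventually_elim (use shifted in \<open>auto simp: sums_iff\<close>)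
  ultimately have "((\<lambda>x::real. 0) \<longlongrightarrow> d n) (at_right 0)"
    by (rule Lim_transform_eventually)
  then show ?case by (simp add: tendsto_const_iff)
qed

lemma gap_count_eq_mod5_count: "gap_count n = mod5_count n"
proof -
  have "real (gap_count n) - real (mod5_count n) = 0"
  proof (rule power_series_coeff_zero[of "\<lambda>n. real (gap_count n) - real (mod5_count n)"])
    fix x :: real assume "0 < x" "x < 1"
    then show "(\<lambda>n. (real (gap_count n) - real (mod5_count n)) * x ^ n) sums 0"
      using sums_diff[OF gap_partitions_gf_total mod5_partitions_gf_total, of x x]
      by (simp add: rr_gf_def algebra_simps)
  qed
  then show ?thesis by simp
qed

section \<open>Multiplicative weights and an exponential Markov inequality\<close>

definition part_weight :: "(nat \<Rightarrow> nat \<Rightarrow> real) \<Rightarrow> nat list \<Rightarrow> real" where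
  "part_weight f l = (\<Prod>x\<in>set l. f x (count_list l x))"

text \<open>With \<open>f s 0 = 1\<close> the product over the occurring sizes agrees with one over
  all sizes, so the copies of \<open>s\<close> split off even when there are none.\<close>

lemma part_weight_replicate:
  assumes "s \<notin> set l" "f s 0 = 1"
  shows "part_weight f (replicate k s @ l) = f s k * part_weight f l"
proof (cases "k = 0")
  case False
  have c: "count_list (replicate k s) x = (if x = s then k else 0)" for x
    by (induction k) auto
  have "(\<Prod>x\<in>set l. f x (count_list (replicate k s @ l) x)) = (\<Prod>x\<in>set l. f x (count_list l x))"
    using assms by (intro prod.cong) (auto simp: c)
  moreover have "count_list l s = 0" using assms by (simp add: count_list_0_iff)
  moreover have "set (replicate k s @ l) = insert s (set l)" using False by simp
  ultimately show ?thesis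
    using assms(1) unfolding part_weight_def by (simp add: c)
qed (use assms in simp)

lemma sorted_replicate_decomp:
  assumes "sorted_wrt (\<ge>) l" "\<forall>x\<in>set l. x \<le> (s::nat)"
  shows "\<exists>k l'. l = replicate k s @ l' \<and> sorted_wrt (\<ge>) l' \<and> (\<forall>x\<in>set l'. x < s)"
  using assms
proof (induction l)
  case (Cons a l)
  show ?case
  proof (cases "a = s")
    case True
    from Cons obtain k l' where "l = replicate k s @ l' \<and> sorted_wrt (\<ge>) l' \<and> (\<forall>x\<in>set l'. x < s)"
      by auto
    with True show ?thesis by (intro exI[of _ "Suc k"] exI[of _ l']) simp
  next
    case False
    with Cons.prems have "\<forall>x\<in>set (a # l). x < s" by fastforce
    with Cons.prems show ?thesis by (intro exI[of _ 0] exI[of _ "a # l"]) simp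
  qed
qed simp

text \<open>Expanding the product chooses a multiplicity for each size. All terms are nonnegative,
  so it is enough to cover the partitions by pairs of a multiplicity and a partition into smaller
  sizes; cutting at \<open>N\<close> keeps every sum finite.\<close>

lemma weighted_mod5_sum_le:
  assumes q: "0 < q" and f: "\<And>s k. 0 \<le> f s k" "\<And>s. f s 0 = 1"
    and F: "\<And>s. s \<in> residues_1_4 K \<Longrightarrow> (\<Sum>k\<le>N. f s k * q ^ (s * k)) \<le> F s"
  shows "(\<Sum>l\<in>(\<Union>n\<le>N. mod5_partitions K n). part_weight f l * q ^ sum_list l) \<le> (\<Prod>s\<in>residues_1_4 K. F s)"
  using F
proof (induction K)
  case 0
  have "(\<Union>n\<le>N. mod5_partitions 0 n) = {[]}"
    by (auto simp: mod5_partitions_0)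
  then show ?case by (simp add: residues_1_4_def part_weight_def)
next
  case (Suc K)
  let ?P = "\<lambda>K. \<Union>n\<le>N. mod5_partitions K n"
  let ?w = "\<lambda>l. part_weight f l * q ^ sum_list l"
  have w0: "0 \<le> ?w l" for l using q f by (simp add: part_weight_def prod_nonneg)
  have IH: "(\<Sum>l\<in>?P K. ?w l) \<le> (\<Prod>s\<in>residues_1_4 K. F s)"
    using Suc.prems by (intro Suc.IH) (auto simp: residues_Suc)
  show ?case
  proof (cases "Suc K mod 5 = 1 \<or> Suc K mod 5 = 4")
    case False
    then have "mod5_partitions (Suc K) n = mod5_partitions K n" for n
      using mod5_partitions_Suc[of K n] by simp
    with IH False show ?thesis by (simp add: residues_Suc)
  next
    case True
    let ?g = "\<lambda>(k, l). replicate k (Suc K) @ l"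
    have cover: "?P (Suc K) \<subseteq> ?g ` ({..N} \<times> ?P K)"
    proof
      fix l assume "l \<in> ?P (Suc K)"
      then have l: "sorted_wrt (\<ge>) l" "\<forall>x\<in>set l. 0 < x" "sum_list l \<le> N" "parts_1_4_mod_5 l"
          "\<forall>x\<in>set l. x \<le> Suc K"
        by (auto simp: mod5_partitions_def is_partition_def)
      obtain k l' where k: "l = replicate k (Suc K) @ l'" "sorted_wrt (\<ge>) l'" "\<forall>x\<in>set l'. x < Suc K"
        using sorted_replicate_decomp[OF l(1,5)] by metis
      have "k * Suc K + sum_list l' \<le> N" using l(3) by (simp add: k(1) sum_list_replicate)
      moreover have "k \<le> k * Suc K" by simp
      ultimately have "k \<le> N" "sum_list l' \<le> N" by linarith+
      moreover have "l' \<in> mod5_partitions K (sum_list l')"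
      proof -
        have "set l' \<subseteq> set l" by (simp add: k(1))
        then have "\<forall>x\<in>set l'. 0 < x" "parts_1_4_mod_5 l'" "\<forall>x\<in>set l'. x \<le> K"
          using l(2,4) k(3) by (auto simp: parts_1_4_mod_5_def less_Suc_eq_le)
        with k(2) show ?thesis by (simp add: mod5_partitions_def is_partition_def)
      qed
      ultimately show "l \<in> ?g ` ({..N} \<times> ?P K)"
        by (intro image_eqI[of _ _ "(k, l')"]) (auto simp: k(1))
    qed
    have "(\<Sum>l\<in>?P (Suc K). ?w l) \<le> (\<Sum>l\<in>?g ` ({..N} \<times> ?P K). ?w l)"
      by (rule sum_mono2[OF _ cover]) (auto simp: w0)
    also have "\<dots> \<le> (\<Sum>p\<in>{..N} \<times> ?P K. ?w (?g p))"
      by (rule sum_image_le[of _ ?w ?g, unfolded comp_def]) (auto simp: w0)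
    also have "\<dots> = (\<Sum>(k, l)\<in>{..N} \<times> ?P K. (f (Suc K) k * q ^ (Suc K * k)) * ?w l)"
    proof (intro sum.cong refl)
      fix p assume "p \<in> {..N} \<times> ?P K"
      then obtain k l n where p: "p = (k, l)" "l \<in> mod5_partitions K n" by auto
      then have "Suc K \<notin> set l" by (auto simp: mod5_partitions_def)
      then have "part_weight f (replicate k (Suc K) @ l) = f (Suc K) k * part_weight f l"
        by (rule part_weight_replicate) (rule f)
      then show "?w (?g p) = (case p of (k, l) \<Rightarrow> (f (Suc K) k * q ^ (Suc K * k)) * ?w l)"
        by (simp add: p(1) sum_list_replicate power_add mult_ac)
    qed
    also have "\<dots> = (\<Sum>k\<le>N. f (Suc K) k * q ^ (Suc K * k)) * (\<Sum>l\<in>?P K. ?w l)"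
      by (simp only: sum_product sum.cartesian_product)
    also have "\<dots> \<le> F (Suc K) * (\<Prod>s\<in>residues_1_4 K. F s)"
    proof (rule mult_mono[OF _ IH])
      show *: "(\<Sum>k\<le>N. f (Suc K) k * q ^ (Suc K * k)) \<le> F (Suc K)"
        by (rule Suc.prems) (use True in \<open>simp add: residues_Suc\<close>)
      have "0 \<le> (\<Sum>k\<le>N. f (Suc K) k * q ^ (Suc K * k))"
        using f q by (intro sum_nonneg) auto
      with * show "0 \<le> F (Suc K)" by simp
    qed (auto intro!: sum_nonneg w0)
    also have "\<dots> = (\<Prod>s\<in>residues_1_4 (Suc K). F s)"
    proof -
      have "Suc K \<notin> residues_1_4 K" by (simp add: residues_1_4_def)
      then show ?thesis using True by (simp add: residues_Suc)
    qed
    finally show ?thesis .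
  qed
qed

text \<open>The weights depend only on whether a multiplicity is 0, 1 or larger, which is all that
  hooks of length 1 and 2 detect here. The bound is the full series.\<close>

lemma truncated_geometric_le:
  fixes x a b :: real
  assumes "0 < x" "x < 1" "0 \<le> a" "0 \<le> b"
  shows "(\<Sum>k\<le>N. (if k = 0 then 1 else if k = 1 then a else b) * x ^ k) \<le> 1 + a * x + b * x\<^sup>2 / (1 - x)"
proof (cases N)
  case 0
  then show ?thesis using assms by simp
next
  case (Suc M)
  have "(\<Sum>k\<le>Suc M. (if k = 0 then 1 else if k = 1 then a else b) * x ^ k)
      = 1 + a * x + b * x\<^sup>2 / (1 - x) - b * x ^ (M + 2) / (1 - x)"
  proof (induction M)
    case (Suc M)
    have "b * x ^ (M + 2) / (1 - x) - b * x ^ (Suc M + 2) / (1 - x) = b * x ^ (M + 2) * (1 - x) / (1 - x)"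
      by (simp add: algebra_simps diff_divide_distrib)
    then have "b * x ^ (M + 2) / (1 - x) - b * x ^ (Suc M + 2) / (1 - x) = b * x ^ (M + 2)"
      using assms by simp
    moreover have "(\<Sum>k\<le>Suc (Suc M). (if k = 0 then 1 else if k = 1 then a else b) * x ^ k)
      = (\<Sum>k\<le>Suc M. (if k = 0 then 1 else if k = 1 then a else b) * x ^ k) + b * x ^ (M + 2)"
      by simp
    ultimately show ?case using Suc.IH by linarith
  qed (simp add: power2_eq_square)
  moreover have "0 \<le> b * x ^ (M + 2) / (1 - x)" using assms by simp
  ultimately show ?thesis unfolding Suc by linarith
qed

lemma residues_prod_le_rr_gf:
  assumes q: "0 < q" "q < 1"
  shows "(\<Prod>s\<in>residues_1_4 (5 * N). 1 / (1 - q ^ s)) \<le> rr_gf q"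
proof -
  have *: "1 \<le> 1 / (1 - q ^ s)" if "0 < s" for s
    using one_minus_power_pos[OF q that] q by simp
  have **: "0 \<le> 1 / (1 - q ^ s)" if "0 < s" for s
    using order_trans[OF zero_le_one *[OF that]] .
  have "incseq (\<lambda>N. \<Prod>s\<in>residues_1_4 (5 * N). 1 / (1 - q ^ s))"
  proof (rule incseq_SucI)
    fix N
    have "1 * 1 \<le> 1 / (1 - q ^ (5 * N + 1)) * (1 / (1 - q ^ (5 * N + 4)))"
      by (intro mult_mono * **) auto
    then have 1: "1 \<le> 1 / (1 - q ^ (5 * N + 1)) * (1 / (1 - q ^ (5 * N + 4)))"
      by (simp only: mult_1_left)
    have 2: "0 \<le> (\<Prod>i<N. 1 / (1 - q ^ (5 * i + 1)) * (1 / (1 - q ^ (5 * i + 4))))"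
      by (intro prod_nonneg mult_nonneg_nonneg **) auto
    show "(\<Prod>s\<in>residues_1_4 (5 * N). 1 / (1 - q ^ s)) \<le> (\<Prod>s\<in>residues_1_4 (5 * Suc N). 1 / (1 - q ^ s))"
      unfolding prod_residues prod.lessThan_Suc using mult_left_mono[OF 1 2] by (simp only: mult_1_right)
  qed
  moreover have "(\<lambda>N. \<Prod>s\<in>residues_1_4 (5 * N). 1 / (1 - q ^ s)) \<longlonglongrightarrow> rr_gf q"
    unfolding prod_residues rr_gf_def using rogers_ramanujan[OF q] by simp
  ultimately show ?thesis by (rule incseq_le)
qed

text \<open>A Chernoff bound: on the event \<open>R\<close> the weight is at least \<open>c\<close>.
  Each local factor is compared with the unweighted \<open>1 / (1 - q ^ s)\<close>, so the
  generating function splits off and only the exponents \<open>e s\<close> remain to be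
  summed.\<close>

lemma mod5_exponential_markov:
  assumes q: "0 < q" "q < 1" and f: "\<And>s k. 0 \<le> f s k" "\<And>s. f s 0 = 1"
    and F: "\<And>s M. 0 < s \<Longrightarrow> (\<Sum>k\<le>M. f s k * q ^ (s * k)) \<le> 1 / (1 - q ^ s) * exp (e s)"
    and R: "\<And>l. R l \<Longrightarrow> c \<le> part_weight f l" and n: "n \<le> N"
  shows "real (card {l. is_partition n l \<and> parts_1_4_mod_5 l \<and> R l}) * c * q ^ n
    \<le> rr_gf q * exp (\<Sum>i<N. e (5 * i + 1) + e (5 * i + 4))"
proof -
  let ?P = "{l. is_partition n l \<and> parts_1_4_mod_5 l \<and> R l}"
  let ?w = "\<lambda>l. part_weight f l * q ^ sum_list l"
  have w0: "0 \<le> ?w l" for l using q f by (simp add: part_weight_def prod_nonneg)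
  have "real (card ?P) * c * q ^ n = (\<Sum>l\<in>?P. c * q ^ n)" by simp
  also have "\<dots> \<le> (\<Sum>l\<in>?P. ?w l)"
    using q R by (intro sum_mono) (auto simp: is_partition_def intro!: mult_right_mono)
  also have "\<dots> \<le> (\<Sum>l\<in>(\<Union>m\<le>5 * N. mod5_partitions (5 * N) m). ?w l)"
  proof (intro sum_mono2 w0)
    have "?P \<subseteq> mod5_partitions (5 * N) n"
      using n by (subst mod5_partitions_eq) auto
    then show "?P \<subseteq> (\<Union>m\<le>5 * N. mod5_partitions (5 * N) m)"
      using n by (auto intro!: bexI[of _ n])
  qed auto
  also have "\<dots> \<le> (\<Prod>s\<in>residues_1_4 (5 * N). 1 / (1 - q ^ s) * exp (e s))"
    by (rule weighted_mod5_sum_le[OF q(1) f F]) (auto simp: residues_1_4_def)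
  also have "\<dots> = (\<Prod>s\<in>residues_1_4 (5 * N). 1 / (1 - q ^ s)) * exp (\<Sum>s\<in>residues_1_4 (5 * N). e s)"
    by (simp only: prod.distrib exp_sum[OF finite_residues])
  also have "\<dots> \<le> rr_gf q * exp (\<Sum>s\<in>residues_1_4 (5 * N). e s)"
    by (intro mult_right_mono residues_prod_le_rr_gf q) simp
  finally show ?thesis unfolding sum_residues .
qed

lemma rr_gf_pos:
  assumes q: "0 < q" "q < 1"
  shows "0 < rr_gf q"
  using residues_prod_le_rr_gf[OF q, of 0] by (simp add: residues_1_4_def)

lemma geometric_residues:
  fixes x :: real
  assumes "0 < x" "x < 1"
  shows "(\<lambda>i. x ^ (5 * i + 1) + x ^ (5 * i + 4)) sums ((x + x ^ 4) / (1 - x ^ 5))"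
proof -
  have "x ^ 5 < 1" using assms by (simp add: power_less_one_iff)
  then have "(\<lambda>i. (x + x ^ 4) * (x ^ 5) ^ i) sums ((x + x ^ 4) * (1 / (1 - x ^ 5)))"
    using assms by (intro sums_mult geometric_sums) simp
  moreover have "(x + x ^ 4) * (x ^ 5) ^ i = x ^ (5 * i + 1) + x ^ (5 * i + 4)" for i
    by (simp add: algebra_simps power_add flip: power_mult)
  ultimately show ?thesis by simp
qed

text \<open>With weight \<open>y\<close> for each occurring size the local factor is
  \<open>(1 + (y - 1) x) / (1 - x)\<close> at \<open>x = q ^ s\<close>, and \<open>1 + z\<close> is
  at most \<open>exp z\<close>.\<close>

lemma many_distinct_parts_count:
  assumes q: "0 < q" "q < 1" and y: "1 \<le> y"
  shows "real (card {l. is_partition n l \<and> parts_1_4_mod_5 l \<and> b \<le> card (set l)}) * y ^ b * q ^ n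
    \<le> rr_gf q * exp ((y - 1) * ((q + q ^ 4) / (1 - q ^ 5)))"
proof -
  define f where "f s k = (if k = 0 then 1 else y)" for s k :: nat
  have "real (card {l. is_partition n l \<and> parts_1_4_mod_5 l \<and> b \<le> card (set l)}) * y ^ b * q ^ n
    \<le> rr_gf q * exp (\<Sum>i<n. (y - 1) * q ^ (5 * i + 1) + (y - 1) * q ^ (5 * i + 4))"
  proof (rule mod5_exponential_markov[OF q, of f "\<lambda>s. (y - 1) * q ^ s"])
    show "y ^ b \<le> part_weight f l" if "b \<le> card (set l)" for l
    proof -
      have "part_weight f l = (\<Prod>x\<in>set l. y)"
        unfolding part_weight_def by (intro prod.cong) (auto simp: f_def count_list_0_iff)
      then show ?thesis using that y by (simp add: power_increasing)
    qed
    show "(\<Sum>k\<le>M. f s k * q ^ (s * k)) \<le> 1 / (1 - q ^ s) * exp ((y - 1) * q ^ s)" if "0 < s" for s M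
    proof -
      define x where "x = q ^ s"
      have x: "0 < x" "x < 1" using q one_minus_power_pos[OF q that] by (auto simp: x_def)
      have "(\<Sum>k\<le>M. f s k * q ^ (s * k)) = (\<Sum>k\<le>M. (if k = 0 then 1 else if k = 1 then y else y) * x ^ k)"
        by (intro sum.cong) (auto simp: f_def x_def power_mult)
      also have "\<dots> \<le> 1 + y * x + y * x\<^sup>2 / (1 - x)"
        using x y by (intro truncated_geometric_le) auto
      also have "\<dots> = 1 / (1 - x) * (1 + (y - 1) * x)"
        using x by (simp add: field_simps power2_eq_square)
      also have "\<dots> \<le> 1 / (1 - x) * exp ((y - 1) * x)"
        using x by (intro mult_left_mono exp_ge_add_one_self) auto
      finally show ?thesis by (simp add: x_def)
    qed
  qed (use y in \<open>auto simp: f_def\<close>)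
  also have "(\<Sum>i<n. (y - 1) * q ^ (5 * i + 1) + (y - 1) * q ^ (5 * i + 4))
      = (y - 1) * (\<Sum>i<n. q ^ (5 * i + 1) + q ^ (5 * i + 4))"
    by (simp add: sum_distrib_left distrib_left)
  also have "rr_gf q * exp \<dots> \<le> rr_gf q * exp ((y - 1) * ((q + q ^ 4) / (1 - q ^ 5)))"
  proof -
    have "(\<Sum>i<n. q ^ (5 * i + 1) + q ^ (5 * i + 4)) \<le> (q + q ^ 4) / (1 - q ^ 5)"
      using geometric_residues[OF q] q
        sum_le_suminf[of "\<lambda>i. q ^ (5 * i + 1) + q ^ (5 * i + 4)" "{..<n}"] by (auto simp: sums_iff)
    then show ?thesis
      using rr_gf_pos[OF q] y by (intro mult_left_mono iffD2[OF exp_le_cancel_iff]) auto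
  qed
  finally show ?thesis .
qed

text \<open>The lower bound from \<open>num_hooks_two_ge\<close>. It is a sum over sizes of terms
  depending on size and multiplicity, so \<open>y\<close> to this power is a
  \<open>part_weight\<close>.\<close>

definition hook_lower :: "nat list \<Rightarrow> nat" where
  "hook_lower l = card {s \<in> set l. 2 \<le> s} + card {s \<in> set l. 2 \<le> count_list l s}"

text \<open>For sizes from 2 on, the local factor is
  \<open>(1 - (1 - y) (x + y x^2)) / (1 - x)\<close> at \<open>x = q ^ s\<close>. The size 1 counts
  only when repeated, whence the correction \<open>- q\<close>.\<close>

lemma few_hooks_count:
  assumes q: "0 < q" "q < 1" and y: "0 < y" "y \<le> 1"
  shows "real (card {l. is_partition n l \<and> parts_1_4_mod_5 l \<and> hook_lower l \<le> b}) * y ^ b * q ^ n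
    \<le> rr_gf q * exp (- (1 - y) * ((q + q ^ 4) / (1 - q ^ 5) - q + y * ((q ^ 2 + q ^ 8) / (1 - q ^ 10))))"
proof -
  define f where "f s k = y ^ ((if 2 \<le> s \<and> 0 < k then 1 else 0) + (if 2 \<le> k then 1 else 0))" for s k :: nat
  define g where "g s = (if s = 1 then 0 else q ^ s) + y * q ^ (2 * s)" for s :: nat
  define e where "e s = - (1 - y) * g s" for s
  let ?card = "real (card {l. is_partition n l \<and> parts_1_4_mod_5 l \<and> hook_lower l \<le> b})"
  have bound: "?card * y ^ b * q ^ n \<le> rr_gf q * exp (\<Sum>i<N. e (5 * i + 1) + e (5 * i + 4))" if "n \<le> N" for N
  proof (rule mod5_exponential_markov[OF q, of f e, OF _ _ _ _ that])
    show "y ^ b \<le> part_weight f l" if "hook_lower l \<le> b" for l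
    proof -
      have "part_weight f l = y ^ (\<Sum>x\<in>set l. (if 2 \<le> x \<and> 0 < count_list l x then 1 else 0) + (if 2 \<le> count_list l x then 1 else 0))"
        unfolding part_weight_def f_def by (rule power_sum[symmetric])
      also have "(\<Sum>x\<in>set l. (if 2 \<le> x \<and> 0 < count_list l x then 1 else 0) + (if 2 \<le> count_list l x then 1 else 0))
         = (\<Sum>x\<in>set l. (if 2 \<le> x then 1 else 0) + (if 2 \<le> count_list l x then 1 else 0))"
        by (intro sum.cong refl) (auto simp: count_list_0_iff)
      also have "\<dots> = hook_lower l"
        unfolding sum.distrib hook_lower_def by (simp add: sum.If_cases Int_def conj_commute)
      finally show ?thesis using that y by (simp add: power_decreasing)
    qed
    show "(\<Sum>k\<le>M. f s k * q ^ (s * k)) \<le> 1 / (1 - q ^ s) * exp (e s)" if "0 < s" for s M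
    proof -
      define x where "x = q ^ s"
      have x: "0 < x" "x < 1" using q one_minus_power_pos[OF q that] by (auto simp: x_def)
      have *: "1 / (1 - x) * (1 + z) \<le> 1 / (1 - x) * exp z" for z
        using x by (intro mult_left_mono exp_ge_add_one_self) auto
      have x2: "q ^ (2 * s) = x\<^sup>2" by (simp add: x_def mult.commute flip: power_mult)
      show ?thesis
      proof (cases "s = 1")
        case True
        have "(\<Sum>k\<le>M. f s k * q ^ (s * k)) = (\<Sum>k\<le>M. (if k = 0 then 1 else if k = 1 then 1 else y) * x ^ k)"
          using True by (intro sum.cong) (auto simp: f_def x_def)
        also have "\<dots> \<le> 1 + 1 * x + y * x\<^sup>2 / (1 - x)"
          using x y by (intro truncated_geometric_le) auto
        also have "\<dots> = 1 / (1 - x) * (1 + - (1 - y) * x\<^sup>2)"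
          using x by (simp add: field_simps power2_eq_square)
        \<comment> \<open>Weakening \<open>x^2\<close> to \<open>y x^2\<close> lets the size 1 share
          the repetition term of the other sizes.\<close>
        also have "\<dots> \<le> 1 / (1 - x) * (1 + - (1 - y) * (y * x\<^sup>2))"
        proof -
          have "(1 - y) * (y * x\<^sup>2) \<le> (1 - y) * (1 * x\<^sup>2)"
            using x y by (intro mult_left_mono mult_right_mono) auto
          then have "1 + - (1 - y) * x\<^sup>2 \<le> 1 + - (1 - y) * (y * x\<^sup>2)"
            by (simp add: algebra_simps)
          then show ?thesis using x by (intro mult_left_mono) auto
        qed
        also note *
        also have "- (1 - y) * (y * x\<^sup>2) = e s"
          unfolding e_def g_def x2 using True by simp
        finally show ?thesis by (simp add: x_def)
      next
        case False
        have "(\<Sum>k\<le>M. f s k * q ^ (s * k)) = (\<Sum>k\<le>M. (if k = 0 then 1 else if k = 1 then y else y\<^sup>2) * x ^ k)"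
          using False that by (intro sum.cong) (auto simp: f_def x_def power_mult power2_eq_square)
        also have "\<dots> \<le> 1 + y * x + y\<^sup>2 * x\<^sup>2 / (1 - x)"
          using x y by (intro truncated_geometric_le) auto
        also have "\<dots> = 1 / (1 - x) * (1 + - (1 - y) * (x + y * x\<^sup>2))"
          using x by (simp add: field_simps power2_eq_square)
        also note *
        also have "- (1 - y) * (x + y * x\<^sup>2) = e s"
          using False by (simp add: e_def g_def x2) (simp add: x_def)
        finally show ?thesis by (simp add: x_def)
      qed
    qed
  qed (use y in \<open>auto simp: f_def\<close>)
  have q2: "0 < q\<^sup>2" "q\<^sup>2 < 1" using q by (auto simp: power_less_one_iff)
  have "(\<lambda>i. (if i = 0 then - q else 0) + (q ^ (5 * i + 1) + q ^ (5 * i + 4))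
        + y * ((q\<^sup>2) ^ (5 * i + 1) + (q\<^sup>2) ^ (5 * i + 4)))
      sums (- q + (q + q ^ 4) / (1 - q ^ 5) + y * ((q\<^sup>2 + (q\<^sup>2) ^ 4) / (1 - (q\<^sup>2) ^ 5)))"
    by (intro sums_add sums_mult geometric_residues q q2 sums_single[of 0 "\<lambda>_. - q"])
  also have "(\<lambda>i. (if i = 0 then - q else 0) + (q ^ (5 * i + 1) + q ^ (5 * i + 4))
        + y * ((q\<^sup>2) ^ (5 * i + 1) + (q\<^sup>2) ^ (5 * i + 4))) = (\<lambda>i. g (5 * i + 1) + g (5 * i + 4))"
    by (auto simp: g_def fun_eq_iff algebra_simps power_mult power_add power2_eq_square)
  finally have "(\<lambda>i. - (1 - y) * (g (5 * i + 1) + g (5 * i + 4))) sums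
      (- (1 - y) * (- q + (q + q ^ 4) / (1 - q ^ 5) + y * ((q\<^sup>2 + (q\<^sup>2) ^ 4) / (1 - (q\<^sup>2) ^ 5))))"
    by (rule sums_mult)
  also have "(\<lambda>i. - (1 - y) * (g (5 * i + 1) + g (5 * i + 4))) = (\<lambda>i. e (5 * i + 1) + e (5 * i + 4))"
    by (simp add: e_def distrib_left)
  also have "- (1 - y) * (- q + (q + q ^ 4) / (1 - q ^ 5) + y * ((q\<^sup>2 + (q\<^sup>2) ^ 4) / (1 - (q\<^sup>2) ^ 5)))
     = - (1 - y) * ((q + q ^ 4) / (1 - q ^ 5) - q + y * ((q ^ 2 + q ^ 8) / (1 - q ^ 10)))"
    by (simp flip: power_mult)
  \<comment> \<open>The exponents are negative here, so a partial sum does not suffice: the bound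
    holds for every \<open>N\<close> from \<open>n\<close> on, and the limit collects all of
    them.\<close>
  finally have "(\<lambda>N. rr_gf q * exp (\<Sum>i<N. e (5 * i + 1) + e (5 * i + 4))) \<longlonglongrightarrow>
     rr_gf q * exp (- (1 - y) * ((q + q ^ 4) / (1 - q ^ 5) - q + y * ((q ^ 2 + q ^ 8) / (1 - q ^ 10))))"
    unfolding sums_def by (intro tendsto_mult tendsto_exp tendsto_const)
  then show ?thesis
    by (rule LIMSEQ_le_const) (use bound in blast)
qed

section \<open>Growth of the coefficients\<close>

text \<open>Expand each \<open>- ln (1 - q ^ s)\<close> of the product side into
  \<open>q ^ (s * k) / k\<close>, exchange the sums by dominated convergence, and sum over
  \<open>s\<close> geometrically. The term \<open>k = 0\<close> is 0 since
  \<open>1 / real 0 = 0\<close>.\<close>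

lemma ln_rr_gf:
  assumes q: "0 < q" "q < 1"
  shows "ln (rr_gf q) = (\<Sum>k. 1 / real k * ((q ^ k + (q ^ k) ^ 4) / (1 - (q ^ k) ^ 5)))"
proof -
  define c where "c k N = 1 / real k * (\<Sum>i<N. (q ^ k) ^ (5 * i + 1) + (q ^ k) ^ (5 * i + 4))" for k N
  have ln1: "(\<lambda>k. 1 / real k * (q ^ k) ^ s) sums - ln (1 - q ^ s)" if "0 < s" for s
  proof -
    have "q ^ s < 1" "0 < q ^ s" using one_minus_power_pos[OF q that] q by auto
    then have "(\<lambda>n. - ((- (- (q ^ s))) ^ n) / of_nat n) sums ln (1 + - (q ^ s))"
      by (intro ln_series') auto
    from sums_minus[OF this] show ?thesis
      by (simp add: mult.commute flip: power_mult)
  qed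
  have pos: "0 < 1 - q ^ s" if "0 < s" for s by (rule one_minus_power_pos[OF q that])
  define P where "P N = (\<Prod>i<N. 1 / ((1 - q ^ (5 * i + 1)) * (1 - q ^ (5 * i + 4))))" for N
  have "ln (P N) = (\<Sum>k. c k N)" for N
  proof -
    have "ln (P N) = (\<Sum>i<N. - ln (1 - q ^ (5 * i + 1)) + - ln (1 - q ^ (5 * i + 4)))"
    proof -
      have nz: "q * q ^ (5 * i) \<noteq> 1" "q ^ (5 * i + 4) \<noteq> 1" for i
        using pos[of "5 * i + 1"] pos[of "5 * i + 4"] by simp_all
      have "ln (P N) = (\<Sum>i<N. ln (1 / ((1 - q ^ (5 * i + 1)) * (1 - q ^ (5 * i + 4)))))"
        unfolding P_def by (rule ln_prod) (use nz in simp_all)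
      also have "\<dots> = (\<Sum>i<N. - ln (1 - q ^ (5 * i + 1)) + - ln (1 - q ^ (5 * i + 4)))"
        by (intro sum.cong refl) (use pos in \<open>simp add: ln_div ln_mult nz\<close>)
      finally show ?thesis .
    qed
    moreover have "(\<lambda>k. \<Sum>i<N. 1 / real k * (q ^ k) ^ (5 * i + 1) + 1 / real k * (q ^ k) ^ (5 * i + 4))
        sums (\<Sum>i<N. - ln (1 - q ^ (5 * i + 1)) + - ln (1 - q ^ (5 * i + 4)))"
      by (rule sums_sum) (intro sums_add ln1; simp)
    moreover have "(\<lambda>k. \<Sum>i<N. 1 / real k * (q ^ k) ^ (5 * i + 1) + 1 / real k * (q ^ k) ^ (5 * i + 4)) = (\<lambda>k. c k N)"
      by (simp only: c_def sum_distrib_left distrib_left)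
    ultimately show ?thesis by (simp only: sums_iff)
  qed
  moreover have "(\<lambda>N. \<Sum>k. c k N) \<longlonglongrightarrow> (\<Sum>k. 1 / real k * ((q ^ k + (q ^ k) ^ 4) / (1 - (q ^ k) ^ 5)))"
  proof (rule tannerys_theorem[THEN conjunct2, THEN conjunct2])
    have x: "0 < q ^ k" "q ^ k < 1" if "k \<noteq> 0" for k
      using pos[of k] that q by auto
    show "(\<lambda>N. c k N) \<longlonglongrightarrow> 1 / real k * ((q ^ k + (q ^ k) ^ 4) / (1 - (q ^ k) ^ 5))" for k
    proof (cases "k = 0")
      case False
      then show ?thesis
        unfolding c_def using geometric_residues[OF x] unfolding sums_def by (intro tendsto_intros) auto
    qed (simp add: c_def)
    show "summable (\<lambda>k. q ^ k * (2 / (1 - q ^ 5)))"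
      using q by (intro summable_mult2 summable_geometric) auto
    have "norm (c k N) \<le> q ^ k * (2 / (1 - q ^ 5))" for k N
    proof (cases "k = 0")
      case False
      have q5: "0 < 1 - q ^ 5" by (rule pos) simp
      have "(q ^ k) ^ 5 \<le> q ^ 5"
        using False q by (subst power_mult[symmetric]) (intro power_decreasing, auto)
      then have le: "1 - q ^ 5 \<le> 1 - (q ^ k) ^ 5" by simp
      have "(q ^ k) ^ 4 \<le> (q ^ k) ^ 1"
        using x[OF False] by (intro power_decreasing) auto
      then have le2: "q ^ k + (q ^ k) ^ 4 \<le> q ^ k * 2" by simp
      have "(\<Sum>i<N. (q ^ k) ^ (5 * i + 1) + (q ^ k) ^ (5 * i + 4)) \<le> (q ^ k + (q ^ k) ^ 4) / (1 - (q ^ k) ^ 5)"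
        using geometric_residues[OF x[OF False]] x[OF False]
          sum_le_suminf[of "\<lambda>i. (q ^ k) ^ (5 * i + 1) + (q ^ k) ^ (5 * i + 4)" "{..<N}"] by (auto simp: sums_iff)
      also have "\<dots> \<le> q ^ k * 2 / (1 - q ^ 5)"
        using le le2 q5 q by (intro frac_le) auto
      finally have S: "(\<Sum>i<N. (q ^ k) ^ (5 * i + 1) + (q ^ k) ^ (5 * i + 4)) \<le> q ^ k * 2 / (1 - q ^ 5)" .
      have S0: "0 \<le> (\<Sum>i<N. (q ^ k) ^ (5 * i + 1) + (q ^ k) ^ (5 * i + 4))"
        using q by (intro sum_nonneg) auto
      have "norm (c k N) = 1 / real k * (\<Sum>i<N. (q ^ k) ^ (5 * i + 1) + (q ^ k) ^ (5 * i + 4))"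
        unfolding c_def real_norm_def by (rule abs_of_nonneg) (intro mult_nonneg_nonneg S0, simp)
      also have "\<dots> \<le> 1 * (q ^ k * 2 / (1 - q ^ 5))"
        using False by (intro mult_mono S S0) auto
      finally show ?thesis by simp
    qed (use q in \<open>simp add: c_def power_le_one\<close>)
    then show "\<forall>\<^sub>F (k, N) in sequentially \<times>\<^sub>F sequentially. norm (c k N) \<le> q ^ k * (2 / (1 - q ^ 5))"
      by (intro always_eventually) auto
  qed simp
  moreover have "(\<lambda>N. ln (P N)) \<longlonglongrightarrow> ln (rr_gf q)"
    unfolding P_def using rogers_ramanujan[OF q] rr_gf_pos[OF q]
    by (intro tendsto_ln) (auto simp: rr_gf_def)
  ultimately show ?thesis
    using LIMSEQ_unique by auto
qed

text \<open>The term \<open>k = 0\<close> is 0, since \<open>1 / 0 = 0\<close>.\<close>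

definition growth_const :: real where
  "growth_const = (\<Sum>k. 1 / (real k)\<^sup>2 * (2 / 5))"

lemma growth_const_pos: "0 < growth_const"
  unfolding growth_const_def
proof (rule suminf_pos2[of _ 1])
  show "summable (\<lambda>k. 1 / (real k)\<^sup>2 * (2 / 5))"
    using inverse_power_summable[of 2, where 'a = real]
    by (intro summable_mult2) (simp add: inverse_eq_divide)
qed auto

text \<open>Each term times \<open>t\<close> is \<open>g (k * t) / k^2\<close>, where
  \<open>g\<close> tends to 2/5 at 0 and is bounded by 2. So the limit is 2/5 of the sum of
  \<open>1 / k^2\<close>, that is \<open>pi^2 / 15\<close>.\<close>

lemma rr_gf_growth: "((\<lambda>t. t * ln (rr_gf (exp (- t)))) \<longlongrightarrow> growth_const) (at_right 0)"
proof -
  define g where "g x = x * ((exp (- x) + exp (- x) ^ 4) / (1 - exp (- x) ^ 5))" for x :: real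
  have g0: "(g \<longlongrightarrow> 2 / 5) (at_right 0)"
    unfolding g_def by real_asymp
  have gb: "\<bar>g x\<bar> \<le> 2" if "0 < x" for x
  proof -
    define y where "y = exp (- x)"
    have y: "0 < y" "y < 1" using that by (auto simp: y_def)
    have "y ^ 5 \<le> y ^ 1" "y ^ 4 \<le> y ^ 1" using y by (intro power_decreasing; simp)+
    then have "(y + y ^ 4) / (1 - y ^ 5) \<le> (2 * y) / (1 - y)"
      using y by (intro frac_le) auto
    also have "x * y \<le> 1 - y"
    proof -
      have "(1 + x) * y \<le> exp x * y"
        using y by (intro mult_right_mono exp_ge_add_one_self) auto
      also have "\<dots> = 1" by (simp add: y_def flip: exp_add)
      finally show ?thesis by (simp add: algebra_simps)
    qed
    then have "x * ((2 * y) / (1 - y)) \<le> 2"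
      using y by (simp add: field_simps)
    finally have "g x \<le> 2"
      using that unfolding g_def y_def[symmetric] by (meson mult_left_mono order_trans less_imp_le)
    moreover have "0 \<le> g x"
      unfolding g_def y_def[symmetric] using that y by (auto simp: power_le_one)
    ultimately show ?thesis by simp
  qed
  have "((\<lambda>t. \<Sum>k. 1 / (real k)\<^sup>2 * g (real k * t)) \<longlongrightarrow> growth_const) (at_right 0)"
    unfolding growth_const_def
  proof (rule tannerys_theorem[THEN conjunct2, THEN conjunct2])
    show "((\<lambda>t. 1 / (real k)\<^sup>2 * g (real k * t)) \<longlongrightarrow> 1 / (real k)\<^sup>2 * (2 / 5)) (at_right 0)" for k
    proof (cases "k = 0")
      case False
      then have "filterlim (\<lambda>t. real k * t) (at_right 0) (at_right 0)"
        by real_asymp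
      from filterlim_compose[OF g0 this] show ?thesis by (intro tendsto_intros)
    qed simp
    show "summable (\<lambda>k. 1 / (real k)\<^sup>2 * 2)"
      using inverse_power_summable[of 2, where 'a = real]
      by (intro summable_mult2) (simp add: inverse_eq_divide)
    have *: "norm (1 / (real k)\<^sup>2 * g (real k * t)) \<le> 1 / (real k)\<^sup>2 * 2" if "0 < t" for k t
    proof (cases "k = 0")
      case False
      then show ?thesis
        using gb[of "real k * t"] that by (simp add: abs_mult divide_right_mono)
    qed simp
    show "\<forall>\<^sub>F (k, t) in sequentially \<times>\<^sub>F at_right 0. norm (1 / (real k)\<^sup>2 * g (real k * t)) \<le> 1 / (real k)\<^sup>2 * 2"
      using eventually_prodI[OF eventually_True[of sequentially] eventually_at_right_less[of "0::real"]]
      by eventually_elim (use * in auto)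
  qed simp
  moreover have "\<forall>\<^sub>F t in at_right 0. (\<Sum>k. 1 / (real k)\<^sup>2 * g (real k * t)) = t * ln (rr_gf (exp (- t)))"
    using eventually_at_right_less[of "0::real"]
  proof eventually_elim
    case (elim t)
    then have q: "0 < exp (- t)" "exp (- t) < 1" by auto
    have e: "1 / (real k)\<^sup>2 * g (real k * t) = t * (1 / real k * ((exp (- t) ^ k + (exp (- t) ^ k) ^ 4) / (1 - (exp (- t) ^ k) ^ 5)))" for k
    proof -
      have "exp (- (real k * t)) = exp (- t) ^ k"
        by (simp add: exp_of_nat_mult[symmetric])
      then show ?thesis
        by (cases "k = 0") (simp_all add: g_def power2_eq_square)
    qed
    have "summable (\<lambda>k. t * (1 / real k * ((exp (- t) ^ k + (exp (- t) ^ k) ^ 4) / (1 - (exp (- t) ^ k) ^ 5))))"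
    proof (rule summable_comparison_test)
      show "summable (\<lambda>k. 1 / (real k)\<^sup>2 * 2)"
        using inverse_power_summable[of 2, where 'a = real]
        by (intro summable_mult2) (simp add: inverse_eq_divide)
      have "norm (1 / (real k)\<^sup>2 * g (real k * t)) \<le> 1 / (real k)\<^sup>2 * 2" for k
        using gb[of "real k * t"] elim by (cases "k = 0") (simp_all add: abs_mult divide_right_mono)
      then show "\<exists>N. \<forall>k\<ge>N. norm (t * (1 / real k * ((exp (- t) ^ k + (exp (- t) ^ k) ^ 4) / (1 - (exp (- t) ^ k) ^ 5)))) \<le> 1 / (real k)\<^sup>2 * 2"
        unfolding e by blast
    qed
    then have "summable (\<lambda>k. 1 / real k * ((exp (- t) ^ k + (exp (- t) ^ k) ^ 4) / (1 - (exp (- t) ^ k) ^ 5)))"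
      using elim by (subst (asm) summable_cmult_iff) auto
    then show ?case
      unfolding e ln_rr_gf[OF q] by (rule suminf_mult)
  qed
  ultimately show ?thesis by (rule Lim_transform_eventually)
qed

text \<open>In the series for \<open>G\<close> at \<open>exp (-t)\<close>, the terms beyond \<open>N\<close> and those below \<open>(1 - \<delta>) A / t^2\<close>
  are compared with the series at \<open>(1 - \<eta>) t\<close> and \<open>(1 + \<eta>) t\<close>; each makes up at most a quarter of
  the total. Monotonicity bounds the remaining terms by \<open>a N\<close>.\<close>

lemma monotone_coeff_lower_bound:
  fixes a :: "nat \<Rightarrow> real" and G :: "real \<Rightarrow> real"
  assumes mono: "incseq a" and nonneg: "\<And>n. 0 \<le> a n"
    and sums: "\<And>q. 0 < q \<Longrightarrow> q < 1 \<Longrightarrow> (\<lambda>n. a n * q ^ n) sums G q"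
    and pos: "\<And>q. 0 < q \<Longrightarrow> q < 1 \<Longrightarrow> 0 < G q"
    and lim: "((\<lambda>t. t * ln (G (exp (- t)))) \<longlongrightarrow> A) (at_right 0)"
    and A: "0 < A" and \<delta>: "0 < \<delta>" "\<delta> \<le> 1"
  shows "\<forall>\<^sub>F t in at_right 0. \<forall>N. real N * t\<^sup>2 = (1 + \<delta>) * A \<longrightarrow>
           exp (real N * t) * G (exp (- t)) \<le> a N * exp (3 * \<delta> * A / t)"
proof -
  \<comment> \<open>Comparing at \<open>(1 - \<eta>) t\<close> or \<open>(1 + \<eta>) t\<close>
    gains \<open>\<delta> * \<eta> * A\<close> in the exponent and loses terms of order
    \<open>A * \<eta>^2\<close>. With this \<eta> the gain is \<open>4 * A * \<eta>^2\<close>, and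
    \<kappa> is small enough to keep a margin of \<open>A * \<eta>^2\<close>.\<close>
  define \<eta> where "\<eta> = \<delta> / 4"
  define \<kappa> where "\<kappa> = A * \<eta>\<^sup>2 / 4"
  have \<eta>: "0 < \<eta>" "\<eta> \<le> 1 / 4" and \<kappa>: "0 < \<kappa>" using \<delta> A by (auto simp: \<eta>_def \<kappa>_def)
  have close: "\<forall>\<^sub>F t in at_right 0. \<bar>c * t * ln (G (exp (- (c * t)))) - A\<bar> < \<kappa>" if "0 < c" for c
  proof -
    have "filterlim (\<lambda>t. c * t) (at_right 0) (at_right 0)"
      using that by real_asymp
    from filterlim_compose[OF lim this] have "((\<lambda>t. c * t * ln (G (exp (- (c * t))))) \<longlongrightarrow> A) (at_right 0)" .
    from tendstoD[OF this \<kappa>] show ?thesis by (simp add: dist_real_def)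
  qed
  have exponent1: "- (1 + \<delta>) * \<eta> * A + (A + \<kappa>) / (1 - \<eta>) \<le> A - \<kappa> - A * \<eta>\<^sup>2"
  proof -
    have "1 / (1 - \<eta>) \<le> 1 + \<eta> + 2 * \<eta>\<^sup>2"
    proof -
      have "1 \<le> (1 + \<eta> + 2 * \<eta>\<^sup>2) * (1 - \<eta>)"
      proof -
        have "(1 + \<eta> + 2 * \<eta>\<^sup>2) * (1 - \<eta>) = 1 + \<eta>\<^sup>2 * (1 - 2 * \<eta>)"
          by (simp add: algebra_simps power2_eq_square)
        moreover have "0 \<le> \<eta>\<^sup>2 * (1 - 2 * \<eta>)" using \<eta> by (intro mult_nonneg_nonneg) auto
        ultimately show ?thesis by simp
      qed
      then show ?thesis using \<eta> by (simp add: divide_le_eq)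
    qed
    then have "(A + \<kappa>) * (1 / (1 - \<eta>)) \<le> (A + \<kappa>) * (1 + \<eta> + 2 * \<eta>\<^sup>2)"
      using A \<kappa> by (intro mult_left_mono) auto
    also have "\<dots> \<le> A * (1 + \<eta> + 2 * \<eta>\<^sup>2) + \<kappa> * 2"
    proof -
      have "\<eta>\<^sup>2 \<le> 1 / 4 * (1 / 4)" unfolding power2_eq_square using \<eta> by (intro mult_mono) auto
      then have "\<kappa> * (1 + \<eta> + 2 * \<eta>\<^sup>2) \<le> \<kappa> * 2"
        using \<eta> \<kappa> by (intro mult_left_mono) auto
      then show ?thesis by (simp add: algebra_simps)
    qed
    finally have "(A + \<kappa>) / (1 - \<eta>) \<le> A * (1 + \<eta> + 2 * \<eta>\<^sup>2) + \<kappa> * 2" by simp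
    moreover have "0 \<le> A * \<eta>\<^sup>2" using A by simp
    moreover have "- (1 + \<delta>) * \<eta> * A = - (A * \<eta>) - 4 * (A * \<eta>\<^sup>2)"
      by (simp add: \<eta>_def field_simps power2_eq_square)
    moreover have "A * (1 + \<eta> + 2 * \<eta>\<^sup>2) = A + A * \<eta> + 2 * (A * \<eta>\<^sup>2)"
      by (simp add: algebra_simps)
    moreover have "\<kappa> = A * \<eta>\<^sup>2 / 4" by (fact \<kappa>_def)
    ultimately show ?thesis by linarith
  qed
  have exponent2: "(1 - \<delta>) * \<eta> * A + (A + \<kappa>) / (1 + \<eta>) \<le> A - \<kappa> - A * \<eta>\<^sup>2"
  proof -
    have "1 / (1 + \<eta>) \<le> 1 - \<eta> + \<eta>\<^sup>2"
    proof -
      have "(1 - \<eta> + \<eta>\<^sup>2) * (1 + \<eta>) = 1 + \<eta>\<^sup>2 * \<eta>"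
        by (simp add: algebra_simps power2_eq_square)
      moreover have "0 \<le> \<eta>\<^sup>2 * \<eta>" using \<eta> by simp
      ultimately show ?thesis using \<eta> by (simp add: divide_le_eq)
    qed
    then have "A * (1 / (1 + \<eta>)) \<le> A * (1 - \<eta> + \<eta>\<^sup>2)"
      using A by (intro mult_left_mono) auto
    moreover have "\<kappa> * (1 / (1 + \<eta>)) \<le> \<kappa> * 1"
      using \<eta> \<kappa> by (intro mult_left_mono) auto
    ultimately have "(A + \<kappa>) / (1 + \<eta>) \<le> A * (1 - \<eta> + \<eta>\<^sup>2) + \<kappa>"
      by (simp add: add_divide_distrib)
    moreover have "0 \<le> A * \<eta>\<^sup>2" using A by simp
    moreover have "(1 - \<delta>) * \<eta> * A = A * \<eta> - 4 * (A * \<eta>\<^sup>2)"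
      by (simp add: \<eta>_def field_simps power2_eq_square)
    moreover have "A * (1 - \<eta> + \<eta>\<^sup>2) = A - A * \<eta> + A * \<eta>\<^sup>2"
      by (simp add: algebra_simps)
    moreover have "\<kappa> = A * \<eta>\<^sup>2 / 4" by (fact \<kappa>_def)
    ultimately show ?thesis by linarith
  qed
  have c1: "0 < 1 - \<eta>" and c2: "0 < 1 + \<eta>" and A\<eta>: "0 < A * \<eta>\<^sup>2" and \<delta>A: "0 < \<delta> * A"
    using \<eta> A \<delta> by auto
  have small: "\<forall>\<^sub>F t in at_right 0. exp (- (A * \<eta>\<^sup>2 / t)) \<le> 1 / 4"
  proof -
    have "\<forall>\<^sub>F t in at_right 0. exp (- (K / t)) \<le> 1 / 4" if "0 < K" for K :: real
      using that by real_asymp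
    from this[OF A\<eta>] show ?thesis .
  qed
  \<comment> \<open>The factor 2 and the \<open>N + 1\<close> middle terms cost one
    \<open>\<delta> * A / t\<close>. With \<open>(1 + \<delta>) - (1 - \<delta>)\<close> from the
    width of the middle range this makes the final \<open>3 * \<delta>\<close>.\<close>
  have poly: "\<forall>\<^sub>F t in at_right 0. 2 * ((1 + \<delta>) * A / t\<^sup>2 + 1) \<le> exp (\<delta> * A / t)"
  proof -
    have "\<forall>\<^sub>F t in at_right 0. 2 * (L / t\<^sup>2 + 1) \<le> exp (K / t)" if "0 < K" "0 < L" for K L :: real
      using that by real_asymp
    from this[OF \<delta>A, of "(1 + \<delta>) * A"] \<delta> A show ?thesis by simp
  qed
  show ?thesis
    using eventually_at_right_less[of "0::real"] close[OF zero_less_one] close[OF c1] close[OF c2] small poly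
  proof eventually_elim
    case (elim t)
    note t = elim(1)
    define q where "q c = exp (- (c * t))" for c
    have q: "0 < q c" "q c < 1" if "0 < c" for c using that t by (auto simp: q_def)
    have upper: "G (q c) \<le> exp ((A + \<kappa>) / c / t)" if "\<bar>c * t * ln (G (exp (- (c * t)))) - A\<bar> < \<kappa>" "0 < c" for c
    proof -
      have "c * t * ln (G (q c)) \<le> A + \<kappa>" using that(1) unfolding q_def by linarith
      then have "ln (G (q c)) \<le> (A + \<kappa>) / c / t"
        using t that(2) by (simp add: field_simps)
      then show ?thesis using pos[OF q[OF that(2)]] by (metis exp_le_cancel_iff exp_ln)
    qed
    have lower: "exp ((A - \<kappa>) / t) \<le> G (q 1)"
    proof -
      have "A - \<kappa> \<le> t * ln (G (q 1))" using elim(2) unfolding q_def by simp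
      then have "(A - \<kappa>) / t \<le> ln (G (q 1))" using t by (simp add: field_simps)
      then show ?thesis using pos[OF q[OF zero_less_one]] by (simp add: ln_ge_iff)
    qed
    show ?case
    proof (intro allI impI)
      fix N assume N: "real N * t\<^sup>2 = (1 + \<delta>) * A"
      have Nt: "real N * t = (1 + \<delta>) * A / t"
        using N t by (simp add: field_simps power2_eq_square)
      \<comment> \<open>\<open>e1\<close> and \<open>e2\<close> are the ratios of the powers at
        \<open>t\<close> to those at \<open>(1 - \<eta>) t\<close> and
        \<open>(1 + \<eta>) t\<close>, taken at the upper and lower end of the middle range, where
        they are worst. \<open>B\<close> bounds the powers inside it.\<close>
      define e1 where "e1 = exp (- (1 + \<delta>) * \<eta> * A / t)"
      define e2 where "e2 = exp ((1 - \<delta>) * \<eta> * A / t)"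
      define B where "B = exp (- ((1 - \<delta>) * A / t))"
      have term_le: "a m * q 1 ^ m \<le> e1 * (a m * q (1 - \<eta>) ^ m) + e2 * (a m * q (1 + \<eta>) ^ m)
          + (if m \<in> {..N} then a N * B else 0)" for m
      proof -
        have qpoch: "q c ^ m = exp (- (c * t * real m))" for c
          unfolding q_def by (simp add: mult_ac flip: exp_of_nat_mult)
        have nn: "0 \<le> e1 * (a m * q (1 - \<eta>) ^ m)" "0 \<le> e2 * (a m * q (1 + \<eta>) ^ m)" "0 \<le> a N * B"
          using nonneg by (auto simp: e1_def e2_def B_def q_def)
        consider "N < m" | "m \<le> N" "real m * t \<le> (1 - \<delta>) * A / t" | "m \<le> N" "(1 - \<delta>) * A / t \<le> real m * t"
          by linarith
        then show ?thesis
        proof cases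
          case 1
          have 0: "\<eta> * (real N * t) \<le> \<eta> * (real m * t)"
            using 1 t \<eta> by (intro mult_left_mono mult_right_mono) auto
          have "- (1 * t * real m) \<le> - (1 + \<delta>) * \<eta> * A / t + - ((1 - \<eta>) * t * real m)"
          proof -
            have "- (1 + \<delta>) * \<eta> * A / t = - (\<eta> * ((1 + \<delta>) * A / t))"
              using t by (simp add: field_simps)
            moreover have "1 * t * real m = \<eta> * (real m * t) + (1 - \<eta>) * t * real m"
              by (simp add: algebra_simps)
            ultimately show ?thesis using 0 unfolding Nt by linarith
          qed
          then have "q 1 ^ m \<le> e1 * q (1 - \<eta>) ^ m"
            unfolding qpoch e1_def exp_add[symmetric] by simp
          from mult_left_mono[OF this nonneg[of m]] nn show ?thesis by (simp add: mult_ac)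
        next
          case 2
          have 0: "\<eta> * (real m * t) \<le> \<eta> * ((1 - \<delta>) * A / t)"
            using 2 \<eta> by (intro mult_left_mono) auto
          have "- (1 * t * real m) \<le> (1 - \<delta>) * \<eta> * A / t + - ((1 + \<eta>) * t * real m)"
          proof -
            have "(1 - \<delta>) * \<eta> * A / t = \<eta> * ((1 - \<delta>) * A / t)"
              using t by (simp add: field_simps)
            moreover have "(1 + \<eta>) * t * real m = \<eta> * (real m * t) + 1 * t * real m"
              by (simp add: algebra_simps)
            ultimately show ?thesis using 0 by linarith
          qed
          then have "q 1 ^ m \<le> e2 * q (1 + \<eta>) ^ m"
            unfolding qpoch e2_def exp_add[symmetric] by simp
          from mult_left_mono[OF this nonneg[of m]] nn show ?thesis by (simp add: mult_ac)
        next
          case 3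
          have "q 1 ^ m \<le> B"
            unfolding qpoch B_def using 3 by (simp add: mult_ac)
          moreover have "a m \<le> a N" using mono 3 by (simp add: incseq_def)
          ultimately have "a m * q 1 ^ m \<le> a N * B"
            using nonneg q[OF zero_less_one] by (intro mult_mono) auto
          with nn 3 show ?thesis by simp
        qed
      qed
      have "G (q 1) \<le> e1 * G (q (1 - \<eta>)) + e2 * G (q (1 + \<eta>)) + (\<Sum>m\<le>N. a N * B)"
      proof (rule sums_le[OF _ sums[OF q[OF zero_less_one]]])
        show "(\<lambda>m. e1 * (a m * q (1 - \<eta>) ^ m) + e2 * (a m * q (1 + \<eta>) ^ m) + (if m \<in> {..N} then a N * B else 0))
          sums (e1 * G (q (1 - \<eta>)) + e2 * G (q (1 + \<eta>)) + (\<Sum>m\<le>N. a N * B))"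
          by (intro sums_add sums_mult sums q c1 c2 sums_If_finite_set) auto
      qed (rule term_le)
      moreover have "e1 * G (q (1 - \<eta>)) \<le> G (q 1) * (1 / 4)"
      proof -
        have "e1 * G (q (1 - \<eta>)) \<le> e1 * exp ((A + \<kappa>) / (1 - \<eta>) / t)"
          by (intro mult_left_mono upper elim c1) (simp add: e1_def)
        also have "\<dots> = exp ((- (1 + \<delta>) * \<eta> * A + (A + \<kappa>) / (1 - \<eta>)) / t)"
          by (simp add: e1_def add_divide_distrib flip: exp_add)
        also have "\<dots> \<le> exp ((A - \<kappa> - A * \<eta>\<^sup>2) / t)"
          using exponent1 t by (simp only: exp_le_cancel_iff divide_right_mono less_imp_le)
        also have "\<dots> = exp ((A - \<kappa>) / t) * exp (- (A * \<eta>\<^sup>2 / t))"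
          by (simp add: diff_divide_distrib flip: exp_add)
        also have "\<dots> \<le> G (q 1) * (1 / 4)"
          using pos[OF q[OF zero_less_one]] by (intro mult_mono lower elim) auto
        finally show ?thesis .
      qed
      moreover have "e2 * G (q (1 + \<eta>)) \<le> G (q 1) * (1 / 4)"
      proof -
        have "e2 * G (q (1 + \<eta>)) \<le> e2 * exp ((A + \<kappa>) / (1 + \<eta>) / t)"
          by (intro mult_left_mono upper elim c2) (simp add: e2_def)
        also have "\<dots> = exp (((1 - \<delta>) * \<eta> * A + (A + \<kappa>) / (1 + \<eta>)) / t)"
          by (simp add: e2_def add_divide_distrib flip: exp_add)
        also have "\<dots> \<le> exp ((A - \<kappa> - A * \<eta>\<^sup>2) / t)"
          using exponent2 t by (simp only: exp_le_cancel_iff divide_right_mono less_imp_le)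
        also have "\<dots> = exp ((A - \<kappa>) / t) * exp (- (A * \<eta>\<^sup>2 / t))"
          by (simp add: diff_divide_distrib flip: exp_add)
        also have "\<dots> \<le> G (q 1) * (1 / 4)"
          using pos[OF q[OF zero_less_one]] by (intro mult_mono lower elim) auto
        finally show ?thesis .
      qed
      ultimately have G: "G (q 1) \<le> 2 * (real N + 1) * (a N * B)"
        by (simp add: algebra_simps)
      have "real N = (1 + \<delta>) * A / t\<^sup>2" using N t by (simp add: field_simps)
      with elim(6) have N1: "2 * (real N + 1) \<le> exp (\<delta> * A / t)" by simp
      have "exp (real N * t) * G (exp (- t)) \<le> exp (real N * t) * (2 * (real N + 1) * (a N * B))"
        using G by (intro mult_left_mono) (auto simp: q_def)
      also have "\<dots> \<le> exp (real N * t) * (exp (\<delta> * A / t) * (a N * B))"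
        using N1 nonneg by (intro mult_left_mono mult_right_mono) (auto simp: B_def)
      also have "\<dots> = a N * exp (real N * t + \<delta> * A / t + - ((1 - \<delta>) * A / t))"
        by (simp only: exp_add B_def mult_ac)
      also have "real N * t + \<delta> * A / t + - ((1 - \<delta>) * A / t) = 3 * \<delta> * A / t"
        unfolding Nt using t by (simp add: field_simps)
      finally show "exp (real N * t) * G (exp (- t)) \<le> a N * exp (3 * \<delta> * A / t)" .
    qed
  qed
qed

section \<open>Concentration\<close>

definition gap_term :: "real \<Rightarrow> nat \<Rightarrow> real" where
  "gap_term q m = q ^ (m * m) / qpoch q m"

text \<open>With \<open>x = q ^ Suc m\<close> the ratio is \<open>x^2 / (q (1 - x))\<close>. The
  extra \<open>1 / q\<close> helps the growth estimate and has to be absorbed in the decay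
  estimate.\<close>

lemma gap_term_Suc: "gap_term q (Suc m) = gap_term q m * (q ^ (2 * m + 1) / (1 - q ^ Suc m))"
proof -
  have "Suc m * Suc m = m * m + (2 * m + 1)" by simp
  then show ?thesis unfolding gap_term_def qpoch_Suc by (simp only: power_add times_divide_times_eq)
qed

lemma gap_term_nonneg: "0 < q \<Longrightarrow> q < 1 \<Longrightarrow> 0 \<le> gap_term q m"
  using qpoch_pos[of q m] by (simp add: gap_term_def)

lemma gap_term_le_rr_gf:
  assumes q: "0 < q" "q < 1"
  shows "gap_term q m \<le> rr_gf q"
proof -
  have "sum (gap_term q) {m} \<le> rr_gf q"
    unfolding rr_gf_def gap_term_def[symmetric]
  proof (rule sum_le_suminf)
    show "summable (gap_term q)" using summable_gap_terms[OF q] unfolding gap_term_def .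
  qed (auto simp: gap_term_nonneg q)
  then show ?thesis by simp
qed

text \<open>A union bound over the number of parts, each coefficient times \<open>q ^ n\<close>
  being at most its whole series.\<close>

lemma gap_card_le:
  assumes q: "0 < q" "q < 1" and I: "finite I" and c: "\<And>m. m \<in> I \<Longrightarrow> gap_term q m \<le> c"
  shows "real (card {l. is_partition n l \<and> gap_two l \<and> length l \<in> I}) * q ^ n \<le> real (card I) * c"
proof -
  have "{l. is_partition n l \<and> gap_two l \<and> length l \<in> I} = (\<Union>m\<in>I. gap_partitions m n)"
    by (auto simp: gap_partitions_def)
  then have "card {l. is_partition n l \<and> gap_two l \<and> length l \<in> I} \<le> (\<Sum>m\<in>I. card (gap_partitions m n))"
    using card_UN_le[OF I] by simp
  then have "real (card {l. is_partition n l \<and> gap_two l \<and> length l \<in> I}) * q ^ n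
      \<le> real (\<Sum>m\<in>I. card (gap_partitions m n)) * q ^ n"
    using q by (intro mult_right_mono of_nat_mono) auto
  also have "\<dots> = (\<Sum>m\<in>I. real (card (gap_partitions m n)) * q ^ n)"
    by (simp add: sum_distrib_right)
  also have "\<dots> \<le> (\<Sum>m\<in>I. c)"
  proof (intro sum_mono order_trans[OF _ c])
    fix m
    show "real (card (gap_partitions m n)) * q ^ n \<le> gap_term q m"
      using gap_partitions_gf[OF q, of m] sum_le_suminf[of "\<lambda>n. real (card (gap_partitions m n)) * q ^ n" "{n}"] q
      by (auto simp: sums_iff gap_term_def)
  qed
  finally show ?thesis by simp
qed

text \<open>The threshold \<open>x^2 = 1 - x\<close> is at 0.618..., and 0.62 and 0.61 lie on its
  two sides. Splitting into 16 and 4 equal factors makes the elementary bounds for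
  \<open>exp\<close> sharp enough.\<close>

lemma exp_bounds: "62 / 100 \<le> exp (- (46 / 100) :: real)" "exp (- (1 / 2)) \<le> (61 / 100 :: real)"
proof -
  have "(62 / 100 :: real) \<le> (1 + - (46 / 1600)) ^ 16" by (simp add: power_divide)
  also have "\<dots> \<le> exp (- (46 / 1600)) ^ 16"
    by (intro power_mono exp_ge_add_one_self) simp
  also have "\<dots> = exp (- (46 / 100))" by (simp flip: exp_of_nat_mult)
  finally show "62 / 100 \<le> exp (- (46 / 100) :: real)" .
  have "(100 / 61 :: real) \<le> (1 + 1 / 8 + (1 / 8)\<^sup>2 / 2) ^ 4" by (simp add: power2_eq_square power_divide)
  also have "\<dots> \<le> exp (1 / 8) ^ 4"
    by (intro power_mono exp_lower_Taylor_quadratic) simp_all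
  also have "\<dots> = exp (1 / 2)" by (simp flip: exp_of_nat_mult)
  finally show "exp (- (1 / 2)) \<le> (61 / 100 :: real)" by (simp add: exp_minus field_simps)
qed

text \<open>Up to \<open>M\<close>, about \<open>0.46 / t\<close>, the terms still grow by the
  factor 1.01, since \<open>0.62^2\<close> exceeds \<open>1.01 * 0.38\<close>. The roughly
  \<open>0.01 / t\<close> steps from \<open>0.45 / t\<close> to \<open>M\<close> gain
  \<open>r / (100 t)\<close> in the exponent; \<open>c\<close> keeps half of it and the rest pays
  for the number of terms.\<close>

lemma gap_few_parts:
  "\<exists>c>0. \<forall>\<^sub>F t in at_right 0. \<forall>n.
     real (card {l. is_partition n l \<and> gap_two l \<and> real (length l) \<le> 45 / 100 / t}) * exp (- t) ^ n
     \<le> rr_gf (exp (- t)) * exp (- (c / t))"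
proof -
  define r where "r = ln (101 / 100 :: real)"
  have r: "0 < r" "exp r = 101 / 100" by (auto simp: r_def)
  define c where "c = r / 200"
  have ev: "\<forall>\<^sub>F t in at_right 0. (45 / 100 / t + 1) * exp (- (r * (1 / 100 / t - 1))) \<le> exp (- (c / t))"
    unfolding c_def using r(1) by real_asymp
  have "\<forall>\<^sub>F t in at_right 0. \<forall>n.
     real (card {l. is_partition n l \<and> gap_two l \<and> real (length l) \<le> 45 / 100 / t}) * exp (- t) ^ n
     \<le> rr_gf (exp (- t)) * exp (- (c / t))"
    using eventually_at_right_less[of "0::real"] ev
  proof eventually_elim
    case (elim t)
    define q where "q = exp (- t)"
    have q: "0 < q" "q < 1" using elim by (auto simp: q_def)
    define b where "b = nat \<lfloor>45 / 100 / t\<rfloor>"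
    define M where "M = nat \<lfloor>46 / 100 / t\<rfloor>"
    have b: "real m \<le> 45 / 100 / t \<longleftrightarrow> m \<le> b" for m
      using elim unfolding b_def by (simp add: le_nat_floor le_floor_iff nat_le_iff le_nat_iff)
    have M: "real m \<le> 46 / 100 / t \<longleftrightarrow> m \<le> M" for m
      using elim unfolding M_def by (simp add: le_floor_iff le_nat_iff)
    have M': "46 / 100 / t < real M + 1" using M[of "Suc M"] by simp
    have b': "real b \<le> 45 / 100 / t" using b by simp
    have bM: "b \<le> M" using b' elim by (intro M[THEN iffD1]) (simp add: divide_right_mono order_trans)
    have step: "gap_term q m * exp r \<le> gap_term q (Suc m)" if "m < M" for m
    proof -
      define x where "x = q ^ Suc m"
      have "real (Suc m) \<le> 46 / 100 / t" using M[of "Suc m"] that by simp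
      then have "real (Suc m) * t \<le> 46 / 100" using elim by (simp add: field_simps)
      moreover have xe: "x = exp (- (real (Suc m) * t))"
        unfolding x_def q_def by (simp only: flip: exp_of_nat_mult) simp
      ultimately have "exp (- (46 / 100)) \<le> x" by simp
      then have x: "62 / 100 \<le> x" using exp_bounds(1) by linarith
      have x1: "0 < 1 - x" unfolding x_def by (rule one_minus_power_pos[OF q]) simp
      have "(62 / 100) * (62 / 100) \<le> x * x" using x by (intro mult_mono) auto
      then have "101 / 100 * (1 - x) \<le> x * x" using x by simp
      moreover have "x * x \<le> q ^ (2 * m + 1)"
        unfolding x_def power_add[symmetric] using q by (intro power_decreasing) auto
      ultimately have "exp r \<le> q ^ (2 * m + 1) / (1 - q ^ Suc m)"
        using x1 unfolding x_def[symmetric] r by (simp add: le_divide_eq)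
      then show ?thesis
        unfolding gap_term_Suc by (intro mult_left_mono gap_term_nonneg q)
    qed
    have growth: "gap_term q (M - d) * exp r ^ d \<le> rr_gf q" if "d \<le> M" for d
      using that
    proof (induction d)
      case (Suc d)
      have "gap_term q (M - Suc d) * exp r \<le> gap_term q (Suc (M - Suc d))"
        using Suc.prems by (intro step) simp
      also have "Suc (M - Suc d) = M - d" using Suc.prems by simp
      finally have "gap_term q (M - Suc d) * exp r * exp r ^ d \<le> gap_term q (M - d) * exp r ^ d"
        by (intro mult_right_mono) auto
      also have "gap_term q (M - d) * exp r ^ d \<le> rr_gf q" using Suc by simp
      finally show ?case by (simp only: power_Suc mult.assoc)
    qed (simp add: gap_term_le_rr_gf[OF q])
    have bound: "gap_term q m \<le> rr_gf q * exp (- (r * (1 / 100 / t - 1)))" if "m \<in> {..b}" for m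
    proof -
      have mM: "m \<le> M" using that bM by simp
      then have "gap_term q m * exp r ^ (M - m) \<le> rr_gf q"
        using growth[of "M - m"] by simp
      moreover have "exp (r * (1 / 100 / t - 1)) \<le> exp r ^ (M - m)"
      proof -
        have "real m \<le> 45 / 100 / t" using that b by simp
        with M' have "1 / 100 / t - 1 \<le> real (M - m)" using mM by (simp add: of_nat_diff)
        then have "r * (1 / 100 / t - 1) \<le> r * real (M - m)" using r by (intro mult_left_mono) auto
        then show ?thesis by (simp add: mult.commute flip: exp_of_nat_mult)
      qed
      ultimately have "gap_term q m * exp (r * (1 / 100 / t - 1)) \<le> rr_gf q"
        using gap_term_nonneg[OF q, of m] by (meson mult_left_mono order_trans)
      then show ?thesis by (simp only: exp_minus divide_inverse[symmetric]) (simp add: pos_le_divide_eq)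
    qed
    show ?case
    proof
      fix n
      have "real (card {l. is_partition n l \<and> gap_two l \<and> real (length l) \<le> 45 / 100 / t}) * q ^ n
        \<le> real (card {..b}) * (rr_gf q * exp (- (r * (1 / 100 / t - 1))))"
        using gap_card_le[OF q finite_atMost[of b] bound, of n] by (simp only: b atMost_iff)
      also have "\<dots> = rr_gf q * ((real b + 1) * exp (- (r * (1 / 100 / t - 1))))"
        by (simp add: algebra_simps)
      also have "\<dots> \<le> rr_gf q * ((45 / 100 / t + 1) * exp (- (r * (1 / 100 / t - 1))))"
        using b' rr_gf_pos[OF q] by (intro mult_left_mono mult_right_mono) auto
      also have "\<dots> \<le> rr_gf q * exp (- (c / t))"
        using elim rr_gf_pos[OF q] by (intro mult_left_mono) auto
      finally show "real (card {l. is_partition n l \<and> gap_two l \<and> real (length l) \<le> 45 / 100 / t}) * exp (- t) ^ n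
        \<le> rr_gf (exp (- t)) * exp (- (c / t))" by (simp add: q_def)
    qed
  qed
  then show ?thesis using r by (intro exI[of _ c]) (simp add: c_def)
qed

text \<open>From \<open>0.5 / t\<close> on the terms shrink by the factor 0.99, and
  \<open>0.52 / t\<close> lies about \<open>0.02 / t\<close> steps further. The factor
  \<open>n + 1\<close> counts the possible numbers of parts, which have no bound in terms of
  \<open>t\<close> alone.\<close>

lemma gap_many_parts:
  "\<exists>c>0. \<forall>\<^sub>F t in at_right 0. \<forall>n.
     real (card {l. is_partition n l \<and> gap_two l \<and> 52 / 100 / t \<le> real (length l)}) * exp (- t) ^ n
     \<le> (real n + 1) * (rr_gf (exp (- t)) * exp (- (c / t)))"
proof -
  define r where "r = - ln (99 / 100 :: real)"
  have r: "0 < r" "exp (- r) = 99 / 100" by (auto simp: r_def)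
  define c where "c = r / 100"
  have ev: "\<forall>\<^sub>F t in at_right 0. exp (- (r * (2 / 100 / t - 1))) \<le> exp (- (c / t))"
    unfolding c_def using r(1) by real_asymp
  \<comment> \<open>This absorbs the factor \<open>1 / q\<close> in the ratio:
    \<open>0.61^2 / 0.97\<close> is still below \<open>0.99 * 0.39\<close>.\<close>
  have ev2: "\<forall>\<^sub>F t in at_right 0. 97 / 100 \<le> exp (- t :: real)"
    by real_asymp
  have "\<forall>\<^sub>F t in at_right 0. \<forall>n.
     real (card {l. is_partition n l \<and> gap_two l \<and> 52 / 100 / t \<le> real (length l)}) * exp (- t) ^ n
     \<le> (real n + 1) * (rr_gf (exp (- t)) * exp (- (c / t)))"
    using eventually_at_right_less[of "0::real"] ev ev2
  proof eventually_elim
    case (elim t)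
    define q where "q = exp (- t)"
    have q: "0 < q" "q < 1" using elim by (auto simp: q_def)
    define M where "M = nat \<lceil>1 / 2 / t\<rceil>"
    have M: "1 / 2 / t \<le> real M" unfolding M_def by (rule real_nat_ceiling_ge)
    have M': "real M < 1 / 2 / t + 1"
      unfolding M_def using elim by (simp add: of_nat_nat) linarith
    have step: "gap_term q (Suc m) \<le> gap_term q m * exp (- r)" if "M \<le> m" for m
    proof -
      define x where "x = q ^ Suc m"
      have "1 / 2 / t \<le> real (Suc m)" using M that by linarith
      then have "1 / 2 \<le> real (Suc m) * t" using elim by (simp add: field_simps)
      moreover have xe: "x = exp (- (real (Suc m) * t))"
        unfolding x_def q_def by (simp only: flip: exp_of_nat_mult) simp
      ultimately have "x \<le> exp (- (1 / 2))" by simp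
      then have x: "x \<le> 61 / 100" using exp_bounds(2) by linarith
      have x0: "0 < x" using q by (simp add: x_def)
      have "q ^ (2 * m + 1) * q = x * x"
        unfolding x_def power_add[symmetric] by (simp add: mult_2 flip: power_add)
      moreover have "q ^ (2 * m + 1) * (97 / 100) \<le> q ^ (2 * m + 1) * q"
        using q elim(3) by (intro mult_left_mono) (auto simp: q_def)
      moreover have "x * x \<le> (61 / 100) * (61 / 100)" using x x0 by (intro mult_mono) auto
      ultimately have "q ^ (2 * m + 1) * (97 / 100) \<le> 61 / 100 * (61 / 100)" by simp
      then have "q ^ (2 * m + 1) \<le> 99 / 100 * (1 - 61 / 100)" by simp
      also have "\<dots> \<le> 99 / 100 * (1 - x)" using x by simp
      finally have "q ^ (2 * m + 1) \<le> 99 / 100 * (1 - x)" .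
      then have "q ^ (2 * m + 1) / (1 - q ^ Suc m) \<le> exp (- r)"
        using x unfolding x_def[symmetric] r by (simp add: divide_le_eq)
      then show ?thesis
        unfolding gap_term_Suc by (intro mult_left_mono gap_term_nonneg q)
    qed
    have decay: "gap_term q (M + d) \<le> rr_gf q * exp (- r) ^ d" for d
    proof (induction d)
      case (Suc d)
      have "gap_term q (Suc (M + d)) \<le> gap_term q (M + d) * exp (- r)" by (rule step) simp
      also have "\<dots> \<le> rr_gf q * exp (- r) ^ d * exp (- r)"
        using Suc.IH by (intro mult_right_mono) auto
      finally show ?case by (simp add: mult_ac)
    qed (simp add: gap_term_le_rr_gf[OF q])
    have bound: "gap_term q m \<le> rr_gf q * exp (- (c / t))" if "52 / 100 / t \<le> real m" for m
    proof -
      have "1 / 2 / t < 52 / 100 / t" using elim(1) by (simp add: field_simps)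
      with M' have "real M < 52 / 100 / t + 1" by linarith
      then have Mm: "real M < real m + 1" using that by linarith
      then have mM: "M \<le> m" by linarith
      have "1 / 2 / t + 2 / 100 / t = 52 / 100 / t" by (simp add: add_divide_distrib[symmetric])
      then have "2 / 100 / t - 1 \<le> real (m - M)" using that M' mM by (simp add: of_nat_diff)
      then have "r * (2 / 100 / t - 1) \<le> r * real (m - M)" using r by (intro mult_left_mono) auto
      moreover have "exp (- r) ^ (m - M) = exp (- (r * real (m - M)))"
        by (simp add: mult.commute flip: exp_of_nat_mult)
      ultimately have "exp (- r) ^ (m - M) \<le> exp (- (c / t))"
        using elim(2) by (smt (verit) exp_le_cancel_iff)
      then have "rr_gf q * exp (- r) ^ (m - M) \<le> rr_gf q * exp (- (c / t))"
        using rr_gf_pos[OF q] by (intro mult_left_mono) auto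
      with decay[of "m - M"] mM show ?thesis by simp
    qed
    show ?case
    proof
      fix n
      define I where "I = {m. m \<le> n \<and> 52 / 100 / t \<le> real m}"
      have I: "finite I" "I \<subseteq> {..n}" by (auto simp: I_def)
      have "{l. is_partition n l \<and> gap_two l \<and> 52 / 100 / t \<le> real (length l)}
          = {l. is_partition n l \<and> gap_two l \<and> length l \<in> I}"
        using length_le_of_partition by (auto simp: I_def)
      then have "real (card {l. is_partition n l \<and> gap_two l \<and> 52 / 100 / t \<le> real (length l)}) * q ^ n
        \<le> real (card I) * (rr_gf q * exp (- (c / t)))"
        using gap_card_le[OF q I(1), of "rr_gf q * exp (- (c / t))" n] bound by (simp add: I_def)
      also have "\<dots> \<le> (real n + 1) * (rr_gf q * exp (- (c / t)))"
        using card_mono[OF _ I(2)] rr_gf_pos[OF q] by (intro mult_right_mono) auto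
      finally show "real (card {l. is_partition n l \<and> gap_two l \<and> 52 / 100 / t \<le> real (length l)}) * exp (- t) ^ n
     \<le> (real n + 1) * (rr_gf (exp (- t)) * exp (- (c / t)))" by (simp add: q_def)
    qed
  qed
  then show ?thesis using r by (intro exI[of _ c]) (simp add: c_def)
qed

text \<open>The mean \<open>0.4 / t\<close>, rounded up to \<open>0.405 / t\<close>, is below
  \<open>0.44 / t\<close>, so a weight slightly above 1 wins: \<open>ln y\<close> is at least
  0.0099, and \<open>0.44 * 0.0099\<close> exceeds \<open>0.01 * 0.405\<close>.\<close>

lemma mod5_many_distinct:
  "\<exists>c>0. \<forall>\<^sub>F t in at_right 0. \<forall>n.
     real (card {l. is_partition n l \<and> parts_1_4_mod_5 l \<and> 44 / 100 / t \<le> real (card (set l))}) * exp (- t) ^ n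
     \<le> rr_gf (exp (- t)) * exp (- (c / t))"
proof -
  define y where "y = (101 / 100 :: real)"
  define c where "c = 44 / 100 * ln y - 405 / 100000"
  have "1 / 100 - (1 / 100)\<^sup>2 \<le> ln (1 + 1 / 100 :: real)"
    by (rule ln_one_plus_pos_lower_bound) auto
  then have c: "0 < c" by (simp add: c_def y_def power2_eq_square)
  have "\<forall>\<^sub>F t in at_right 0. (exp (- t) + exp (- t) ^ 4) / (1 - exp (- t) ^ 5) \<le> 405 / 1000 / (t :: real)"
    by real_asymp
  then have "\<forall>\<^sub>F t in at_right 0. \<forall>n.
     real (card {l. is_partition n l \<and> parts_1_4_mod_5 l \<and> 44 / 100 / t \<le> real (card (set l))}) * exp (- t) ^ n
     \<le> rr_gf (exp (- t)) * exp (- (c / t))"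
    using eventually_at_right_less[of "0::real"]
  proof eventually_elim
    case (elim t)
    define q where "q = exp (- t)"
    have q: "0 < q" "q < 1" using elim by (auto simp: q_def)
    define b where "b = nat \<lceil>44 / 100 / t\<rceil>"
    have b: "44 / 100 / t \<le> real m \<longleftrightarrow> b \<le> m" for m
      unfolding b_def by (simp add: nat_le_iff ceiling_le_iff)
    have yb: "exp (44 / 100 * ln y / t) \<le> y ^ b"
    proof -
      have "44 / 100 / t * ln y \<le> real b * ln y"
        using b[of b] by (intro mult_right_mono) (auto simp: y_def)
      moreover have "y ^ b = exp (real b * ln y)" by (simp add: exp_of_nat_mult y_def)
      ultimately show ?thesis by (simp only: exp_le_cancel_iff times_divide_eq_left)
    qed
    show ?case
    proof
      fix n
      define C where "C = real (card {l. is_partition n l \<and> parts_1_4_mod_5 l \<and> b \<le> card (set l)})"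
      have "C * q ^ n * exp (44 / 100 * ln y / t) \<le> C * q ^ n * y ^ b"
        using yb q by (intro mult_left_mono) (auto simp: C_def)
      also have "\<dots> \<le> rr_gf q * exp ((y - 1) * ((q + q ^ 4) / (1 - q ^ 5)))"
        using many_distinct_parts_count[OF q, of y n b] by (simp add: C_def y_def mult_ac)
      also have "\<dots> \<le> rr_gf q * exp ((y - 1) * (405 / 1000 / t))"
        using elim(1) rr_gf_pos[OF q] by (intro mult_left_mono iffD2[OF exp_le_cancel_iff]) (auto simp: q_def y_def)
      finally have "C * q ^ n \<le> rr_gf q * exp ((y - 1) * (405 / 1000 / t)) / exp (44 / 100 * ln y / t)"
        by (simp add: le_divide_eq)
      also have "\<dots> = rr_gf q * exp (- (c / t))"
      proof -
        have "- (c / t) = (y - 1) * (405 / 1000 / t) - 44 / 100 * ln y / t"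
          using elim(2) by (simp add: c_def y_def field_simps)
        then show ?thesis by (simp only: exp_diff times_divide_eq_right)
      qed
      finally show "real (card {l. is_partition n l \<and> parts_1_4_mod_5 l \<and> 44 / 100 / t \<le> real (card (set l))}) * exp (- t) ^ n
        \<le> rr_gf (exp (- t)) * exp (- (c / t))" by (simp only: b C_def q_def)
    qed
  qed
  then show ?thesis using c by blast
qed

text \<open>\<open>Z\<close> is about \<open>(0.4 + 0.2 * y) / t = 0.598 / t\<close>, rounded down
  to \<open>0.59 / t\<close>. A weight slightly below 1 wins: \<open>ln y\<close> is at least -
  0.0102, and \<open>0.55 * 0.0102\<close> is less than \<open>0.01 * 0.59\<close>.\<close>

lemma mod5_few_hooks:
  "\<exists>c>0. \<forall>\<^sub>F t in at_right 0. \<forall>n.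
     real (card {l. is_partition n l \<and> parts_1_4_mod_5 l \<and> real (hook_lower l) \<le> 55 / 100 / t}) * exp (- t) ^ n
     \<le> rr_gf (exp (- t)) * exp (- (c / t))"
proof -
  define y where "y = (99 / 100 :: real)"
  define c where "c = 59 / 10000 + 55 / 100 * ln y"
  have "- (1 / 100) - 2 * (1 / 100)\<^sup>2 \<le> ln (1 - 1 / 100 :: real)"
    by (rule ln_one_minus_pos_lower_bound) auto
  then have c: "0 < c" by (simp add: c_def y_def power2_eq_square)
  define Z where "Z q = (q + q ^ 4) / (1 - q ^ 5) - q + y * ((q ^ 2 + q ^ 8) / (1 - q ^ 10))" for q
  have "\<forall>\<^sub>F t in at_right 0. 59 / 100 / t \<le> Z (exp (- t))"
    unfolding Z_def y_def by real_asymp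
  then have "\<forall>\<^sub>F t in at_right 0. \<forall>n.
     real (card {l. is_partition n l \<and> parts_1_4_mod_5 l \<and> real (hook_lower l) \<le> 55 / 100 / t}) * exp (- t) ^ n
     \<le> rr_gf (exp (- t)) * exp (- (c / t))"
    using eventually_at_right_less[of "0::real"]
  proof eventually_elim
    case (elim t)
    define q where "q = exp (- t)"
    have q: "0 < q" "q < 1" using elim by (auto simp: q_def)
    define b where "b = nat \<lfloor>55 / 100 / t\<rfloor>"
    have b: "real m \<le> 55 / 100 / t \<longleftrightarrow> m \<le> b" for m
      using elim unfolding b_def by (simp add: le_floor_iff le_nat_iff)
    have yb: "exp (55 / 100 * ln y / t) \<le> y ^ b"
    proof -
      have "55 / 100 / t * ln y \<le> real b * ln y"
        using b[of b] by (intro mult_right_mono_neg) (auto simp: y_def)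
      moreover have "y ^ b = exp (real b * ln y)" by (simp add: exp_of_nat_mult y_def)
      ultimately show ?thesis by (simp only: exp_le_cancel_iff times_divide_eq_left)
    qed
    show ?case
    proof
      fix n
      define C where "C = real (card {l. is_partition n l \<and> parts_1_4_mod_5 l \<and> hook_lower l \<le> b})"
      have "C * q ^ n * exp (55 / 100 * ln y / t) \<le> C * q ^ n * y ^ b"
        using yb q by (intro mult_left_mono) (auto simp: C_def)
      also have "\<dots> \<le> rr_gf q * exp (- (1 - y) * Z q)"
        using few_hooks_count[OF q, of y n b] by (simp add: C_def Z_def y_def mult_ac)
      also have "\<dots> \<le> rr_gf q * exp (- (1 - y) * (59 / 100 / t))"
      proof -
        have "- (1 - y) * Z q \<le> - (1 - y) * (59 / 100 / t)"
          using elim(1) by (intro mult_left_mono_neg) (simp_all add: q_def y_def)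
        then have "exp (- (1 - y) * Z q) \<le> exp (- (1 - y) * (59 / 100 / t))"
          by (simp only: exp_le_cancel_iff)
        then show ?thesis using rr_gf_pos[OF q] by (rule mult_left_mono[OF _ less_imp_le])
      qed
      finally have "C * q ^ n \<le> rr_gf q * exp (- (1 - y) * (59 / 100 / t)) / exp (55 / 100 * ln y / t)"
        by (simp add: le_divide_eq)
      also have "\<dots> = rr_gf q * exp (- (c / t))"
      proof -
        have "- (c / t) = - (1 - y) * (59 / 100 / t) - 55 / 100 * ln y / t"
          using elim(2) by (simp add: c_def y_def field_simps)
        then show ?thesis by (simp only: exp_diff times_divide_eq_right)
      qed
      finally show "real (card {l. is_partition n l \<and> parts_1_4_mod_5 l \<and> real (hook_lower l) \<le> 55 / 100 / t}) * exp (- t) ^ n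
        \<le> rr_gf (exp (- t)) * exp (- (c / t))" by (simp only: b C_def q_def)
    qed
  qed
  then show ?thesis using c by blast
qed

section \<open>Comparison of the hook counts\<close>

text \<open>Appending a part 1 is injective. This supplies the monotonicity on which the lower bound
  for the coefficients rests.\<close>

lemma mod5_count_Suc: "mod5_count n \<le> mod5_count (Suc n)"
  unfolding mod5_count_def
proof (rule card_inj_on_le[where f = "\<lambda>l. l @ [1]"])
  show "(\<lambda>l. l @ [1]) ` {l. is_partition n l \<and> parts_1_4_mod_5 l} \<subseteq> {l. is_partition (Suc n) l \<and> parts_1_4_mod_5 l}"
    by (auto simp: is_partition_def parts_1_4_mod_5_def sorted_wrt_append Suc_le_eq)
qed (auto simp: inj_on_def finite_partitions_with)

lemma mod5_count_pos: "0 < mod5_count n"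
proof (induction n)
  case 0
  have "[] \<in> {l. is_partition 0 l \<and> parts_1_4_mod_5 l}"
    by (simp add: is_partition_def parts_1_4_mod_5_def)
  then show ?case
    unfolding mod5_count_def using finite_partitions_with card_gt_0_iff by blast
next
  case (Suc n)
  then show ?case using mod5_count_Suc[of n] by simp
qed

lemma sum_ge_of_few_small:
  fixes f :: "'a \<Rightarrow> nat" and x :: real
  assumes "finite S" "0 \<le> x"
  shows "x * (real (card S) - real (card {l \<in> S. real (f l) \<le> x})) \<le> real (\<Sum>l\<in>S. f l)"
proof -
  have "x * (real (card S) - real (card {l \<in> S. real (f l) \<le> x})) = (\<Sum>l\<in>S. x - (if real (f l) \<le> x then x else 0))"
    using assms(1) by (simp add: sum_subtractf sum.If_cases Int_def algebra_simps)
  also have "\<dots> \<le> (\<Sum>l\<in>S. real (f l))"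
    using assms(2) by (intro sum_mono) auto
  finally show ?thesis by simp
qed

lemma sum_le_of_few_large:
  fixes f :: "'a \<Rightarrow> nat" and x Z :: real
  assumes "finite S" "0 \<le> x" "\<And>l. l \<in> S \<Longrightarrow> real (f l) \<le> Z"
  shows "real (\<Sum>l\<in>S. f l) \<le> x * real (card S) + Z * real (card {l \<in> S. x \<le> real (f l)})"
proof -
  have "real (\<Sum>l\<in>S. f l) \<le> (\<Sum>l\<in>S. x + (if x \<le> real (f l) then Z else 0))"
    unfolding of_nat_sum using assms(2,3) by (intro sum_mono) fastforce
  also have "\<dots> = x * real (card S) + Z * real (card {l \<in> S. x \<le> real (f l)})"
    using assms(1) by (simp add: sum.distrib sum.If_cases Int_def algebra_simps)
  finally show ?thesis .
qed

lemma r1_one_ge: "(\<Sum>l | is_partition n l \<and> gap_two l. length l) \<le> r1 1 n"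
  unfolding r1_def by (intro sum_mono) (use gap_two_num_hooks_one in auto)

lemma r1_two_le: "r1 2 n \<le> (\<Sum>l | is_partition n l \<and> gap_two l. length l)"
  unfolding r1_def by (intro sum_mono) (auto intro: gap_two_num_hooks_two)

lemma r2_one_le: "r2 1 n \<le> (\<Sum>l | is_partition n l \<and> parts_1_4_mod_5 l. card (set l))"
  unfolding r2_def by (intro sum_mono) (use num_hooks_one_le in auto)

text \<open>If \<open>s\<close> is 1 or 4 modulo 5 then \<open>s - 1\<close> is 0 or 3, so the sizes
  are isolated as \<open>num_hooks_two_ge\<close> requires.\<close>

lemma r2_two_ge: "(\<Sum>l | is_partition n l \<and> parts_1_4_mod_5 l. hook_lower l) \<le> r2 2 n"
  unfolding r2_def hook_lower_def
proof (intro sum_mono num_hooks_two_ge)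
  fix l s assume l: "l \<in> {l. is_partition n l \<and> parts_1_4_mod_5 l}" and s: "s \<in> set l"
  then have "s mod 5 = 1 \<or> s mod 5 = 4" by (auto simp: parts_1_4_mod_5_def)
  then have "\<not> ((s - 1) mod 5 = 1 \<or> (s - 1) mod 5 = 4)"
    by (cases s) (auto simp: mod_Suc split: if_splits)
  then show "s - 1 \<notin> set l" using l by (auto simp: parts_1_4_mod_5_def)
qed auto

lemma hooks_comparison_at:
  "\<exists>B>0. \<forall>\<^sub>F t in at_right 0. \<forall>n. real n * t\<^sup>2 = B \<longrightarrow> r2 1 n < r1 1 n \<and> r1 2 n < r2 2 n"
proof -
  obtain c1 where c1: "0 < c1" and t1: "\<forall>\<^sub>F t in at_right 0. \<forall>n.
     real (card {l. is_partition n l \<and> gap_two l \<and> real (length l) \<le> 45 / 100 / t}) * exp (- t) ^ n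
     \<le> rr_gf (exp (- t)) * exp (- (c1 / t))"
    using gap_few_parts by blast
  obtain c2 where c2: "0 < c2" and t2: "\<forall>\<^sub>F t in at_right 0. \<forall>n.
     real (card {l. is_partition n l \<and> gap_two l \<and> 52 / 100 / t \<le> real (length l)}) * exp (- t) ^ n
     \<le> (real n + 1) * (rr_gf (exp (- t)) * exp (- (c2 / t)))"
    using gap_many_parts by blast
  obtain c3 where c3: "0 < c3" and t3: "\<forall>\<^sub>F t in at_right 0. \<forall>n.
     real (card {l. is_partition n l \<and> parts_1_4_mod_5 l \<and> 44 / 100 / t \<le> real (card (set l))}) * exp (- t) ^ n
     \<le> rr_gf (exp (- t)) * exp (- (c3 / t))"
    using mod5_many_distinct by blast
  obtain c4 where c4: "0 < c4" and t4: "\<forall>\<^sub>F t in at_right 0. \<forall>n.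
     real (card {l. is_partition n l \<and> parts_1_4_mod_5 l \<and> real (hook_lower l) \<le> 55 / 100 / t}) * exp (- t) ^ n
     \<le> rr_gf (exp (- t)) * exp (- (c4 / t))"
    using mod5_few_hooks by blast
  define c where "c = Min {c1, c2, c3, c4}"
  have c: "0 < c" "c \<le> c1" "c \<le> c2" "c \<le> c3" "c \<le> c4"
    using c1 c2 c3 c4 by (auto simp: c_def)
  define A where "A = growth_const"
  have A: "0 < A" unfolding A_def by (rule growth_const_pos)
  \<comment> \<open>The rates are known by now, and \<delta> makes the loss
    \<open>3 * \<delta> * A\<close> of the coefficient bound at most half of the smallest
    rate.\<close>
  define \<delta> where "\<delta> = min 1 (c / (6 * A))"
  have \<delta>: "0 < \<delta>" "\<delta> \<le> 1" using c A by (auto simp: \<delta>_def)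
  have "\<delta> \<le> c / (6 * A)" by (simp add: \<delta>_def)
  then have \<delta>c: "3 * \<delta> * A \<le> c / 2" using A by (simp add: field_simps)
  define B where "B = (1 + \<delta>) * A"
  have B: "0 < B" using \<delta> A by (simp add: B_def)
  have tauber: "\<forall>\<^sub>F t in at_right 0. \<forall>N. real N * t\<^sup>2 = (1 + \<delta>) * A \<longrightarrow>
           exp (real N * t) * rr_gf (exp (- t)) \<le> real (mod5_count N) * exp (3 * \<delta> * A / t)"
    using mod5_partitions_gf_total rr_gf_pos rr_gf_growth A \<delta>
    by (intro monotone_coeff_lower_bound incseq_SucI) (auto simp: A_def mod5_count_Suc)
  \<comment> \<open>One factor \<open>n + 1\<close> comes from the bound in
    \<open>gap_many_parts\<close>, the other from charging up to \<open>n\<close> hooks to each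
    exceptional partition.\<close>
  have small: "\<forall>\<^sub>F t in at_right 0. (B / t\<^sup>2 + 1)\<^sup>2 * exp (- (c / 2 / t)) \<le> 1 / 1000"
  proof -
    have "\<forall>\<^sub>F t in at_right 0. (B / t\<^sup>2 + 1)\<^sup>2 * exp (- (K / t)) \<le> 1 / 1000" if "0 < K" for K :: real
      using that B by real_asymp
    from this[of "c / 2"] c show ?thesis by simp
  qed
  have tiny: "\<forall>\<^sub>F t in at_right 0. t < (1 :: real)"
    by real_asymp
  have "\<forall>\<^sub>F t in at_right 0. \<forall>n. real n * t\<^sup>2 = B \<longrightarrow> r2 1 n < r1 1 n \<and> r1 2 n < r2 2 n"
    using eventually_at_right_less[of "0::real"] tauber small tiny t1 t2 t3 t4
  proof eventually_elim
    case (elim t)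
    note t = elim(1)
    show ?case
    proof (intro allI impI)
      fix n assume n: "real n * t\<^sup>2 = B"
      define a where "a = real (mod5_count n)"
      have a: "1 \<le> a" using mod5_count_pos[of n] by (simp add: a_def)
      have n_eq: "real n = B / t\<^sup>2" using n t by (simp add: field_simps)
      \<comment> \<open>An exceptional set of size \<open>C\<close> is negligible even when each
        member is charged the trivial bound \<open>n\<close> on its statistic.\<close>
      have main: "(real n + 1) * C \<le> a / 1000"
        if C: "C * exp (- t) ^ n \<le> (real n + 1) * (rr_gf (exp (- t)) * exp (- (c' / t)))" and c': "c \<le> c'" for C c'
      proof -
        have rr: "0 < rr_gf (exp (- t))" using t by (intro rr_gf_pos) auto
        have e: "exp (real n * t) * exp (- t) ^ n = 1"
          by (simp flip: exp_of_nat_mult exp_add)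
        have "C = exp (real n * t) * (C * exp (- t) ^ n)"
          using e by (metis mult.left_commute mult.right_neutral)
        also have "\<dots> \<le> exp (real n * t) * ((real n + 1) * (rr_gf (exp (- t)) * exp (- (c / t))))"
        proof -
          have "exp (- (c' / t)) \<le> exp (- (c / t))" using c' t by (simp add: divide_right_mono)
          then have "(real n + 1) * (rr_gf (exp (- t)) * exp (- (c' / t))) \<le> (real n + 1) * (rr_gf (exp (- t)) * exp (- (c / t)))"
            using rr by (intro mult_left_mono) auto
          from order_trans[OF C this] show ?thesis by (rule mult_left_mono) simp
        qed
        also have "\<dots> = (real n + 1) * exp (- (c / t)) * (exp (real n * t) * rr_gf (exp (- t)))"
          by (simp add: mult_ac)
        also have "\<dots> \<le> (real n + 1) * exp (- (c / t)) * (a * exp (c / 2 / t))"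
        proof -
          have "exp (real n * t) * rr_gf (exp (- t)) \<le> a * exp (3 * \<delta> * A / t)"
            using elim(2) n unfolding a_def B_def by blast
          also have "\<dots> \<le> a * exp (c / 2 / t)"
            using a divide_right_mono[OF \<delta>c less_imp_le[OF t]] by (intro mult_left_mono) auto
          finally show ?thesis by (intro mult_left_mono) auto
        qed
        also have "\<dots> = (real n + 1) * a * exp (- (c / 2 / t))"
        proof -
          have "exp (- (c / t)) * exp (c / 2 / t) = exp (- (c / 2 / t))"
            by (simp flip: exp_add)
          then show ?thesis by (metis mult.assoc mult.commute)
        qed
        finally have "(real n + 1) * C \<le> (real n + 1) * ((real n + 1) * a * exp (- (c / 2 / t)))"
          by (intro mult_left_mono) auto
        also have "\<dots> = a * ((real n + 1)\<^sup>2 * exp (- (c / 2 / t)))"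
          by (simp add: power2_eq_square mult_ac)
        also have "\<dots> \<le> a * (1 / 1000)"
          using elim(3) a unfolding n_eq by (intro mult_left_mono) auto
        finally show ?thesis by simp
      qed
      have weaken: "C * x \<le> (real n + 1) * y" if "C * x \<le> y" "0 \<le> C * x" for C x y :: real
      proof -
        have "1 * y \<le> (real n + 1) * y"
          using that by (intro mult_right_mono) auto
        with that show ?thesis by simp
      qed
      define C1 where "C1 = real (card {l. is_partition n l \<and> gap_two l \<and> real (length l) \<le> 45 / 100 / t})"
      define C2 where "C2 = real (card {l. is_partition n l \<and> gap_two l \<and> 52 / 100 / t \<le> real (length l)})"
      define C3 where "C3 = real (card {l. is_partition n l \<and> parts_1_4_mod_5 l \<and> 44 / 100 / t \<le> real (card (set l))})"
      define C4 where "C4 = real (card {l. is_partition n l \<and> parts_1_4_mod_5 l \<and> real (hook_lower l) \<le> 55 / 100 / t})"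
      have C0: "0 \<le> C1" "0 \<le> C2" "0 \<le> C3" "0 \<le> C4" by (simp_all add: C1_def C2_def C3_def C4_def)
      have "(real n + 1) * C1 \<le> a / 1000"
        using elim(5) c C0 by (intro main[of _ c1] weaken) (auto simp: C1_def)
      moreover have "(real n + 1) * C2 \<le> a / 1000"
        using elim(6) c C0 by (intro main[of _ c2]) (auto simp: C2_def)
      moreover have "(real n + 1) * C3 \<le> a / 1000"
        using elim(7) c C0 by (intro main[of _ c3] weaken) (auto simp: C3_def)
      moreover have "(real n + 1) * C4 \<le> a / 1000"
        using elim(8) c C0 by (intro main[of _ c4] weaken) (auto simp: C4_def)
      moreover have "C \<le> (real n + 1) * C" "real n * C \<le> (real n + 1) * C" if "0 \<le> C" for C
        using that by (simp_all add: algebra_simps)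
      ultimately have tails: "C1 \<le> a / 1000" "real n * C2 \<le> a / 1000" "real n * C3 \<le> a / 1000" "C4 \<le> a / 1000"
        using C0 order_trans by blast+
      have card_gap: "real (card {l. is_partition n l \<and> gap_two l}) = a"
        using gap_count_eq_mod5_count[of n] by (simp add: a_def gap_count_def)
      have card_mod5: "real (card {l. is_partition n l \<and> parts_1_4_mod_5 l}) = a"
        by (simp add: a_def mod5_count_def)
      have conj: "{l \<in> {l. P l \<and> Q l}. R l} = {l. P l \<and> Q l \<and> R l}" for P Q R :: "nat list \<Rightarrow> bool"
        by auto
      \<comment> \<open>The tails cost at most \<open>a / 1000\<close> each or a thousandth of the
        main term, so with \<open>t < 1\<close> the margins of 0.44955 over 0.44 and of 0.54945 over
        0.52, in units of \<open>a / t\<close>, outweigh them.\<close>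
      have a_t: "a < a / t" using a t elim(4) by (simp add: less_divide_eq)
      have "45 / 100 / t * (a - C1) \<le> real (\<Sum>l | is_partition n l \<and> gap_two l. length l)"
        using sum_ge_of_few_small[OF finite_partitions_with[of n gap_two], of "45 / 100 / t" length] t
        unfolding conj card_gap C1_def[symmetric] by simp
      then have "45 / 100 / t * (a - C1) \<le> real (r1 1 n)"
        by (rule order_trans[OF _ of_nat_mono[OF r1_one_ge]])
      moreover have "real (r2 1 n) \<le> 44 / 100 / t * a + real n * C3"
      proof -
        have "real (card (set l)) \<le> real n" if "l \<in> {l. is_partition n l \<and> parts_1_4_mod_5 l}" for l
          using that card_length[of l] length_le_of_partition[of n l] by simp
        from sum_le_of_few_large[where f = "\<lambda>l. card (set l)", OF finite_partitions_with[of n parts_1_4_mod_5] _ this, of "44 / 100 / t"] t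
        have "real (\<Sum>l | is_partition n l \<and> parts_1_4_mod_5 l. card (set l)) \<le> 44 / 100 / t * a + real n * C3"
          unfolding conj card_mod5 C3_def[symmetric] by simp
        with of_nat_mono[OF r2_one_le] show ?thesis by (rule order_trans)
      qed
      moreover have "45 / 100 / t * (a - a / 1000) \<le> 45 / 100 / t * (a - C1)"
        using tails t by (intro mult_left_mono) auto
      moreover have "45 / 100 / t * (a - a / 1000) = 44955 / 100000 * (a / t)" "44 / 100 / t * a = 44 / 100 * (a / t)"
        by simp_all
      ultimately have 1: "real (r2 1 n) < real (r1 1 n)"
        using tails a_t a by linarith
      have "55 / 100 / t * (a - C4) \<le> real (\<Sum>l | is_partition n l \<and> parts_1_4_mod_5 l. hook_lower l)"
        using sum_ge_of_few_small[OF finite_partitions_with[of n parts_1_4_mod_5], of "55 / 100 / t" hook_lower] t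
        unfolding conj card_mod5 C4_def[symmetric] by simp
      then have "55 / 100 / t * (a - C4) \<le> real (r2 2 n)"
        by (rule order_trans[OF _ of_nat_mono[OF r2_two_ge]])
      moreover have "real (r1 2 n) \<le> 52 / 100 / t * a + real n * C2"
      proof -
        have "real (length l) \<le> real n" if "l \<in> {l. is_partition n l \<and> gap_two l}" for l
          using that length_le_of_partition[of n l] by simp
        from sum_le_of_few_large[where f = length, OF finite_partitions_with[of n gap_two] _ this, of "52 / 100 / t"] t
        have "real (\<Sum>l | is_partition n l \<and> gap_two l. length l) \<le> 52 / 100 / t * a + real n * C2"
          unfolding conj card_gap C2_def[symmetric] by simp
        with of_nat_mono[OF r1_two_le] show ?thesis by (rule order_trans)
      qed
      moreover have "55 / 100 / t * (a - a / 1000) \<le> 55 / 100 / t * (a - C4)"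
        using tails t by (intro mult_left_mono) auto
      moreover have "55 / 100 / t * (a - a / 1000) = 54945 / 100000 * (a / t)" "52 / 100 / t * a = 52 / 100 * (a / t)"
        by simp_all
      ultimately have 2: "real (r1 2 n) < real (r2 2 n)"
        using tails a_t a by linarith
      from 1 2 show "r2 1 n < r1 1 n \<and> r1 2 n < r2 2 n" by simp
    qed
  qed
  with B show ?thesis by blast
qed

theorem theorem1p2:
  shows "\<forall>\<^sub>F n in sequentially. r1 1 n > r2 1 n \<and> r1 2 n < r2 2 n"
proof -
  obtain B where B: "0 < B"
    and ev: "\<forall>\<^sub>F t in at_right 0. \<forall>n. real n * t\<^sup>2 = B \<longrightarrow> r2 1 n < r1 1 n \<and> r1 2 n < r2 2 n"
    using hooks_comparison_at by blast
  \<comment> \<open>For each positive \<open>n\<close> this is the \<open>t\<close> with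
    \<open>n t^2 = B\<close>, and it tends to 0 from the right.\<close>
  have "filterlim (\<lambda>n. sqrt (B / real n)) (at_right 0) sequentially"
    using B by real_asymp
  from eventually_compose_filterlim[OF ev this] eventually_gt_at_top[of 0]
  show ?thesis
    by eventually_elim (use B in auto)
qed

end
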